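(* Let $A\in\operatorname{M}_n(\mathbb{Z})$ be non-singular with $\mathcal{P}'\neq\emptyset$, let $F\subset\overline{\mathbb{Q}}$ be any finite extension of $\mathbb{Q}$ containing all eigenvalues of $A$, and assume $G_A$ has a characteristic $\{\alpha_{pij}\in\mathbb{Z}_p\mid p\in\mathcal{P}',\ 1\le i\le t_p<j\le n\}$ relative to the standard basis $\mathbf{e}_1,\ldots,\mathbf{e}_n$. For $T\in\operatorname{M}_n(\mathbb{Q})$, we have $T(G_A)\subseteq G_A$ if and only if $T\in\operatorname{M}_n(\mathcal{R})$ and, for every $p\in\mathcal{P}'$ and every prime ideal $\mathfrak p$ of $\mathcal{O}_F$ above $p$, we have $T(\mathcal{X}_{A,\mathfrak p})\subseteq\mathcal{X}_{A,\mathfrak p}$, and every $j$-th column $(\gamma_{1j},\ldots,\gamma_{nj})^t$ of $T$ with $j\in\{t_p+1,\ldots,n\}$ satisfies $$\gamma_{kj}-\sum_{i=1}^{t_p}\gamma_{ij}\alpha_{pik}\in\mathbb{Z}_p\quad\text{for all }k\in\{t_p+1,\ldots,n\}.$$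
   Context: $G_A=\{A^k\mathbf{x}\mid\mathbf{x}\in\mathbb{Z}^n,k\in\mathbb{Z}\}\subseteq\mathbb{Q}^n$; $\mathcal{R}=\mathbb{Z}[1/\det A]$; $h_A$ is the characteristic polynomial of $A$; $\mathcal{P}$ is the set of primes dividing $\det A$; $\mathcal{P}'=\{p\in\mathcal{P}\mid h_A\not\equiv x^n\pmod p\}$; $t_p$ is the multiplicity of $0$ as a root of $h_A$ mod $p$. $\mathcal{X}_{A,\mathfrak p}\subseteq F^n$ is the $F$-span of the generalized eigenvectors of $A$ for those eigenvalues $\lambda$ of $A$ with $\lambda\in\mathfrak p$ (i.e. divisible by $\mathfrak p$ in $\mathcal{O}_F$). For $a=\sum_{i\ge0}a_ip^i\in\mathbb{Z}_p$ with digits $a_i\in\{0,\ldots,p-1\}$ and $k\ge1$, $a^{(k)}=\sum_{i<k}a_ip^i\in\mathbb{Z}$; for $\mathbf{x}\in\mathbb{Z}_p^n$, $\mathbf{x}^{(k)}$ is defined componentwise, and $p^{-\infty}\mathbf{x}=\{p^{-k}\mathbf{x}^{(k)}\mid k\in\mathbb{N}\}\subset\mathbb{Q}^n$. A characteristic of $G_A$ relative to the standard basis is a family $\alpha_{pij}\in\mathbb{Z}_p$ ($p\in\mathcal{P}'$, $1\le i\le t_p<j\le n$) such that $G_A$ is generated as an abelian group by $\mathbf{e}_1,\ldots,\mathbf{e}_n$, the sets $q^{-\infty}\mathbf{e}_j$ for $q\in\mathcal{P}\setminus\mathcal{P}'$, $1\le j\le n$, and the sets $p^{-\infty}\mathbf{x}_{pi}$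 for $p\in\mathcal{P}'$, $1\le i\le t_p$, where $\mathbf{x}_{pi}=\mathbf{e}_i+\sum_{j=t_p+1}^n\alpha_{pij}\mathbf{e}_j$. *)

theory Defs
  imports
    "Jordan_Normal_Form.Char_Poly"
    "Jordan_Normal_Form.VS_Connect"
    "Berlekamp_Zassenhaus.Poly_Mod"
    "HOL-Algebra.Embedded_Algebras"
    "HOL-Algebra.Ideal"
begin

section \<open>The $p$-adic integers and the $p$-adic numbers\<close>

text \<open>
  $\mathbb{Z}_p$ is the inverse limit of the rings $\mathbb{Z}/p^k$: the entry \<open>a k\<close> of a compatible
  sequence is the residue of \<open>a\<close> modulo \<open>p ^ k\<close>, represented in \<open>{0..<p ^ k}\<close>. Since \<open>p\<close> varies
  in the statements below, these are rings with an explicit carrier rather than types.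
\<close>

definition padic_int :: "int \<Rightarrow> (nat \<Rightarrow> int) ring" where
  "padic_int p = \<lparr>
     carrier = {a. \<forall>k. a k \<in> {0..<p ^ k} \<and> a (Suc k) mod p ^ k = a k},
     monoid.mult = (\<lambda>a b k. (a k * b k) mod p ^ k),
     one = (\<lambda>k. 1 mod p ^ k),
     ring.zero = (\<lambda>k. 0),
     add = (\<lambda>a b k. (a k + b k) mod p ^ k)\<rparr>"

definition padic_of_int :: "int \<Rightarrow> int \<Rightarrow> nat \<Rightarrow> int" where
  "padic_of_int p z = (\<lambda>k. z mod p ^ k)"

definition padic_digit :: "int \<Rightarrow> (nat \<Rightarrow> int) \<Rightarrow> nat \<Rightarrow> int" where
  "padic_digit p a i = a (Suc i) div p ^ i"

definition padic_trunc :: "int \<Rightarrow> nat \<Rightarrow> (nat \<Rightarrow> int) \<Rightarrow> int" where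
  "padic_trunc p k a = (\<Sum>i<k. padic_digit p a i * p ^ i)"

lemma padic_digit_range:
  assumes "p > 0" "a \<in> carrier (padic_int p)"
  shows "padic_digit p a i \<in> {0..<p}"
proof -
  have "0 \<le> a (Suc i)" "a (Suc i) < p * p ^ i"
    using assms(2) by (auto simp: padic_int_def dest: spec[of _ "Suc i"])
  moreover from this(2) have "a (Suc i) div p ^ i < p"
    using assms(1) by (smt (verit, best) of_int_less_iff of_int_mult of_int_pos
        pos_le_divide_eq real_of_int_div4 zero_less_power)
  ultimately show ?thesis
    using assms(1) by (simp add: padic_digit_def pos_imp_zdiv_nonneg_iff)
qed

lemma padic_trunc_eq:
  assumes "a \<in> carrier (padic_int p)"
  shows "padic_trunc p k a = a k"
proof (induction k)
  case 0
  have "\<forall>k. a k \<in> {0..<p ^ k}" using assms by (simp add: padic_int_def)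
  from spec[OF this, of 0] have "a 0 = 0" by simp
  then show ?case by (simp add: padic_trunc_def)
next
  case (Suc k)
  have "a (Suc k) mod p ^ k = a k" using assms by (simp add: padic_int_def)
  then have "a k + a (Suc k) div p ^ k * p ^ k = a (Suc k)"
    using div_mult_mod_eq[of "a (Suc k)" "p ^ k"] by simp
  then show ?case using Suc by (simp add: padic_trunc_def padic_digit_def)
qed

definition frac_rel :: "('a, 'b) ring_scheme \<Rightarrow> (('a \<times> 'a) \<times> ('a \<times> 'a)) set" where
  "frac_rel R = {((a, b), (c, d)).
     a \<in> carrier R \<and> b \<in> carrier R - {\<zero>\<^bsub>R\<^esub>} \<and> c \<in> carrier R \<and> d \<in> carrier R - {\<zero>\<^bsub>R\<^esub>} \<and>
     a \<otimes>\<^bsub>R\<^esub> d = c \<otimes>\<^bsub>R\<^esub> b}"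

definition frac_class :: "('a, 'b) ring_scheme \<Rightarrow> 'a \<Rightarrow> 'a \<Rightarrow> ('a \<times> 'a) set" where
  "frac_class R a b = frac_rel R `` {(a, b)}"

definition fraction_field :: "('a, 'b) ring_scheme \<Rightarrow> ('a \<times> 'a) set ring" where
  "fraction_field R = \<lparr>
     carrier = (carrier R \<times> (carrier R - {\<zero>\<^bsub>R\<^esub>})) // frac_rel R,
     monoid.mult = (\<lambda>X Y. \<Union>(a, b)\<in>X. \<Union>(c, d)\<in>Y. frac_class R (a \<otimes>\<^bsub>R\<^esub> c) (b \<otimes>\<^bsub>R\<^esub> d)),
     one = frac_class R \<one>\<^bsub>R\<^esub> \<one>\<^bsub>R\<^esub>,
     ring.zero = frac_class R \<zero>\<^bsub>R\<^esub> \<one>\<^bsub>R\<^esub>,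
     add = (\<lambda>X Y. \<Union>(a, b)\<in>X. \<Union>(c, d)\<in>Y.
              frac_class R (a \<otimes>\<^bsub>R\<^esub> d \<oplus>\<^bsub>R\<^esub> c \<otimes>\<^bsub>R\<^esub> b) (b \<otimes>\<^bsub>R\<^esub> d))\<rparr>"

definition padic_field :: "int \<Rightarrow> ((nat \<Rightarrow> int) \<times> (nat \<Rightarrow> int)) set ring" where
  "padic_field p = fraction_field (padic_int p)"

definition padic_emb :: "int \<Rightarrow> (nat \<Rightarrow> int) \<Rightarrow> ((nat \<Rightarrow> int) \<times> (nat \<Rightarrow> int)) set" where
  "padic_emb p a = frac_class (padic_int p) a \<one>\<^bsub>padic_int p\<^esub>"

definition padic_of_rat :: "int \<Rightarrow> rat \<Rightarrow> ((nat \<Rightarrow> int) \<times> (nat \<Rightarrow> int)) set" where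
  "padic_of_rat p r = frac_class (padic_int p)
     (padic_of_int p (fst (quotient_of r))) (padic_of_int p (snd (quotient_of r)))"


section \<open>The group $G_A$ and its characteristic\<close>

definition mat_zpow :: "'a :: field mat \<Rightarrow> int \<Rightarrow> 'a mat" where
  "mat_zpow A k = (if k \<ge> 0 then A ^\<^sub>m nat k else the (mat_inverse A) ^\<^sub>m nat (- k))"

definition group_of_mat :: "int mat \<Rightarrow> rat vec set" where
  "group_of_mat A = {mat_zpow (map_mat rat_of_int A) k *\<^sub>v map_vec rat_of_int x | x k.
     x \<in> carrier_vec (dim_row A)}"

definition adjoin_inverse :: "int \<Rightarrow> rat set" where
  "adjoin_inverse d = range (\<lambda>f :: int poly. poly (map_poly rat_of_int f) (1 / rat_of_int d))"

definition primes_of_mat :: "int mat \<Rightarrow> int set" where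
  "primes_of_mat A = {p. prime p \<and> p dvd det A}"

definition primes_of_mat' :: "int mat \<Rightarrow> int set" where
  "primes_of_mat' A =
     {p \<in> primes_of_mat A. \<not> poly_mod.eq_m p (char_poly A) ([:0, 1:] ^ dim_row A)}"

text \<open>The analogue, for the reduction of \<open>f\<close> modulo \<open>p\<close>, of \<^const>\<open>Polynomial.order\<close>.\<close>

definition root_order_mod :: "int \<Rightarrow> int \<Rightarrow> int poly \<Rightarrow> nat" where
  "root_order_mod p a f = (LEAST k. \<not> poly_mod.dvdm p ([:- a, 1:] ^ Suc k) f)"

definition zero_mult :: "int mat \<Rightarrow> int \<Rightarrow> nat" where
  "zero_mult A p = root_order_mod p 0 (char_poly A)"

definition p_inf :: "int \<Rightarrow> (nat \<Rightarrow> int) vec \<Rightarrow> rat vec set" where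
  "p_inf p x = {(1 / rat_of_int p ^ k) \<cdot>\<^sub>v map_vec (\<lambda>a. rat_of_int (padic_trunc p k a)) x | k.
     k \<ge> 1}"

definition padic_unit_vec :: "int \<Rightarrow> nat \<Rightarrow> nat \<Rightarrow> (nat \<Rightarrow> int) vec" where
  "padic_unit_vec p n j = vec n (\<lambda>k. if k = j then \<one>\<^bsub>padic_int p\<^esub> else \<zero>\<^bsub>padic_int p\<^esub>)"

text \<open>
  The vector $e_i + \sum_{t \le j < n} \alpha_{pij} e_j$ of $\mathbb{Z}_p^n$, where $i < t$.
  Indices of vectors and matrices start at 0, so the informal ranges $1 \le i \le t_p$ and
  $t_p < j \le n$ become $i < t$ and $t \le j < n$.
\<close>

definition char_vec ::
  "(int \<Rightarrow> nat \<Rightarrow> nat \<Rightarrow> (nat \<Rightarrow> int)) \<Rightarrow> nat \<Rightarrow> nat \<Rightarrow> int \<Rightarrow> nat \<Rightarrow> (nat \<Rightarrow> int) vec" where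
  "char_vec \<alpha> n t p i = vec n (\<lambda>k.
     if k = i then \<one>\<^bsub>padic_int p\<^esub> else if k < t then \<zero>\<^bsub>padic_int p\<^esub> else \<alpha> p i k)"

definition is_characteristic ::
  "int mat \<Rightarrow> (int \<Rightarrow> nat \<Rightarrow> nat \<Rightarrow> (nat \<Rightarrow> int)) \<Rightarrow> bool" where
  "is_characteristic A \<alpha> \<longleftrightarrow> (let n = dim_row A in
     (\<forall>p\<in>primes_of_mat' A. \<forall>i<zero_mult A p. \<forall>j\<in>{zero_mult A p..<n}.
        \<alpha> p i j \<in> carrier (padic_int p)) \<and>
     group_of_mat A = generate (monoid_vec TYPE(rat) n)
       (unit_vec n ` {..<n}
        \<union> (\<Union>q\<in>primes_of_mat A - primes_of_mat' A. \<Union>j<n. p_inf q (padic_unit_vec q n j))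
        \<union> (\<Union>p\<in>primes_of_mat' A. \<Union>i<zero_mult A p.
             p_inf p (char_vec \<alpha> n (zero_mult A p) p i))))"


section \<open>Number fields and generalized eigenvectors\<close>

text \<open>$\overline{\mathbb{Q}}$ is the algebraic closure of the rationals inside the complex numbers.\<close>

definition number_field :: "complex set \<Rightarrow> bool" where
  "number_field F \<longleftrightarrow> subfield F (class_ring :: complex ring) \<and>
     ring.finite_dimension (class_ring :: complex ring) \<rat> F"

definition ring_of_integers :: "complex set \<Rightarrow> complex ring" where
  "ring_of_integers F = class_ring\<lparr>carrier := {x \<in> F. algebraic_int x}\<rparr>"

definition prime_above :: "complex set \<Rightarrow> int \<Rightarrow> complex set \<Rightarrow> bool" where
  "prime_above F p P \<longleftrightarrow> primeideal P (ring_of_integers F) \<and>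
     P \<inter> \<int> = range (\<lambda>k. complex_of_int (p * k))"

definition generalized_eigenvector :: "'a :: field mat \<Rightarrow> 'a vec \<Rightarrow> 'a \<Rightarrow> bool" where
  "generalized_eigenvector A v k \<longleftrightarrow>
     v \<in> carrier_vec (dim_row A) \<and> v \<noteq> 0\<^sub>v (dim_row A) \<and>
     (\<exists>m. char_matrix A k ^\<^sub>m m *\<^sub>v v = 0\<^sub>v (dim_row A))"

definition eigenspace_at :: "complex set \<Rightarrow> int mat \<Rightarrow> complex set \<Rightarrow> complex vec set" where
  "eigenspace_at F A P = LinearCombinations.module.span
     (class_ring\<lparr>carrier := F\<rparr>) (module_vec TYPE(complex) (dim_row A))
     {v. set\<^sub>v v \<subseteq> F \<and>
         (\<exists>l\<in>P. eigenvalue (map_mat of_int A) l \<and> generalized_eigenvector (map_mat of_int A) v l)}"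

end

theory Submission
  imports Defs "HOL-Number_Theory.Cong" "Jordan_Normal_Form.Schur_Decomposition"
begin

text \<open>
  A rational vector \<open>v\<close> lies in \<open>G\<^sub>A\<close> iff for every prime \<open>p\<close> some \<open>A\<^sup>l v\<close> is \<open>p\<close>-integral. This is
  \<open>p\<close>-integrality of \<open>v\<close> if \<open>p\<close> does not divide the determinant, no condition if \<open>p\<close> is in \<open>\<P> - \<P>'\<close>, and for
  \<open>p\<close> in \<open>\<P>'\<close> the characteristic turns it into \<open>p\<close>-adic integrality of the linear forms
  \<open>v\<^sub>k - \<Sum>\<^sub>i v\<^sub>i \<alpha>\<^sub>p\<^sub>i\<^sub>k\<close>, whence the condition on the columns of \<open>T\<close>.

  No completion is needed to bring in the eigenspaces: in the localization of \<open>\<O>\<^sub>F\<close> at a prime above \<open>p\<close>,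
  with the powers of \<open>p\<close> as neighbourhoods of 0, the eigenspace consists of the \<open>v\<close> with \<open>A\<^sup>m v \<longrightarrow> 0\<close>,
  while \<open>A\<close> preserves divisibility by powers of \<open>p\<close> in both directions on the sum of the other generalized
  eigenspaces. If \<open>T\<close> maps \<open>G\<^sub>A\<close> to itself, then each \<open>T A\<^sup>-\<^sup>k\<close> becomes integral after multiplication
  by a power of \<open>A\<close>, so \<open>T\<close> preserves the condition \<open>A\<^sup>m v \<longrightarrow> 0\<close>. Conversely, by the pigeonhole principle there
  are \<open>m\<close> for which \<open>A\<^sup>m\<close> is idempotent modulo a high power of \<open>p\<close>; then \<open>A\<^sup>m\<close> is close to the
  projection with kernel the eigenspace, and stability of the latter makes \<open>A\<^sup>m T (1 - A\<^sup>m)\<close> divisible by a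
  high power of \<open>p\<close>, so that \<open>T g\<close> and \<open>T A\<^sup>m g\<close> agree modulo the localization of \<open>G\<^sub>A\<close>, where
  \<open>A\<^sup>m g\<close> is integral for \<open>g \<in> G\<^sub>A\<close>.
\<close>

section \<open>The $p$-adic field and $p$-integral rationals\<close>

text \<open>The eigenspaces are defined over \<open>F\<close>, while \<open>T\<close>, G_A and the
  conclusion are rational. Divisibility is therefore measured by powers of the rational prime p even
  at P: the two scales then agree on rational numbers (\<open>ldiv_of_rat_iff\<close>), and no
  uniformizer or ramification index enters. The price is that an eigenvalue in P need not be
  divisible by p; only some power of it is, whence the periodicity argument for eigenvalues and the
  contraction in blocks of several steps. \<open>T\<close> need not commute with \<open>A\<close>,
  so polynomials in \<open>A\<close> cannot be moved past \<open>T\<close>; this is why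
  \<open>T\<close> appears flanked by powers of \<open>A\<close>. Denominators dictate the order of
  choices: first the precision N, from the vector g, then K, which absorbs the denominators of
  \<open>T\<close> and of the components over \<open>F\<close>, then m, for which A^m is idempotent
  modulo p^K. Conditions that persist for larger exponents are stated with
  \<open>eventually\<close>, so that finitely many coordinates or primes can share one
  exponent.\<close>

context domain
begin

lemma equiv_frac_rel: "equiv (carrier R \<times> (carrier R - {\<zero>})) (frac_rel R)"
proof (rule equivI)
  show "frac_rel R \<subseteq> (carrier R \<times> (carrier R - {\<zero>})) \<times> (carrier R \<times> (carrier R - {\<zero>}))"
    by (auto simp: frac_rel_def)
  show "refl_on (carrier R \<times> (carrier R - {\<zero>})) (frac_rel R)"
    by (auto simp: refl_on_def frac_rel_def)
  show "sym (frac_rel R)" by (auto simp: sym_def frac_rel_def)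
  show "trans (frac_rel R)"
  proof (rule transI)
    fix x y z assume *: "(x, y) \<in> frac_rel R" "(y, z) \<in> frac_rel R"
    obtain a b c d e f where x: "x = (a, b)" "y = (c, d)" "z = (e, f)" by (metis prod.exhaust)
    from * have cl: "a \<in> carrier R" "b \<in> carrier R" "c \<in> carrier R" "d \<in> carrier R"
        "e \<in> carrier R" "f \<in> carrier R"
      and nz: "b \<noteq> \<zero>" "d \<noteq> \<zero>" "f \<noteq> \<zero>" and eq: "a \<otimes> d = c \<otimes> b" "c \<otimes> f = e \<otimes> d"
      by (auto simp: x frac_rel_def)
    have "(a \<otimes> f) \<otimes> d = (a \<otimes> d) \<otimes> f" using cl by (simp add: m_ac)
    also have "\<dots> = (c \<otimes> f) \<otimes> b" using cl by (simp add: eq(1) m_ac)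
    also have "\<dots> = (e \<otimes> b) \<otimes> d" using cl by (simp add: eq(2) m_ac)
    finally have "a \<otimes> f = e \<otimes> b" using m_rcancel[OF nz(2) cl(4)] cl by simp
    then show "(x, z) \<in> frac_rel R" using cl nz by (auto simp: x frac_rel_def)
  qed
qed

lemma frac_class_eq_iff:
  assumes "a \<in> carrier R" "b \<in> carrier R - {\<zero>}" "c \<in> carrier R" "d \<in> carrier R - {\<zero>}"
  shows "frac_class R a b = frac_class R c d \<longleftrightarrow> a \<otimes> d = c \<otimes> b"
  using eq_equiv_class_iff[OF equiv_frac_rel, of "(a, b)" "(c, d)"] assms
  by (simp add: frac_class_def frac_rel_def)

lemma mem_frac_class:
  "x \<in> frac_class R a b \<longleftrightarrow> (\<exists>c d. x = (c, d) \<and> ((a, b), (c, d)) \<in> frac_rel R)"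
  by (cases x) (auto simp: frac_class_def)

lemma frac_class_closed:
  assumes "a \<in> carrier R" "b \<in> carrier R - {\<zero>}"
  shows "frac_class R a b \<in> carrier (fraction_field R)"
  using assms by (auto simp: fraction_field_def frac_class_def intro: quotientI)

lemma fraction_field_cases:
  assumes "x \<in> carrier (fraction_field R)"
  obtains a b where "a \<in> carrier R" "b \<in> carrier R - {\<zero>}" "x = frac_class R a b"
  using assms by (auto simp: fraction_field_def frac_class_def elim!: quotientE)

text \<open>Sum and product in \<open>fraction_field\<close> are unions over all pairs of
  representatives. Such a union collapses to a single class as soon as \<open>f\<close> takes the
  same value at every pair.\<close>

lemma frac_class_Union:
  assumes "a \<in> carrier R" "b \<in> carrier R - {\<zero>}" "c \<in> carrier R" "d \<in> carrier R - {\<zero>}"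
    and "\<And>a' b' c' d'. \<lbrakk>a' \<in> carrier R; b' \<in> carrier R - {\<zero>}; c' \<in> carrier R; d' \<in> carrier R - {\<zero>};
      a \<otimes> b' = a' \<otimes> b; c \<otimes> d' = c' \<otimes> d\<rbrakk> \<Longrightarrow> f a' b' c' d' = f a b c d"
  shows "(\<Union>(a', b')\<in>frac_class R a b. \<Union>(c', d')\<in>frac_class R c d. f a' b' c' d') = f a b c d"
proof -
  have "f a' b' c' d' = f a b c d"
    if "(a', b') \<in> frac_class R a b" "(c', d') \<in> frac_class R c d" for a' b' c' d'
    using that by (intro assms(5)) (auto simp: mem_frac_class frac_rel_def)
  moreover have "(a, b) \<in> frac_class R a b" "(c, d) \<in> frac_class R c d"
    using assms(1-4) by (auto simp: mem_frac_class frac_rel_def)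
  ultimately show ?thesis by blast
qed

lemma frac_class_add:
  assumes "a \<in> carrier R" "b \<in> carrier R - {\<zero>}" "c \<in> carrier R" "d \<in> carrier R - {\<zero>}"
  shows "frac_class R a b \<oplus>\<^bsub>fraction_field R\<^esub> frac_class R c d =
    frac_class R (a \<otimes> d \<oplus> c \<otimes> b) (b \<otimes> d)"
  unfolding fraction_field_def ring.simps
proof (rule frac_class_Union[OF assms])
  fix a' b' c' d'
  assume *: "a' \<in> carrier R" "b' \<in> carrier R - {\<zero>}" "c' \<in> carrier R" "d' \<in> carrier R - {\<zero>}"
    and eq: "a \<otimes> b' = a' \<otimes> b" "c \<otimes> d' = c' \<otimes> d"
  have "(a \<otimes> d \<oplus> c \<otimes> b) \<otimes> (b' \<otimes> d') = (a \<otimes> b') \<otimes> (d \<otimes> d') \<oplus> (c \<otimes> d') \<otimes> (b \<otimes> b')"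
    using * assms by (simp add: l_distr r_distr m_ac)
  also have "\<dots> = (a' \<otimes> d' \<oplus> c' \<otimes> b') \<otimes> (b \<otimes> d)"
    unfolding eq using * assms by (simp add: l_distr r_distr m_ac)
  finally show "frac_class R (a' \<otimes> d' \<oplus> c' \<otimes> b') (b' \<otimes> d') = frac_class R (a \<otimes> d \<oplus> c \<otimes> b) (b \<otimes> d)"
    using * assms by (subst frac_class_eq_iff) (auto simp: integral_iff)
qed

lemma frac_class_mult:
  assumes "a \<in> carrier R" "b \<in> carrier R - {\<zero>}" "c \<in> carrier R" "d \<in> carrier R - {\<zero>}"
  shows "frac_class R a b \<otimes>\<^bsub>fraction_field R\<^esub> frac_class R c d =
    frac_class R (a \<otimes> c) (b \<otimes> d)"
  unfolding fraction_field_def monoid.simps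
proof (rule frac_class_Union[OF assms])
  fix a' b' c' d'
  assume *: "a' \<in> carrier R" "b' \<in> carrier R - {\<zero>}" "c' \<in> carrier R" "d' \<in> carrier R - {\<zero>}"
    and eq: "a \<otimes> b' = a' \<otimes> b" "c \<otimes> d' = c' \<otimes> d"
  have "(a \<otimes> c) \<otimes> (b' \<otimes> d') = (a \<otimes> b') \<otimes> (c \<otimes> d')" using * assms by (simp add: m_ac)
  also have "\<dots> = (a' \<otimes> c') \<otimes> (b \<otimes> d)" unfolding eq using * assms by (simp add: m_ac)
  finally show "frac_class R (a' \<otimes> c') (b' \<otimes> d') = frac_class R (a \<otimes> c) (b \<otimes> d)"
    using * assms by (subst frac_class_eq_iff) (auto simp: integral_iff)
qed

text \<open>The fraction (ad + cd)/(dd) cancels to (a + c)/d. Over one common denominator, sums and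
  differences in the fraction field are computed on numerators.\<close>

lemma frac_class_add_same:
  assumes "a \<in> carrier R" "c \<in> carrier R" "d \<in> carrier R - {\<zero>}"
  shows "frac_class R a d \<oplus>\<^bsub>fraction_field R\<^esub> frac_class R c d = frac_class R (a \<oplus> c) d"
  using assms
  by (subst frac_class_add, simp_all, subst frac_class_eq_iff)
     (auto simp: integral_iff l_distr r_distr m_ac)

lemma abelian_group_fraction_field: "abelian_group (fraction_field R)"
proof -
  have zero: "\<zero>\<^bsub>fraction_field R\<^esub> = frac_class R \<zero> \<one>" by (simp add: fraction_field_def)
  show ?thesis
  proof (rule abelian_groupI)
    show "\<zero>\<^bsub>fraction_field R\<^esub> \<in> carrier (fraction_field R)"
      unfolding zero by (rule frac_class_closed) auto
  next
    fix x y assume "x \<in> carrier (fraction_field R)" "y \<in> carrier (fraction_field R)"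
    then obtain a b c d where *: "a \<in> carrier R" "b \<in> carrier R - {\<zero>}" "x = frac_class R a b"
      "c \<in> carrier R" "d \<in> carrier R - {\<zero>}" "y = frac_class R c d"
      by (metis fraction_field_cases)
    then show "x \<oplus>\<^bsub>fraction_field R\<^esub> y \<in> carrier (fraction_field R)"
      by (auto simp: frac_class_add integral_iff intro!: frac_class_closed)
    show "x \<oplus>\<^bsub>fraction_field R\<^esub> y = y \<oplus>\<^bsub>fraction_field R\<^esub> x"
      using * by (auto simp: frac_class_add m_comm a_comm)
  next
    fix x y z assume "x \<in> carrier (fraction_field R)" "y \<in> carrier (fraction_field R)"
      "z \<in> carrier (fraction_field R)"
    then obtain a b c d e f where *: "a \<in> carrier R" "b \<in> carrier R - {\<zero>}" "x = frac_class R a b"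
      "c \<in> carrier R" "d \<in> carrier R - {\<zero>}" "y = frac_class R c d"
      "e \<in> carrier R" "f \<in> carrier R - {\<zero>}" "z = frac_class R e f"
      by (metis fraction_field_cases)
    then show "x \<oplus>\<^bsub>fraction_field R\<^esub> y \<oplus>\<^bsub>fraction_field R\<^esub> z =
        x \<oplus>\<^bsub>fraction_field R\<^esub> (y \<oplus>\<^bsub>fraction_field R\<^esub> z)"
      by (simp add: frac_class_add integral_iff l_distr r_distr m_ac a_ac)
  next
    fix x assume "x \<in> carrier (fraction_field R)"
    then obtain a b where *: "a \<in> carrier R" "b \<in> carrier R - {\<zero>}" "x = frac_class R a b"
      by (metis fraction_field_cases)
    then show "\<zero>\<^bsub>fraction_field R\<^esub> \<oplus>\<^bsub>fraction_field R\<^esub> x = x"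
      by (simp add: zero frac_class_add)
    have "frac_class R (\<ominus> a) b \<oplus>\<^bsub>fraction_field R\<^esub> x = \<zero>\<^bsub>fraction_field R\<^esub>"
      using * by (simp add: frac_class_add_same l_neg zero frac_class_eq_iff)
    moreover have "frac_class R (\<ominus> a) b \<in> carrier (fraction_field R)"
      using * by (auto intro: frac_class_closed)
    ultimately show "\<exists>y\<in>carrier (fraction_field R).
        y \<oplus>\<^bsub>fraction_field R\<^esub> x = \<zero>\<^bsub>fraction_field R\<^esub>" by blast
  qed
qed

lemma frac_class_minus_same:
  assumes "a \<in> carrier R" "c \<in> carrier R" "d \<in> carrier R - {\<zero>}"
  shows "frac_class R a d \<ominus>\<^bsub>fraction_field R\<^esub> frac_class R c d = frac_class R (a \<ominus> c) d"
proof -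
  interpret K: abelian_group "fraction_field R" by (rule abelian_group_fraction_field)
  have "frac_class R (a \<ominus> c) d \<oplus>\<^bsub>fraction_field R\<^esub> frac_class R c d = frac_class R a d"
    using assms by (simp add: frac_class_add_same a_minus_def a_assoc l_neg)
  moreover have "frac_class R (a \<ominus> c) d \<in> carrier (fraction_field R)"
    "frac_class R c d \<in> carrier (fraction_field R)"
    using assms by (auto intro!: frac_class_closed)
  ultimately show ?thesis
    by (metis K.minus_eq K.add.inv_solve_right K.a_closed)
qed

lemma frac_class_finsum_same:
  assumes "finite I" "\<And>i. i \<in> I \<Longrightarrow> a i \<in> carrier R" "d \<in> carrier R - {\<zero>}"
  shows "(\<Oplus>\<^bsub>fraction_field R\<^esub>i\<in>I. frac_class R (a i) d) = frac_class R (\<Oplus>i\<in>I. a i) d"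
proof -
  interpret K: abelian_group "fraction_field R" by (rule abelian_group_fraction_field)
  show ?thesis
    using assms(1,2)
  proof (induction I)
    case empty
    have "\<zero>\<^bsub>fraction_field R\<^esub> = frac_class R \<zero> \<one>" by (simp add: fraction_field_def)
    then show ?case using assms(3) by (auto simp: frac_class_eq_iff)
  next
    case (insert x I)
    have "(\<Oplus>\<^bsub>fraction_field R\<^esub>i\<in>insert x I. frac_class R (a i) d) =
        frac_class R (a x) d \<oplus>\<^bsub>fraction_field R\<^esub> (\<Oplus>\<^bsub>fraction_field R\<^esub>i\<in>I. frac_class R (a i) d)"
      using insert assms(3) by (intro K.finsum_insert) (auto intro!: frac_class_closed)
    also have "\<dots> = frac_class R (a x \<oplus> (\<Oplus>i\<in>I. a i)) d"
      using insert assms(3) finsum_closed[of a I] by (simp add: frac_class_add_same Pi_def)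
    also have "a x \<oplus> (\<Oplus>i\<in>I. a i) = (\<Oplus>i\<in>insert x I. a i)"
      using insert by (intro finsum_insert[symmetric]) auto
    finally show ?case .
  qed
qed

end

section \<open>The ring of p-adic integers as compatible sequences of residues\<close>

lemma padic_int_carrierI:
  assumes "\<And>k. 0 \<le> a k" "\<And>k. a k < p ^ k" "\<And>k. a (Suc k) mod p ^ k = a k"
  shows "a \<in> carrier (padic_int p)"
  using assms by (simp add: padic_int_def)

lemma padic_int_mod:
  assumes "a \<in> carrier (padic_int p)" "k \<le> m"
  shows "a m mod p ^ k = a k"
  using assms(2)
proof (induction m rule: dec_induct)
  case base
  have "0 \<le> a k" "a k < p ^ k" using assms(1) by (auto simp: padic_int_def)
  then show ?case by simp
next
  case (step m)
  have "a (Suc m) mod p ^ k = (a (Suc m) mod p ^ m) mod p ^ k"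
    using step(1) by (simp add: le_imp_power_dvd mod_mod_cancel)
  also have "\<dots> = a k" using assms(1) step by (simp add: padic_int_def)
  finally show ?case .
qed

lemma padic_int_self_mod:
  "a \<in> carrier (padic_int p) \<Longrightarrow> a k mod p ^ k = a k"
  by (rule padic_int_mod) auto

lemma padic_of_int_closed:
  assumes "p > 0"
  shows "padic_of_int p z \<in> carrier (padic_int p)"
  using assms by (intro padic_int_carrierI) (auto simp: padic_of_int_def mod_mod_cancel)

text \<open>\<open>p ^ |z|\<close> exceeds |z|, so a nonzero \<open>z\<close> has a nonzero residue
  modulo this power. Hence nonzero integers may serve as denominators in
  \<open>padic_field\<close>.\<close>

lemma padic_of_int_eq_zero_iff:
  assumes "p > 1"
  shows "padic_of_int p z = \<zero>\<^bsub>padic_int p\<^esub> \<longleftrightarrow> z = 0"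
proof
  assume "padic_of_int p z = \<zero>\<^bsub>padic_int p\<^esub>"
  then have *: "p ^ k dvd z" for k
    by (auto simp: padic_of_int_def padic_int_def fun_eq_iff mod_eq_0_iff_dvd)
  show "z = 0"
  proof (rule ccontr)
    assume "z \<noteq> 0"
    have "\<bar>z\<bar> < 2 ^ nat \<bar>z\<bar>"
      by (metis abs_ge_zero int_nat_eq of_nat_less_two_power of_nat_numeral of_nat_power)
    also have "(2::int) ^ nat \<bar>z\<bar> \<le> p ^ nat \<bar>z\<bar>" using assms by (intro power_mono) auto
    finally show False using dvd_imp_le_int[OF \<open>z \<noteq> 0\<close> *[of "nat \<bar>z\<bar>"]] assms by simp
  qed
qed (auto simp: padic_of_int_def padic_int_def)

lemma cring_padic_int:
  assumes "p > 0"
  shows "cring (padic_int p)"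
proof (rule cringI)
  note defs = padic_int_def
  show "abelian_group (padic_int p)"
  proof (rule abelian_groupI)
    fix x assume x: "x \<in> carrier (padic_int p)"
    let ?y = "\<lambda>k. (- x k) mod p ^ k"
    have "?y \<in> carrier (padic_int p)"
    proof (rule padic_int_carrierI)
      fix k
      have "(- x (Suc k) mod p ^ Suc k) mod p ^ k = (- x (Suc k)) mod p ^ k"
        by (simp add: mod_mod_cancel)
      also have "\<dots> = (- (x (Suc k) mod p ^ k)) mod p ^ k" by (simp add: mod_minus_eq)
      also have "x (Suc k) mod p ^ k = x k" by (rule padic_int_mod[OF x]) simp
      finally show "(- x (Suc k) mod p ^ Suc k) mod p ^ k = - x k mod p ^ k" .
    qed (use assms in auto)
    moreover have "?y \<oplus>\<^bsub>padic_int p\<^esub> x = \<zero>\<^bsub>padic_int p\<^esub>"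
      by (simp add: defs mod_add_left_eq fun_eq_iff)
    ultimately show "\<exists>y\<in>carrier (padic_int p). y \<oplus>\<^bsub>padic_int p\<^esub> x = \<zero>\<^bsub>padic_int p\<^esub>" by blast
  next
    fix x y assume x: "x \<in> carrier (padic_int p)" and y: "y \<in> carrier (padic_int p)"
    have "(\<lambda>k. (x k + y k) mod p ^ k) \<in> carrier (padic_int p)"
    proof (rule padic_int_carrierI)
      fix k
      have "(x (Suc k) + y (Suc k)) mod p ^ Suc k mod p ^ k = (x (Suc k) + y (Suc k)) mod p ^ k"
        by (simp add: mod_mod_cancel)
      also have "\<dots> = (x (Suc k) mod p ^ k + y (Suc k) mod p ^ k) mod p ^ k"
        by (simp add: mod_add_eq)
      finally show "(x (Suc k) + y (Suc k)) mod p ^ Suc k mod p ^ k = (x k + y k) mod p ^ k"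
        using padic_int_mod[OF x, of k "Suc k"] padic_int_mod[OF y, of k "Suc k"] by simp
    qed (use assms in auto)
    then show "x \<oplus>\<^bsub>padic_int p\<^esub> y \<in> carrier (padic_int p)" by (simp add: defs)
  qed (use assms in \<open>auto simp: defs fun_eq_iff mod_add_left_eq mod_add_right_eq ac_simps\<close>)
  show "Group.comm_monoid (padic_int p)"
  proof (rule comm_monoidI)
    fix x y assume x: "x \<in> carrier (padic_int p)" and y: "y \<in> carrier (padic_int p)"
    have "(\<lambda>k. (x k * y k) mod p ^ k) \<in> carrier (padic_int p)"
    proof (rule padic_int_carrierI)
      fix k
      have "(x (Suc k) * y (Suc k)) mod p ^ Suc k mod p ^ k = (x (Suc k) * y (Suc k)) mod p ^ k"
        by (simp add: mod_mod_cancel)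
      also have "\<dots> = ((x (Suc k) mod p ^ k) * (y (Suc k) mod p ^ k)) mod p ^ k"
        by (simp add: mod_mult_eq)
      finally show "(x (Suc k) * y (Suc k)) mod p ^ Suc k mod p ^ k = (x k * y k) mod p ^ k"
        using padic_int_mod[OF x, of k "Suc k"] padic_int_mod[OF y, of k "Suc k"] by simp
    qed (use assms in auto)
    then show "x \<otimes>\<^bsub>padic_int p\<^esub> y \<in> carrier (padic_int p)" by (simp add: defs)
  next
    show "\<one>\<^bsub>padic_int p\<^esub> \<in> carrier (padic_int p)"
      using padic_of_int_closed[OF assms, of 1] by (simp add: padic_of_int_def padic_int_def)
  qed (use assms in \<open>auto simp: defs fun_eq_iff mod_mult_left_eq mod_mult_right_eq ac_simps\<close>)
  show "\<And>x y z. x \<in> carrier (padic_int p) \<Longrightarrow> y \<in> carrier (padic_int p) \<Longrightarrow>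
      z \<in> carrier (padic_int p) \<Longrightarrow>
      (x \<oplus>\<^bsub>padic_int p\<^esub> y) \<otimes>\<^bsub>padic_int p\<^esub> z =
      x \<otimes>\<^bsub>padic_int p\<^esub> z \<oplus>\<^bsub>padic_int p\<^esub> y \<otimes>\<^bsub>padic_int p\<^esub> z"
    by (simp add: defs fun_eq_iff mod_mult_left_eq mod_add_eq distrib_right)
qed

text \<open>Multiplicities of nonzero factors add. Read contrapositively: residues that are nonzero
  at levels \<open>k\<close> and \<open>l\<close> have a product that is nonzero at level
  \<open>k + l\<close>, which makes the p-adic integers a domain.\<close>

lemma prime_power_dvd_mult_cases:
  fixes p x y :: int
  assumes "prime p" "p ^ (k + l) dvd x * y" "\<not> p ^ k dvd x"
  shows "p ^ l dvd y"
proof (cases "y = 0")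
  case False
  have "x \<noteq> 0" using assms(3) by auto
  have "multiplicity p x < k" using assms \<open>x \<noteq> 0\<close> power_dvd_iff_le_multiplicity[of x p k]
    prime_gt_1_int[OF assms(1)] by (auto simp: not_le)
  moreover have "k + l \<le> multiplicity p (x * y)"
    using assms False \<open>x \<noteq> 0\<close> power_dvd_iff_le_multiplicity[of "x * y" p "k + l"]
      prime_gt_1_int[OF assms(1)] by auto
  moreover have "multiplicity p (x * y) = multiplicity p x + multiplicity p y"
    using assms False \<open>x \<noteq> 0\<close> by (intro prime_elem_multiplicity_mult_distrib prime_imp_prime_elem)
  ultimately show ?thesis by (intro multiplicity_dvd') auto
qed auto

lemma domain_padic_int:
  assumes "prime p"
  shows "domain (padic_int p)"
proof -
  have p: "p > 1" using assms by (rule prime_gt_1_int)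
  interpret cring "padic_int p" using p by (intro cring_padic_int) auto
  show ?thesis
  proof (unfold_locales)
    have "padic_of_int p 1 \<noteq> \<zero>\<^bsub>padic_int p\<^esub>" using padic_of_int_eq_zero_iff[OF p, of 1] by simp
    then show "\<one>\<^bsub>padic_int p\<^esub> \<noteq> \<zero>\<^bsub>padic_int p\<^esub>" by (simp add: padic_of_int_def padic_int_def)
  next
    fix a b assume ab: "a \<otimes>\<^bsub>padic_int p\<^esub> b = \<zero>\<^bsub>padic_int p\<^esub>"
      and a: "a \<in> carrier (padic_int p)" and b: "b \<in> carrier (padic_int p)"
    show "a = \<zero>\<^bsub>padic_int p\<^esub> \<or> b = \<zero>\<^bsub>padic_int p\<^esub>"
    proof (rule ccontr)
      assume "\<not> ?thesis"
      then obtain k l where kl: "a k \<noteq> 0" "b l \<noteq> 0" by (auto simp: padic_int_def fun_eq_iff)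
      have "p ^ (k + l) dvd a (k + l) * b (k + l)"
        using ab by (auto simp: padic_int_def fun_eq_iff mod_eq_0_iff_dvd)
      moreover have "\<not> p ^ k dvd a (k + l)"
        using kl padic_int_mod[OF a, of k "k + l"] by (auto simp: dvd_eq_mod_eq_0)
      moreover have "\<not> p ^ l dvd b (k + l)"
        using kl padic_int_mod[OF b, of l "k + l"] by (auto simp: dvd_eq_mod_eq_0)
      ultimately show False using prime_power_dvd_mult_cases[OF assms] by blast
    qed
  qed
qed

lemma padic_of_int_mult:
  "padic_of_int p (x * y) = padic_of_int p x \<otimes>\<^bsub>padic_int p\<^esub> padic_of_int p y"
  by (simp add: padic_of_int_def padic_int_def fun_eq_iff mod_mult_eq)

text \<open>\<open>padic_of_rat\<close> goes through the reduced fraction given by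
  \<open>quotient_of\<close>; cross-multiplication shows that any other fraction yields the same
  class. This permits a common denominator for all rationals in a sum.\<close>

lemma padic_of_rat_divide:
  assumes "prime p" "d \<noteq> 0"
  shows "padic_of_rat p (of_int c / of_int d) =
    frac_class (padic_int p) (padic_of_int p c) (padic_of_int p d)"
proof -
  have p: "p > 1" using assms(1) by (rule prime_gt_1_int)
  interpret domain "padic_int p" using assms(1) by (rule domain_padic_int)
  obtain x y where xy: "quotient_of (of_int c / of_int d) = (x, y)" by force
  have y: "y > 0" using quotient_of_denom_pos[OF xy] .
  have "of_int c / of_int d = (of_int x / of_int y :: rat)" using quotient_of_div[OF xy] .
  then have "(of_int (x * d) :: rat) = of_int (c * y)"
    using y assms(2) by (simp add: field_simps)
  then have "x * d = c * y" by (simp only: of_int_eq_iff)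
  then show ?thesis
    using p y assms(2) unfolding padic_of_rat_def xy
    by (simp add: frac_class_eq_iff padic_of_int_closed padic_of_int_eq_zero_iff
        flip: padic_of_int_mult)
qed

text \<open>\<open>\<ominus>\<close> hides an abstract additive inverse; its components are read off
  from (x - y) + y = x.\<close>

lemma padic_int_minus_nth:
  assumes "p > 0" "x \<in> carrier (padic_int p)" "y \<in> carrier (padic_int p)"
  shows "(x \<ominus>\<^bsub>padic_int p\<^esub> y) k = (x k - y k) mod p ^ k"
proof -
  interpret cring "padic_int p" using assms(1) by (rule cring_padic_int)
  define z where "z = x \<ominus>\<^bsub>padic_int p\<^esub> y"
  have z: "z \<in> carrier (padic_int p)" using assms by (simp add: z_def)
  have "z \<oplus>\<^bsub>padic_int p\<^esub> y = x" using assms by (simp add: z_def a_minus_def a_assoc l_neg)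
  then have "(z k + y k) mod p ^ k = x k" by (auto simp: padic_int_def)
  then have "(x k - y k) mod p ^ k = z k mod p ^ k"
    by (metis add_diff_cancel_right' mod_diff_left_eq)
  then show ?thesis using padic_int_self_mod[OF z] by (simp add: z_def)
qed

lemma padic_int_finsum_nth:
  assumes "p > 0" "finite I" "\<And>i. i \<in> I \<Longrightarrow> f i \<in> carrier (padic_int p)"
  shows "(\<Oplus>\<^bsub>padic_int p\<^esub>i\<in>I. f i) k = (\<Sum>i\<in>I. f i k) mod p ^ k"
proof -
  interpret cring "padic_int p" using assms(1) by (rule cring_padic_int)
  show ?thesis using assms(2,3)
  proof (induction I)
    case empty
    show ?case unfolding finsum_empty by (simp add: padic_int_def)
  next
    case (insert x I)
    then have "(\<Oplus>\<^bsub>padic_int p\<^esub>i\<in>insert x I. f i) k =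
        (f x k + (\<Oplus>\<^bsub>padic_int p\<^esub>i\<in>I. f i) k) mod p ^ k"
      by (simp add: finsum_insert Pi_def) (simp add: padic_int_def)
    then show ?case using insert by (simp add: mod_add_right_eq)
  qed
qed

text \<open>\<open>d\<close> is \<open>p ^ e\<close> times a p-adic unit, where \<open>e\<close> is
  its multiplicity, so its multiples are those of \<open>p ^ e\<close>, recognised by a vanishing
  residue at level \<open>e\<close>. The quotient is built level by level.\<close>

lemma padic_int_dvd_iff:
  assumes "prime p" "d \<noteq> 0" "y \<in> carrier (padic_int p)"
  shows "(\<exists>z\<in>carrier (padic_int p). y = padic_of_int p d \<otimes>\<^bsub>padic_int p\<^esub> z) \<longleftrightarrow>
    y (multiplicity p d) = 0"
proof -
  define e where "e = multiplicity p d"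
  have p: "p > 1" using assms(1) by (rule prime_gt_1_int)
  have ped: "p ^ e dvd d" unfolding e_def by (rule multiplicity_dvd)
  have nd: "\<not> p ^ Suc e dvd d"
    unfolding e_def using assms p by (subst power_dvd_iff_le_multiplicity) auto
  show ?thesis unfolding e_def[symmetric]
  proof
    assume "\<exists>z\<in>carrier (padic_int p). y = padic_of_int p d \<otimes>\<^bsub>padic_int p\<^esub> z"
    then obtain z where "y e = ((d mod p ^ e) * z e) mod p ^ e"
      by (auto simp: padic_int_def padic_of_int_def)
    then show "y e = 0" using ped by simp
  next
    assume ye: "y e = 0"
    \<comment> \<open>Division by \<open>d\<close> loses \<open>e\<close> digits, hence the modulus
      \<open>p ^ (k + e)\<close> for a quotient modulo \<open>p ^ k\<close>. This uniqueness makes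
      the quotients at successive levels compatible.\<close>
    have uniq: "z mod p ^ k = z' mod p ^ k"
      if "[d * z = d * z'] (mod p ^ (k + e))" for k z z'
    proof -
      have "p ^ (e + k) dvd d * (z - z')"
        using that by (simp add: cong_iff_dvd_diff right_diff_distrib add.commute)
      moreover obtain d' where d': "d = p ^ e * d'" using ped by auto
      ultimately have "p ^ k dvd d' * (z - z')"
        using p by (simp add: power_add mult.assoc)
      moreover have "\<not> p dvd d'" using nd d' by auto
      then have "Rings.coprime (p ^ k) d'" using assms(1) by (simp add: prime_imp_coprime)
      ultimately have "p ^ k dvd z - z'" by (simp add: coprime_dvd_mult_right_iff)
      then show ?thesis by (simp add: mod_eq_dvd_iff)
    qed
    have ex: "\<exists>z. [d * z = y (k + e)] (mod p ^ (k + e))" for k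
    proof -
      obtain d' where d': "d = p ^ e * d'" using ped by auto
      have "y (k + e) mod p ^ e = 0" using padic_int_mod[OF assms(3), of e "k + e"] ye by simp
      then obtain y' where y': "y (k + e) = p ^ e * y'" by (metis mod_eq_0_iff_dvd dvdE)
      have "\<not> p dvd d'" using nd d' by auto
      then have "Rings.coprime d' (p ^ k)"
        using assms(1) prime_imp_coprime[of p d'] by (simp add: ac_simps)
      then obtain w where "[d' * w = 1] (mod p ^ k)" using cong_solve_coprime_int by blast
      then have "[d' * (w * y') = y'] (mod p ^ k)"
        using cong_scalar_right[of "d' * w" 1 "p ^ k" y'] by (simp add: mult.assoc)
      then have "[d * (w * y') = y (k + e)] (mod p ^ (k + e))"
        unfolding d' y' using p
        by (simp add: cong_iff_dvd_diff power_add mult.assoc mult.commute[of "p ^ k"]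
            flip: right_diff_distrib)
      then show ?thesis by blast
    qed
    then obtain z where z: "[d * z k = y (k + e)] (mod p ^ (k + e))" for k by metis
    define w where "w k = z k mod p ^ k" for k
    have "w \<in> carrier (padic_int p)"
    proof (rule padic_int_carrierI)
      fix k
      have "[d * z (Suc k) = y (Suc k + e)] (mod p ^ (k + e))"
        using z[of "Suc k"] cong_modulus_mult[of "d * z (Suc k)" "y (Suc k + e)" "p ^ (k + e)" p]
        by (simp add: mult.commute)
      moreover have "[y (Suc k + e) = y (k + e)] (mod p ^ (k + e))"
        using padic_int_mod[OF assms(3), of "k + e" "Suc k + e"]
          padic_int_self_mod[OF assms(3), of "k + e"] by (simp add: cong_def)
      ultimately have "[d * z (Suc k) = d * z k] (mod p ^ (k + e))"
        using z[of k] by (meson cong_trans cong_sym)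
      from uniq[OF this] show "w (Suc k) mod p ^ k = w k"
        unfolding w_def by (simp add: mod_mod_cancel)
    qed (use p in \<open>auto simp: w_def\<close>)
    moreover have "y = padic_of_int p d \<otimes>\<^bsub>padic_int p\<^esub> w"
    proof
      fix k
      have "[d * z k = y (k + e)] (mod p ^ k)"
        using z[of k] cong_modulus_mult[of "d * z k" "y (k + e)" "p ^ k" "p ^ e"]
        by (simp add: power_add)
      then have "(d * z k) mod p ^ k = y k"
        using padic_int_mod[OF assms(3), of k "k + e"] by (simp add: cong_def)
      then show "y k = (padic_of_int p d \<otimes>\<^bsub>padic_int p\<^esub> w) k"
        by (simp add: padic_int_def padic_of_int_def w_def mod_mult_eq)
    qed
    ultimately show "\<exists>z\<in>carrier (padic_int p). y = padic_of_int p d \<otimes>\<^bsub>padic_int p\<^esub> z" by blast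
  qed
qed

section \<open>Rationals with a denominator prime to p\<close>

definition p_integral :: "int \<Rightarrow> rat \<Rightarrow> bool" where
  "p_integral p r \<longleftrightarrow> (\<exists>a b. \<not> p dvd b \<and> r = of_int a / of_int b)"

text \<open>If c/d = a/b with p not dividing b, the equation c b = a d forces the power of p
  contained in d into c. The fraction c/d need not be reduced.\<close>

lemma p_integral_divide_iff:
  assumes "prime p" "d \<noteq> 0"
  shows "p_integral p (of_int c / of_int d) \<longleftrightarrow> p ^ multiplicity p d dvd c"
proof -
  define e where "e = multiplicity p d"
  have p: "p > 1" using assms(1) by (rule prime_gt_1_int)
  obtain d' where d': "d = p ^ e * d'" unfolding e_def by (metis multiplicity_dvd dvdE)
  have nd: "\<not> p ^ Suc e dvd d"
    unfolding e_def using assms p by (subst power_dvd_iff_le_multiplicity) auto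
  then have d'p: "\<not> p dvd d'" using d' by auto
  show ?thesis unfolding e_def[symmetric]
  proof
    assume "p ^ e dvd c"
    then obtain c' where "c = p ^ e * c'" by auto
    then have "of_int c / of_int d = (of_int c' / of_int d' :: rat)" using p by (simp add: d')
    then show "p_integral p (of_int c / of_int d)" using d'p by (auto simp: p_integral_def)
  next
    assume "p_integral p (of_int c / of_int d)"
    then obtain a b where ab: "\<not> p dvd b" "of_int c / of_int d = (of_int a / of_int b :: rat)"
      by (auto simp: p_integral_def)
    then have "(of_int (c * b) :: rat) = of_int (a * d)"
      using assms(2) by (auto simp: field_simps)
    then have "c * b = a * d" by (simp only: of_int_eq_iff)
    then have "p ^ e dvd c * b" by (simp add: d')
    moreover have "Rings.coprime (p ^ e) b" using assms(1) ab(1) by (simp add: prime_imp_coprime)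
    ultimately show "p ^ e dvd c" by (simp add: coprime_dvd_mult_left_iff)
  qed
qed

lemma common_denominator:
  fixes S :: "rat set"
  assumes "finite S"
  shows "\<exists>d::int. d > 0 \<and> (\<forall>r\<in>S. \<exists>z. r = of_int z / of_int d)"
  using assms
proof (induction S)
  case empty
  show ?case by (rule exI[of _ 1]) simp
next
  case (insert x S)
  then obtain d where d: "d > 0" "\<forall>r\<in>S. \<exists>z. r = of_int z / of_int d" by blast
  obtain a b where ab: "quotient_of x = (a, b)" by force
  have b: "b > 0" using quotient_of_denom_pos[OF ab] .
  have x: "x = of_int a / of_int b" using quotient_of_div[OF ab] .
  show ?case
  proof (rule exI[of _ "b * d"], intro conjI ballI)
    fix r assume "r \<in> insert x S"
    show "\<exists>z. r = of_int z / of_int (b * d)"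
    proof (cases "r = x")
      case True
      then have "r = of_int (a * d) / of_int (b * d)" using x d(1) by simp
      then show ?thesis by blast
    next
      case False
      then obtain z where "r = of_int z / of_int d" using d(2) \<open>r \<in> insert x S\<close> by blast
      then have "r = of_int (b * z) / of_int (b * d)" using b by simp
      then show ?thesis by blast
    qed
  qed (use b d in simp)
qed

text \<open>Here the p-adic field leaves the argument. Over a common denominator \<open>d\<close>
  the expression is \<open>y\<close> divided by \<open>d\<close>, a p-adic integer iff
  \<open>y\<close> vanishes at level \<open>e\<close>, the multiplicity of \<open>p\<close> in
  \<open>d\<close>. Only residues modulo \<open>p ^ e\<close> matter, so all truncations at levels
  \<open>M \<ge> e\<close> give the same answer, and the condition becomes one on rational
  numbers.\<close>

lemma padic_field_combination_integral_iff:
  fixes t :: nat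
  assumes "prime p" "\<And>i. i < t \<Longrightarrow> a i \<in> carrier (padic_int p)"
  shows "padic_of_rat p c \<ominus>\<^bsub>padic_field p\<^esub>
      (\<Oplus>\<^bsub>padic_field p\<^esub>i\<in>{..<t}. padic_of_rat p (r i) \<otimes>\<^bsub>padic_field p\<^esub> padic_emb p (a i))
      \<in> padic_emb p ` carrier (padic_int p) \<longleftrightarrow>
    (\<forall>\<^sub>F M in sequentially. p_integral p (c - (\<Sum>i<t. r i * of_int (a i M))))"
proof -
  let ?R = "padic_int p"
  have p: "p > 1" using assms(1) by (rule prime_gt_1_int)
  interpret domain ?R using assms(1) by (rule domain_padic_int)
  obtain d where d: "d > 0" "\<forall>x\<in>insert c (r ` {..<t}). \<exists>z. x = of_int z / of_int d"
    using common_denominator[of "insert c (r ` {..<t})"] by blast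
  obtain C where C: "c = of_int C / of_int d" using d(2) by blast
  have "\<forall>i\<in>{..<t}. \<exists>z. r i = of_int z / of_int d" using d(2) by blast
  then obtain N where N: "\<And>i. i < t \<Longrightarrow> r i = of_int (N i) / of_int d" by (metis lessThan_iff)
  define e where "e = multiplicity p d"
  define D where "D = padic_of_int p d"
  have D: "D \<in> carrier ?R - {\<zero>\<^bsub>?R\<^esub>}"
    using d(1) p by (simp add: D_def padic_of_int_closed padic_of_int_eq_zero_iff)
  have cl: "padic_of_int p z \<in> carrier ?R" for z using p by (intro padic_of_int_closed) simp
  define f where "f i = padic_of_int p (N i) \<otimes>\<^bsub>?R\<^esub> a i" for i
  have f: "f i \<in> carrier ?R" if "i < t" for i using that assms(2) cl by (simp add: f_def)
  define y where "y = padic_of_int p C \<ominus>\<^bsub>?R\<^esub> (\<Oplus>\<^bsub>?R\<^esub>i\<in>{..<t}. f i)"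
  have sumf: "(\<Oplus>\<^bsub>?R\<^esub>i\<in>{..<t}. f i) \<in> carrier ?R" using f by (intro finsum_closed) auto
  then have y: "y \<in> carrier ?R" using cl by (simp add: y_def)
  interpret K: abelian_group "fraction_field ?R" by (rule abelian_group_fraction_field)
  have tm: "padic_of_rat p (r i) \<otimes>\<^bsub>padic_field p\<^esub> padic_emb p (a i) = frac_class ?R (f i) D"
    if "i < t" for i
    using that assms d(1) D cl
    by (simp add: N padic_of_rat_divide padic_field_def padic_emb_def f_def frac_class_mult
        flip: D_def)
  have "(\<Oplus>\<^bsub>padic_field p\<^esub>i\<in>{..<t}. padic_of_rat p (r i) \<otimes>\<^bsub>padic_field p\<^esub> padic_emb p (a i)) =
      (\<Oplus>\<^bsub>fraction_field ?R\<^esub>i\<in>{..<t}. frac_class ?R (f i) D)"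
    unfolding padic_field_def using f D tm
    by (intro K.finsum_cong') (auto simp: padic_field_def intro!: frac_class_closed)
  also have "\<dots> = frac_class ?R (\<Oplus>\<^bsub>?R\<^esub>i\<in>{..<t}. f i) D"
    using f D by (intro frac_class_finsum_same) auto
  finally have expr: "padic_of_rat p c \<ominus>\<^bsub>padic_field p\<^esub>
      (\<Oplus>\<^bsub>padic_field p\<^esub>i\<in>{..<t}. padic_of_rat p (r i) \<otimes>\<^bsub>padic_field p\<^esub> padic_emb p (a i)) =
      frac_class ?R y D"
    using sumf D cl d(1) assms(1) unfolding C y_def
    by (simp add: padic_of_rat_divide padic_field_def frac_class_minus_same flip: D_def)
  have "frac_class ?R y D \<in> padic_emb p ` carrier ?R \<longleftrightarrow>
      (\<exists>z\<in>carrier ?R. y = D \<otimes>\<^bsub>?R\<^esub> z)"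
    using y D by (auto simp: padic_emb_def frac_class_eq_iff image_iff m_comm)
  also have "\<dots> \<longleftrightarrow> y e = 0"
    unfolding D_def e_def using d(1) assms(1) y by (intro padic_int_dvd_iff) auto
  also have "\<dots> \<longleftrightarrow> (\<forall>\<^sub>F M in sequentially. p_integral p (c - (\<Sum>i<t. r i * of_int (a i M))))"
  proof -
    have yM: "y M = (C - (\<Sum>i<t. N i * a i M)) mod p ^ M" for M
    proof -
      have "y M = (C mod p ^ M - (\<Sum>i<t. f i M) mod p ^ M) mod p ^ M"
        unfolding y_def using p sumf cl f
          padic_int_finsum_nth[of p "{..<t}" f M]
        by (simp add: padic_int_minus_nth) (simp add: padic_of_int_def)
      also have "\<dots> = (C - (\<Sum>i<t. f i M)) mod p ^ M" by (simp add: mod_diff_eq)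
      also have "\<dots> = (C - (\<Sum>i<t. f i M) mod p ^ M) mod p ^ M" by (simp add: mod_diff_right_eq)
      also have "(\<Sum>i<t. f i M) mod p ^ M = (\<Sum>i<t. N i * a i M mod p ^ M) mod p ^ M"
        by (simp add: f_def padic_int_def padic_of_int_def mod_mult_left_eq)
      also have "\<dots> = (\<Sum>i<t. N i * a i M) mod p ^ M" by (rule mod_sum_eq)
      finally show ?thesis by (simp add: mod_diff_right_eq)
    qed
    have "p_integral p (c - (\<Sum>i<t. r i * of_int (a i M))) \<longleftrightarrow> y e = 0" if "M \<ge> e" for M
    proof -
      have "(\<Sum>i<t. r i * of_int (a i M)) = (\<Sum>i<t. of_int (N i * a i M) / of_int d)"
        by (intro sum.cong) (auto simp: N)
      then have "c - (\<Sum>i<t. r i * of_int (a i M)) =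
          of_int (C - (\<Sum>i<t. N i * a i M)) / of_int d"
        by (simp add: C diff_divide_distrib sum_divide_distrib)
      moreover have "p_integral p (of_int (C - (\<Sum>i<t. N i * a i M)) / of_int d) \<longleftrightarrow>
          p ^ e dvd C - (\<Sum>i<t. N i * a i M)"
        unfolding e_def using d(1) assms(1) by (intro p_integral_divide_iff) auto
      ultimately have "p_integral p (c - (\<Sum>i<t. r i * of_int (a i M))) \<longleftrightarrow>
          p ^ e dvd C - (\<Sum>i<t. N i * a i M)"
        by (simp only:)
      also have "\<dots> \<longleftrightarrow> y M mod p ^ e = 0"
        unfolding yM using mod_mod_cancel[OF le_imp_power_dvd[OF that, of p]]
        by (simp add: dvd_eq_mod_eq_0)
      also have "y M mod p ^ e = y e" using padic_int_mod[OF y that] .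
      finally show ?thesis .
    qed
    then have "\<forall>\<^sub>F M in sequentially.
        p_integral p (c - (\<Sum>i<t. r i * of_int (a i M))) \<longleftrightarrow> y e = 0"
      using eventually_sequentially by blast
    then have "(\<forall>\<^sub>F M in sequentially. p_integral p (c - (\<Sum>i<t. r i * of_int (a i M)))) \<longleftrightarrow>
        (\<forall>\<^sub>F M in sequentially. y e = 0)"
      by (intro eventually_subst)
    then show ?thesis by simp
  qed
  finally show ?thesis using expr by simp
qed

section \<open>Algebraic integers in number fields\<close>

text \<open>The characteristic polynomial is monic with integer coefficients. Besides the
  eigenvalues of the given matrix, this serves the multiplication matrices in
  \<open>algebraic_int_if_stable\<close> and the quotient matrix \<open>B\<close> in
  \<open>eigenvalue_power_ldiv\<close>.\<close>

lemma int_mat_eigenvalue_algebraic_int: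
  fixes M :: "int mat" and z :: "'a :: field_char_0"
  assumes "M \<in> carrier_mat k k" "eigenvalue (map_mat of_int M) z"
  shows "algebraic_int z"
proof -
  have "poly (char_poly (map_mat of_int M)) z = 0"
    using assms eigenvalue_root_char_poly[of "map_mat of_int M" k z] by simp
  also have "char_poly (map_mat of_int M) = map_poly of_int (char_poly M)"
    using assms(1) by (rule of_int_hom.char_poly_hom)
  finally show ?thesis
    unfolding algebraic_int_altdef_ipoly using degree_monic_char_poly[OF assms(1)] by auto
qed

text \<open>A finitely generated additive group of complex numbers; its stability under
  multiplication by \<open>z\<close> is the test for integrality of \<open>z\<close>.\<close>

definition int_combinations :: "'i set \<Rightarrow> ('i \<Rightarrow> complex) \<Rightarrow> complex set" where
  "int_combinations I v = range (\<lambda>c. \<Sum>i\<in>I. of_int (c i) * v i)"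

lemma int_combinationsI: "(\<Sum>i\<in>I. of_int (c i) * v i) \<in> int_combinations I v"
  by (auto simp: int_combinations_def)

lemma int_combinations_mem:
  assumes "finite I" "i \<in> I"
  shows "v i \<in> int_combinations I v"
proof -
  have "v i = (\<Sum>j\<in>I. of_int (if j = i then 1 else 0) * v j)"
    using assms by (simp add: if_distrib if_distribR cong: if_cong)
  also have "\<dots> \<in> int_combinations I v" by (rule int_combinationsI)
  finally show ?thesis .
qed

lemma int_combinations_zero: "0 \<in> int_combinations I v"
proof -
  have "0 = (\<Sum>j\<in>I. of_int ((\<lambda>_. 0) j) * v j)" by simp
  also have "\<dots> \<in> int_combinations I v" by (rule int_combinationsI)
  finally show ?thesis .
qed

lemma int_combinations_add:
  assumes "x \<in> int_combinations I v" "y \<in> int_combinations I v"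
  shows "x + y \<in> int_combinations I v"
proof -
  obtain c d where "x = (\<Sum>j\<in>I. of_int (c j) * v j)" "y = (\<Sum>j\<in>I. of_int (d j) * v j)"
    using assms unfolding int_combinations_def by auto
  then have "x + y = (\<Sum>j\<in>I. of_int (c j + d j) * v j)"
    by (simp add: sum.distrib distrib_right)
  also have "\<dots> \<in> int_combinations I v" by (rule int_combinationsI)
  finally show ?thesis .
qed

lemma int_combinations_scale:
  assumes "x \<in> int_combinations I v"
  shows "of_int k * x \<in> int_combinations I v"
proof -
  obtain c where "x = (\<Sum>j\<in>I. of_int (c j) * v j)"
    using assms unfolding int_combinations_def by auto
  then have "of_int k * x = (\<Sum>j\<in>I. of_int (k * c j) * v j)"
    by (simp add: sum_distrib_left mult.assoc)
  also have "\<dots> \<in> int_combinations I v" by (rule int_combinationsI)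
  finally show ?thesis .
qed

lemma int_combinations_sum:
  assumes "\<And>j. j \<in> J \<Longrightarrow> f j \<in> int_combinations I v"
  shows "(\<Sum>j\<in>J. of_int (c j) * f j) \<in> int_combinations I v"
  using assms
  by (induction J rule: infinite_finite_induct)
     (auto intro: int_combinations_zero int_combinations_add int_combinations_scale)

lemma int_combinations_stable:
  assumes "\<And>i. i \<in> I \<Longrightarrow> z * v i \<in> int_combinations I v" "w \<in> int_combinations I v"
  shows "z * w \<in> int_combinations I v"
proof -
  obtain c where "w = (\<Sum>i\<in>I. of_int (c i) * v i)"
    using assms(2) unfolding int_combinations_def by auto
  then have "z * w = (\<Sum>i\<in>I. of_int (c i) * (z * v i))"
    by (simp add: sum_distrib_left algebra_simps)
  then show ?thesis using int_combinations_sum[OF assms(1)] by simp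
qed

text \<open>Multiplication by \<open>z\<close> on the generators is described by an integer matrix
  \<open>M\<close>, for which the vector \<open>u\<close> of generators is an eigenvector with
  eigenvalue \<open>z\<close>. One nonzero generator ensures that \<open>u\<close> is
  nonzero.\<close>

lemma algebraic_int_if_stable:
  assumes "finite I" "i0 \<in> I" "v i0 \<noteq> 0"
    and "\<And>i. i \<in> I \<Longrightarrow> z * v i \<in> int_combinations I v"
  shows "algebraic_int z"
proof -
  define k where "k = card I"
  obtain h where h: "bij_betw h {..<k} I"
    using ex_bij_betw_nat_finite[OF assms(1)] by (auto simp: k_def atLeast0LessThan)
  have "\<forall>i\<in>I. \<exists>c. z * v i = (\<Sum>j\<in>I. of_int (c j) * v j)"
    using assms(4) unfolding int_combinations_def by blast
  then obtain c where c: "\<And>i. i \<in> I \<Longrightarrow> z * v i = (\<Sum>j\<in>I. of_int (c i j) * v j)" by metis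
  define M where "M = mat k k (\<lambda>(i, j). c (h i) (h j))"
  define u where "u = vec k (\<lambda>i. v (h i))"
  have hI: "h i \<in> I" if "i < k" for i using h that by (auto simp: bij_betw_def)
  have M: "M \<in> carrier_mat k k" by (simp add: M_def)
  have "map_mat of_int M *\<^sub>v u = z \<cdot>\<^sub>v u"
  proof (rule eq_vecI)
    fix i assume "i < dim_vec (z \<cdot>\<^sub>v u)"
    then have i: "i < k" by (simp add: u_def)
    have "(map_mat of_int M *\<^sub>v u) $ i = (\<Sum>j<k. of_int (c (h i) (h j)) * v (h j))"
      using i by (simp add: M_def u_def scalar_prod_def atLeast0LessThan)
    also have "\<dots> = (\<Sum>j\<in>I. of_int (c (h i) j) * v j)"
      by (rule sum.reindex_bij_betw[OF h])
    also have "\<dots> = z * v (h i)" using c[OF hI[OF i]] by simp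
    finally show "(map_mat of_int M *\<^sub>v u) $ i = (z \<cdot>\<^sub>v u) $ i" using i by (simp add: u_def)
  qed (simp_all add: M_def u_def)
  moreover have "u \<noteq> 0\<^sub>v k"
  proof
    obtain j where j: "j < k" "h j = i0" using h assms(2) by (auto simp: bij_betw_def)
    assume "u = 0\<^sub>v k"
    then have "u $ j = 0" using j by simp
    then show False using j assms(3) by (simp add: u_def)
  qed
  ultimately have "eigenvalue (map_mat of_int M) z"
    unfolding eigenvalue_def eigenvector_def by (intro exI[of _ u]) (simp add: M_def u_def)
  then show ?thesis using int_mat_eigenvalue_algebraic_int[OF M] by blast
qed

lemma algebraic_int_power_reduction:
  fixes x :: complex
  assumes "algebraic_int x"
  obtains m c where "m > 0" "x ^ m = (\<Sum>i<m. of_int (c i) * x ^ i)"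
proof -
  obtain f where f: "poly (map_poly of_int f) x = 0" "lead_coeff f = 1"
    using assms unfolding algebraic_int_altdef_ipoly by blast
  let ?m = "degree f"
  have "0 = (\<Sum>i\<le>?m. of_int (poly.coeff f i) * x ^ i)"
    using f(1) by (simp add: poly_altdef coeff_map_poly)
  also have "\<dots> = x ^ ?m + (\<Sum>i<?m. of_int (poly.coeff f i) * x ^ i)"
    using f(2) by (simp flip: lessThan_Suc_atMost)
  finally have red: "x ^ ?m = (\<Sum>i<?m. of_int (- poly.coeff f i) * x ^ i)"
    by (simp add: sum_negf eq_neg_iff_add_eq_0)
  have "?m > 0"
  proof (rule ccontr)
    assume "\<not> ?m > 0"
    then obtain a where "f = [:a:]" by (metis degree_eq_zeroE gr0I)
    then show False using f by simp
  qed
  then show ?thesis using red by (rule that)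
qed

text \<open>When \<open>x\<close> and \<open>y\<close> satisfy monic equations of degrees
  \<open>m\<close> and \<open>n\<close>, the monomials \<open>x ^ i * y ^ j\<close> with
  \<open>i < m\<close> and \<open>j < n\<close> generate the ring Z[x, y] as a group. The same group
  then tests both x + y and x * y.\<close>

lemma algebraic_int_pair_stable:
  fixes x y :: complex
  assumes "algebraic_int x" "algebraic_int y"
  obtains I :: "(nat \<times> nat) set" and v i0 where "finite I" "i0 \<in> I" "v i0 \<noteq> 0"
    "\<And>i. i \<in> I \<Longrightarrow> x * v i \<in> int_combinations I v"
    "\<And>i. i \<in> I \<Longrightarrow> y * v i \<in> int_combinations I v"
proof -
  obtain m c where m: "m > 0" "x ^ m = (\<Sum>i<m. of_int (c i) * x ^ i)"
    using algebraic_int_power_reduction[OF assms(1)] .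
  obtain n d where n: "n > 0" "y ^ n = (\<Sum>i<n. of_int (d i) * y ^ i)"
    using algebraic_int_power_reduction[OF assms(2)] .
  define I where "I = {..<m} \<times> {..<n}"
  define v where "v = (\<lambda>(i, j). x ^ i * y ^ j)"
  have fin: "finite I" by (simp add: I_def)
  have mem: "x ^ i * y ^ j \<in> int_combinations I v" if "i < m" "j < n" for i j
    using int_combinations_mem[OF fin, of "(i, j)" v] that by (simp add: I_def v_def)
  show ?thesis
  proof (rule that[OF fin, of "(0, 0)" v])
    fix ij assume "ij \<in> I"
    then obtain i j where ij: "ij = (i, j)" "i < m" "j < n" by (auto simp: I_def)
    show "x * v ij \<in> int_combinations I v"
    proof (cases "Suc i < m")
      case True
      then show ?thesis using mem[of "Suc i" j] ij by (simp add: v_def mult.assoc)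
    next
      case False
      then have "m = Suc i" using ij by simp
      then have "x * v ij = x ^ m * y ^ j" using ij by (simp add: v_def mult.assoc)
      also have "\<dots> = (\<Sum>i<m. of_int (c i) * (x ^ i * y ^ j))"
        unfolding m(2) by (simp add: sum_distrib_right mult.assoc)
      finally show ?thesis using mem ij(3) by (auto intro!: int_combinations_sum)
    qed
    show "y * v ij \<in> int_combinations I v"
    proof (cases "Suc j < n")
      case True
      then show ?thesis using mem[of i "Suc j"] ij by (simp add: v_def mult_ac)
    next
      case False
      then have "n = Suc j" using ij by simp
      then have "y * v ij = x ^ i * y ^ n" using ij by (simp add: v_def mult_ac)
      also have "\<dots> = (\<Sum>j<n. of_int (d j) * (x ^ i * y ^ j))"
        unfolding n(2) by (simp add: sum_distrib_left mult_ac)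
      finally show ?thesis using mem ij(2) by (auto intro!: int_combinations_sum)
    qed
  qed (use m(1) n(1) in \<open>auto simp: I_def v_def\<close>)
qed

lemma algebraic_int_add:
  fixes x y :: complex
  assumes "algebraic_int x" "algebraic_int y"
  shows "algebraic_int (x + y)"
proof (rule algebraic_int_pair_stable[OF assms])
  fix I :: "(nat \<times> nat) set" and v i0
  assume *: "finite I" "i0 \<in> I" "v i0 \<noteq> 0"
    "\<And>i. i \<in> I \<Longrightarrow> x * v i \<in> int_combinations I v" "\<And>i. i \<in> I \<Longrightarrow> y * v i \<in> int_combinations I v"
  show ?thesis
    by (rule algebraic_int_if_stable[of I i0 v, OF *(1-3)])
       (simp add: distrib_right * int_combinations_add)
qed

lemma algebraic_int_mult:
  fixes x y :: complex
  assumes "algebraic_int x" "algebraic_int y"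
  shows "algebraic_int (x * y)"
proof (rule algebraic_int_pair_stable[OF assms])
  fix I :: "(nat \<times> nat) set" and v i0
  assume *: "finite I" "i0 \<in> I" "v i0 \<noteq> 0"
    "\<And>i. i \<in> I \<Longrightarrow> x * v i \<in> int_combinations I v" "\<And>i. i \<in> I \<Longrightarrow> y * v i \<in> int_combinations I v"
  show ?thesis
    by (rule algebraic_int_if_stable[of I i0 v, OF *(1-3)])
       (simp add: mult.assoc * int_combinations_stable)
qed

text \<open>If \<open>c\<close> is the leading coefficient of an integer polynomial of degree n
  vanishing at \<open>x\<close>, multiplying the equation by c^(n-1) turns it into a monic equation
  for \<open>c * x\<close>.\<close>

lemma algebraic_multiple_algebraic_int:
  fixes x :: complex
  assumes "algebraic x"
  obtains c :: int where "c \<noteq> 0" "algebraic_int (of_int c * x)"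
proof -
  obtain f where f: "f \<noteq> 0" "poly (map_poly of_int f) x = 0" using algebraicE'[OF assms] .
  let ?n = "degree f" and ?c = "lead_coeff f"
  have n: "?n > 0"
  proof (rule ccontr)
    assume "\<not> ?n > 0"
    then obtain a where "f = [:a:]" by (metis degree_eq_zeroE gr0I)
    then show False using f by (simp add: map_poly_pCons)
  qed
  define v where "v i = (of_int ?c * x) ^ i" for i :: nat
  have "0 = (\<Sum>i\<le>?n. of_int (poly.coeff f i) * x ^ i)"
    using f(2) by (simp add: poly_altdef coeff_map_poly)
  also have "\<dots> = of_int ?c * x ^ ?n + (\<Sum>i<?n. of_int (poly.coeff f i) * x ^ i)"
    by (simp flip: lessThan_Suc_atMost)
  finally have top: "of_int ?c * x ^ ?n = - (\<Sum>i<?n. of_int (poly.coeff f i) * x ^ i)"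
    by (simp add: eq_neg_iff_add_eq_0)
  have "algebraic_int (of_int ?c * x)"
  proof (rule algebraic_int_if_stable[of "{..<?n}" 0 v])
    fix i assume i: "i \<in> {..<?n}"
    have "of_int ?c * x * v i = v (Suc i)" by (simp add: v_def)
    also have "\<dots> \<in> int_combinations {..<?n} v"
    proof (cases "Suc i < ?n")
      case True
      then show ?thesis by (intro int_combinations_mem) auto
    next
      case False
      then have eq: "?n = Suc i" using i by simp
      \<comment> \<open>As \<open>?n = Suc i\<close>, the factor c^i is the one that makes the
        equation monic in c x. In the term of index j, c^j is absorbed into \<open>v j\<close> and
        c^(i-j) stays in the integer coefficient.\<close>
      have "v (Suc i) = of_int ?c ^ i * (of_int ?c * x ^ ?n)"
        by (subst eq) (simp add: v_def power_mult_distrib)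
      also have "\<dots> = (\<Sum>j<?n. of_int (- poly.coeff f j * ?c ^ (i - j)) * v j)"
        unfolding top sum_distrib_left sum_negf[symmetric]
      proof (rule sum.cong)
        fix j assume "j \<in> {..<?n}"
        then have "j \<le> i" using eq by simp
        then have "(of_int ?c :: complex) ^ i = of_int ?c ^ (i - j) * of_int ?c ^ j"
          by (simp flip: power_add)
        then show "of_int ?c ^ i * - (of_int (poly.coeff f j) * x ^ j) =
            of_int (- poly.coeff f j * ?c ^ (i - j)) * v j"
          by (simp add: v_def power_mult_distrib)
      qed simp
      also have "\<dots> \<in> int_combinations {..<?n} v"
        by (intro int_combinations_sum int_combinations_mem) auto
      finally show ?thesis .
    qed
    finally show "of_int ?c * x * v i \<in> int_combinations {..<?n} v" .
  qed (use n in \<open>auto simp: v_def\<close>)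
  then show ?thesis using that[of ?c] f(1) by simp
qed

lemma subfield_complexD:
  assumes "subfield F (class_ring :: complex ring)"
  shows "0 \<in> F" "1 \<in> F" "\<And>x y. x \<in> F \<Longrightarrow> y \<in> F \<Longrightarrow> x + y \<in> F"
    "\<And>x y. x \<in> F \<Longrightarrow> y \<in> F \<Longrightarrow> x * y \<in> F" "\<And>x. x \<in> F \<Longrightarrow> - x \<in> F"
    "\<And>x. x \<in> F \<Longrightarrow> inverse x \<in> F"
proof -
  note R = subringE[OF subfieldE(1)[OF assms]]
  show F: "0 \<in> F" "1 \<in> F" "\<And>x y. x \<in> F \<Longrightarrow> y \<in> F \<Longrightarrow> x + y \<in> F"
    "\<And>x y. x \<in> F \<Longrightarrow> y \<in> F \<Longrightarrow> x * y \<in> F" "\<And>x. x \<in> F \<Longrightarrow> - x \<in> F"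
    using R(2,3,5-7) by (auto simp: class_ring_simps)
  show "inverse x \<in> F" if "x \<in> F" for x
  proof (cases "x = 0")
    case False
    then have "x \<in> Units ((class_ring :: complex ring)\<lparr>carrier := F\<rparr>)"
      using subfield.subfield_Units[OF assms] that by auto
    then obtain y where "y \<in> F" "x * y = 1" by (auto simp: Units_def)
    then show ?thesis using inverse_unique by metis
  qed (use F in simp)
qed

lemma subfield_complex_of_int:
  assumes "subfield F (class_ring :: complex ring)"
  shows "of_int z \<in> F"
proof -
  note F = subfield_complexD[OF assms]
  have "of_nat m \<in> F" for m using F by (induction m) auto
  then show ?thesis using F(5) by (cases z rule: int_cases) (auto simp del: of_nat_Suc)
qed

lemma cring_ring_of_integers:
  assumes "subfield F (class_ring :: complex ring)"
  shows "cring (ring_of_integers F)"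
proof -
  note cl = subfield_complexD[OF assms]
  show ?thesis
  proof (rule cringI)
    show "abelian_group (ring_of_integers F)"
    proof (rule abelian_groupI)
      fix x assume "x \<in> carrier (ring_of_integers F)"
      then show "\<exists>y\<in>carrier (ring_of_integers F).
          y \<oplus>\<^bsub>ring_of_integers F\<^esub> x = \<zero>\<^bsub>ring_of_integers F\<^esub>"
        by (intro bexI[of _ "- x"]) (auto simp: ring_of_integers_def cl)
    qed (auto simp: ring_of_integers_def cl algebraic_int_add)
    show "Group.comm_monoid (ring_of_integers F)"
      by (rule comm_monoidI)
         (auto simp: ring_of_integers_def cl algebraic_int_mult)
  qed (auto simp: ring_of_integers_def distrib_right)
qed

text \<open>If \<open>F\<close> has dimension \<open>n\<close> over the rationals,
  \<open>Suc n\<close> powers of \<open>x\<close> are linearly dependent; the coefficients of a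
  relation form a nonzero polynomial with root \<open>x\<close>.\<close>

lemma number_field_algebraic:
  assumes "number_field F" "x \<in> F"
  shows "algebraic x"
proof -
  have F: "subfield F (class_ring :: complex ring)"
    and fin: "ring.finite_dimension (class_ring :: complex ring) \<rat> F"
    using assms(1) by (auto simp: number_field_def)
  have R: "ring (class_ring :: complex ring)" by (rule class_ring.ring_axioms)
  obtain n where n: "ring.dimension (class_ring :: complex ring) n \<rat> F"
    using fin unfolding ring.finite_dimension_def[OF R] by blast
  have Q: "subfield \<rat> (class_ring :: complex ring)"
  proof (rule ring.subfieldI[OF R])
    show "subcring \<rat> (class_ring :: complex ring)"
      by (intro ring.subcringI[OF R] ring.subringI[OF R]) (auto simp: class_ring_simps)
    show "Units ((class_ring :: complex ring)\<lparr>carrier := \<rat>\<rparr>) = \<rat> - {\<zero>\<^bsub>class_ring\<^esub>}"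
    proof -
      have "\<exists>y\<in>\<rat>. y * x = 1 \<and> x * y = 1" if "x \<in> \<rat>" "x \<noteq> 0" for x :: complex
        using that by (intro bexI[of _ "inverse x"]) auto
      then show ?thesis by (auto simp: Units_def)
    qed
  qed
  have pw: "x ^ i \<in> F" for i
    using subringE(3,6)[OF subfieldE(1)[OF F]] assms(2) by (induction i) auto
  let ?Us = "map (\<lambda>i. x ^ i) [0..<Suc n]"
  have "ring.dependent (class_ring :: complex ring) \<rat> ?Us"
    using ring.independent_length_le_dimension[OF R Q n, of ?Us] pw by auto
  then obtain Ks where Ks: "length Ks = Suc n" "ring.combine (class_ring :: complex ring) Ks ?Us = 0"
      "set Ks \<subseteq> \<rat>" "set Ks \<noteq> {0}"
    using ring.dependent_imp_non_trivial_combine[OF R Q, of ?Us] by (auto simp: class_ring_simps)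
  have comb: "ring.combine (class_ring :: complex ring) Ks Us = (\<Sum>i<length Ks. Ks ! i * Us ! i)"
    if "length Ks = length Us" for Ks Us :: "complex list"
    using that by (induction Ks Us rule: list_induct2)
      (simp_all add: ring.combine.simps[OF R] sum.lessThan_Suc_shift del: sum.lessThan_Suc)
  define f where "f = Poly Ks"
  have "poly f x = (\<Sum>i<length Ks. Ks ! i * x ^ i)"
    unfolding f_def by (induction Ks) (simp_all add: sum.lessThan_Suc_shift sum_distrib_left mult_ac del: sum.lessThan_Suc)
  also have "\<dots> = ring.combine (class_ring :: complex ring) Ks ?Us"
    using Ks(1) by (subst comb) (auto intro!: sum.cong simp del: upt_Suc)
  finally have "poly f x = 0" using Ks(2) by simp
  moreover have "poly.coeff f i \<in> \<rat>" for i
    using Ks(3) by (auto simp: f_def coeff_Poly_eq nth_default_def)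
  moreover have "f \<noteq> 0"
  proof
    assume "f = 0"
    then have "k = 0" if "k \<in> set Ks" for k
      using that unfolding f_def Poly_eq_0 by (metis in_set_replicate)
    then show False using Ks(1,4) by (cases Ks) auto
  qed
  ultimately show ?thesis by (intro algebraicI') auto
qed

section \<open>Primes above $p$ and the local ring\<close>

text \<open>Zorn's lemma on the ideals containing \<open>p\<close> but not 1 yields a maximal, hence
  prime, ideal. By Bezout an integer in it that is prime to \<open>p\<close> would put 1 into it, so
  it meets the integers exactly in the multiples of \<open>p\<close>.\<close>

lemma prime_above_exists:
  assumes "subfield F (class_ring :: complex ring)" "prime p"
  obtains P where "prime_above F p P"
proof -
  let ?O = "ring_of_integers F"
  interpret O: cring ?O using assms(1) by (rule cring_ring_of_integers)
  have p: "p > 1" using assms(2) by (rule prime_gt_1_int)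
  have carO: "x \<in> carrier ?O \<longleftrightarrow> x \<in> F \<and> algebraic_int x" for x
    by (simp add: ring_of_integers_def)
  have intO: "of_int z \<in> carrier ?O" for z
    using subfield_complex_of_int[OF assms(1)] by (simp add: carO int_imp_algebraic_int)
  define \<A> where "\<A> = {I. ideal I ?O \<and> of_int p \<in> I \<and> 1 \<notin> I}"
  \<comment> \<open>The ideal generated by \<open>p\<close> is proper: 1/p is rational and not an
    integer, hence not an algebraic integer.\<close>
  have nunit: "1 \<noteq> x * of_int p" if "x \<in> carrier ?O" for x
  proof
    assume "1 = x * of_int p"
    then have x: "x = of_rat (1 / of_int p)" using p by (simp add: of_rat_divide field_simps)
    then have "x \<in> \<int>" using that rational_algebraic_int_is_int[of x] by (simp add: carO)
    then obtain z where "x = of_int z" by (auto elim: Ints_cases)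
    then have "(of_int (z * p) :: complex) = of_int 1" using \<open>1 = x * of_int p\<close> by simp
    then have "z * p = 1" by (simp only: of_int_eq_iff)
    then show False using p by (simp add: zmult_eq_1_iff)
  qed
  have "PIdl\<^bsub>?O\<^esub> (of_int p) \<in> \<A>"
    using O.cgenideal_ideal[OF intO[of p]] O.cgenideal_self[OF intO[of p]] nunit
    by (auto simp: \<A>_def cgenideal_def) (auto simp: ring_of_integers_def)
  then have "\<A> \<noteq> {}" by blast
  moreover have "\<Union>C \<in> \<A>" if C: "C \<noteq> {}" "subset.chain \<A> C" for C
  proof -
    have sub: "ideal I ?O" "of_int p \<in> I" "1 \<notin> I" if "I \<in> C" for I
      using C(2) that by (auto simp: subset_chain_def \<A>_def)
    have "ideal (\<Union>C) ?O"
    proof (rule idealI)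
      show "ring ?O" by (rule O.ring_axioms)
      show "subgroup (\<Union>C) (add_monoid ?O)"
      proof (rule O.add.subgroupI)
        show "\<Union>C \<subseteq> carrier ?O" using sub(1) ideal.Icarr by fastforce
        show "\<Union>C \<noteq> {}" using C(1) sub(2) by blast
      next
        fix a assume "a \<in> \<Union>C"
        then show "\<ominus>\<^bsub>?O\<^esub> a \<in> \<Union>C"
          using sub(1) by (metis UnionE UnionI additive_subgroup.a_inv_closed ideal.axioms(1))
      next
        fix a b assume "a \<in> \<Union>C" "b \<in> \<Union>C"
        then obtain I J where "I \<in> C" "J \<in> C" "a \<in> I" "b \<in> J" by blast
        moreover from this have "I \<subseteq> J \<or> J \<subseteq> I" using C(2) by (auto simp: subset_chain_def)
        ultimately obtain K where "K \<in> C" "a \<in> K" "b \<in> K" by blast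
        then show "a \<oplus>\<^bsub>?O\<^esub> b \<in> \<Union>C"
          using sub(1)[of K] by (meson UnionI additive_subgroup.a_closed ideal.axioms(1))
      qed
    next
      fix a x assume *: "a \<in> \<Union>C" "x \<in> carrier ?O"
      then obtain I where "I \<in> C" "a \<in> I" by blast
      then show "x \<otimes>\<^bsub>?O\<^esub> a \<in> \<Union>C" "a \<otimes>\<^bsub>?O\<^esub> x \<in> \<Union>C"
        using sub(1)[of I] *(2) by (meson UnionI ideal.I_l_closed ideal.I_r_closed)+
    qed
    then show ?thesis using C(1) sub by (auto simp: \<A>_def)
  qed
  ultimately obtain P where P: "P \<in> \<A>" "\<forall>X\<in>\<A>. P \<subseteq> X \<longrightarrow> X = P"
    using subset_Zorn_nonempty[of \<A>] by blast
  then have idP: "ideal P ?O" and pP: "of_int p \<in> P" and oneP: "1 \<notin> P" by (auto simp: \<A>_def)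
  interpret P: ideal P ?O by (rule idP)
  have "maximalideal P ?O"
  proof (rule maximalidealI[OF idP])
    show "carrier ?O \<noteq> P" using intO[of 1] oneP by auto
    fix J assume J: "ideal J ?O" "P \<subseteq> J" "J \<subseteq> carrier ?O"
    show "J = P \<or> J = carrier ?O"
    proof (cases "1 \<in> J")
      case True
      then have "J = carrier ?O"
        using ideal.one_imp_carrier[OF J(1)] by (simp add: ring_of_integers_def)
      then show ?thesis ..
    next
      case False
      then have "J \<in> \<A>" using J pP by (auto simp: \<A>_def)
      then show ?thesis using P(2) J(2) by blast
    qed
  qed
  then have prime: "primeideal P ?O" by (rule O.maximalideal_prime)
  have mult: "x \<in> P \<Longrightarrow> y \<in> carrier ?O \<Longrightarrow> x * y \<in> P" for x y
    using P.I_r_closed[of x y] by (simp add: ring_of_integers_def)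
  have add: "x \<in> P \<Longrightarrow> y \<in> P \<Longrightarrow> x + y \<in> P" for x y
    using P.a_closed[of x y] by (simp add: ring_of_integers_def)
  have "P \<inter> \<int> = range (\<lambda>k. complex_of_int (p * k))"
  proof (intro equalityI subsetI)
    fix x assume "x \<in> range (\<lambda>k. complex_of_int (p * k))"
    then obtain k where "x = of_int p * of_int k" by auto
    then show "x \<in> P \<inter> \<int>" using mult[OF pP intO[of k]] by auto
  next
    fix x assume x: "x \<in> P \<inter> \<int>"
    then obtain z where z: "x = of_int z" by (auto elim: Ints_cases)
    have "p dvd z"
    proof (rule ccontr)
      assume "\<not> p dvd z"
      then have "Rings.coprime z p" using assms(2) prime_imp_coprime[of p z] by (simp add: ac_simps)
      then obtain u v where "u * z + v * p = 1"
        using bezout_int[of z p] by (auto simp: coprime_iff_gcd_eq_1)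
      then have "(1 :: complex) = of_int (u * z + v * p)" by simp
      also have "\<dots> = x * of_int u + of_int p * of_int v" by (simp add: z)
      also have "\<dots> \<in> P" using x intO pP by (intro add mult) auto
      finally show False using oneP by simp
    qed
    then show "x \<in> range (\<lambda>k. complex_of_int (p * k))" using z by (auto elim!: dvdE)
  qed
  then show ?thesis using that prime unfolding prime_above_def by blast
qed

locale prime_above_field =
  fixes F P :: "complex set" and p :: int
  assumes number_field: "number_field F" and prime_p: "prime p" and above: "prime_above F p P"
begin

lemma subfield_F: "subfield F (class_ring :: complex ring)"
  using number_field by (simp add: number_field_def)

lemmas F_closed = subfield_complexD[OF subfield_F]

lemma F_diff: "x \<in> F \<Longrightarrow> y \<in> F \<Longrightarrow> x - y \<in> F"
  using F_closed(3)[of x "- y"] F_closed(5) by simp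

lemmas F_of_int = subfield_complex_of_int[OF subfield_F]

lemma F_of_rat: "of_rat r \<in> F"
proof -
  obtain a b where "quotient_of r = (a, b)" by force
  then have "r = of_int a / of_int b" by (rule quotient_of_div)
  then have "of_rat r = of_int a * inverse (of_int b :: complex)"
    by (simp add: of_rat_divide flip: divide_inverse)
  then show ?thesis using F_closed(4,6) F_of_int by metis
qed

lemma F_power: "x \<in> F \<Longrightarrow> x ^ k \<in> F"
  by (induction k) (auto intro: F_closed)

lemma F_sum: "(\<And>i. i \<in> I \<Longrightarrow> f i \<in> F) \<Longrightarrow> sum f I \<in> F"
  by (induction I rule: infinite_finite_induct) (auto intro: F_closed)

abbreviation "\<O> \<equiv> {x \<in> F. algebraic_int x}"

lemma O_add: "x \<in> \<O> \<Longrightarrow> y \<in> \<O> \<Longrightarrow> x + y \<in> \<O>" by (auto intro: F_closed algebraic_int_add)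
lemma O_mult: "x \<in> \<O> \<Longrightarrow> y \<in> \<O> \<Longrightarrow> x * y \<in> \<O>" by (auto intro: F_closed algebraic_int_mult)
lemma O_of_int: "of_int z \<in> \<O>" using F_of_int by (auto intro: int_imp_algebraic_int)
lemma O_power: "x \<in> \<O> \<Longrightarrow> x ^ k \<in> \<O>"
  by (induction k) (use O_mult O_of_int[of 1] in auto)
lemma O_uminus: "x \<in> \<O> \<Longrightarrow> - x \<in> \<O>" by (auto intro: F_closed)

lemma primeideal_P: "primeideal P (ring_of_integers F)"
  using above by (simp add: prime_above_def)

lemma P_subset: "x \<in> P \<Longrightarrow> x \<in> \<O>"
  using ideal.Icarr[OF primeideal.axioms(1)[OF primeideal_P]] by (simp add: ring_of_integers_def)

lemma P_mult: "x \<in> P \<Longrightarrow> y \<in> \<O> \<Longrightarrow> x * y \<in> P"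
  using ideal.I_r_closed[OF primeideal.axioms(1)[OF primeideal_P], of x y]
  by (simp add: ring_of_integers_def)

lemma P_add: "x \<in> P \<Longrightarrow> y \<in> P \<Longrightarrow> x + y \<in> P"
  using additive_subgroup.a_closed[OF ideal.axioms(1)[OF primeideal.axioms(1)[OF primeideal_P]], of x y]
  by (simp add: ring_of_integers_def)

lemma P_prime: "x * y \<in> P \<Longrightarrow> x \<in> \<O> \<Longrightarrow> y \<in> \<O> \<Longrightarrow> x \<in> P \<or> y \<in> P"
  using primeideal.I_prime[OF primeideal_P, of x y] by (simp add: ring_of_integers_def)

lemma P_of_int_iff: "of_int z \<in> P \<longleftrightarrow> p dvd z"
proof -
  have "of_int z \<in> P \<longleftrightarrow> of_int z \<in> P \<inter> \<int>" by simp
  also have "\<dots> \<longleftrightarrow> (of_int z :: complex) \<in> range (\<lambda>k. complex_of_int (p * k))"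
    using above by (simp add: prime_above_def)
  also have "\<dots> \<longleftrightarrow> p dvd z" by (auto simp: image_iff dvd_def simp flip: of_int_mult)
  finally show ?thesis .
qed

lemma one_notin_P: "1 \<notin> P"
  using P_of_int_iff[of 1] prime_gt_1_int[OF prime_p] by (auto simp: zdvd1_eq)

lemma p_gt_1: "p > 1" using prime_p by (rule prime_gt_1_int)

text \<open>\<open>ldiv N\<close> is membership in the ideal \<open>p\<^sup>N \<O>\<^sub>P\<close> of the localization of \<open>\<O>\<close> at \<open>P\<close>.\<close>

definition ldiv :: "nat \<Rightarrow> complex \<Rightarrow> bool" where
  "ldiv N x \<longleftrightarrow> (\<exists>a\<in>\<O>. \<exists>b\<in>\<O> - P. x * b = of_int p ^ N * a)"

lemma ldivI: "a \<in> \<O> \<Longrightarrow> b \<in> \<O> - P \<Longrightarrow> x * b = of_int p ^ N * a \<Longrightarrow> ldiv N x"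
  unfolding ldiv_def by (intro bexI)

lemma ldivE:
  assumes "ldiv N x"
  obtains a b where "a \<in> \<O>" "b \<in> \<O>" "b \<notin> P" "b \<noteq> 0" "x * b = of_int p ^ N * a"
proof -
  obtain a b where "a \<in> \<O>" "b \<in> \<O> - P" "x * b = of_int p ^ N * a" using assms ldiv_def by blast
  moreover have "0 \<in> P" using P_of_int_iff[of 0] by simp
  ultimately show ?thesis by (intro that[of a b]) auto
qed

lemma O_minus_P_mult: "b \<in> \<O> - P \<Longrightarrow> d \<in> \<O> - P \<Longrightarrow> b * d \<in> \<O> - P"
  using O_mult[of b d] P_prime[of b d] by blast

lemma ldiv_O: "a \<in> \<O> \<Longrightarrow> ldiv 0 a"
  by (rule ldivI[of a 1]) (use one_notin_P O_of_int[of 1] in auto)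

lemma ldiv_of_int: "ldiv 0 (of_int z)"
  using O_of_int by (rule ldiv_O)

lemma ldiv_zero [simp]: "ldiv N 0"
  by (rule ldivI[of 0 1]) (use one_notin_P O_of_int[of 1] O_of_int[of 0] in auto)

lemma ldiv_add:
  assumes "ldiv N x" "ldiv N y"
  shows "ldiv N (x + y)"
proof -
  obtain a b where ab: "a \<in> \<O>" "b \<in> \<O>" "b \<notin> P" "b \<noteq> 0" "x * b = of_int p ^ N * a"
    by (rule ldivE[OF assms(1)])
  obtain c d where cd: "c \<in> \<O>" "d \<in> \<O>" "d \<notin> P" "d \<noteq> 0" "y * d = of_int p ^ N * c"
    by (rule ldivE[OF assms(2)])
  have "(x + y) * (b * d) = (x * b) * d + (y * d) * b" by (simp add: algebra_simps)
  also have "\<dots> = of_int p ^ N * (a * d + c * b)" unfolding ab(5) cd(5) by (simp add: algebra_simps)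
  finally show ?thesis
    using O_minus_P_mult[of b d] ab cd O_add[OF O_mult O_mult, of a d c b]
    by (intro ldivI[of "a * d + c * b" "b * d"]) auto
qed

lemma ldiv_mult:
  assumes "ldiv N x" "ldiv M y"
  shows "ldiv (N + M) (x * y)"
proof -
  obtain a b where ab: "a \<in> \<O>" "b \<in> \<O>" "b \<notin> P" "b \<noteq> 0" "x * b = of_int p ^ N * a"
    by (rule ldivE[OF assms(1)])
  obtain c d where cd: "c \<in> \<O>" "d \<in> \<O>" "d \<notin> P" "d \<noteq> 0" "y * d = of_int p ^ M * c"
    by (rule ldivE[OF assms(2)])
  have "(x * y) * (b * d) = (x * b) * (y * d)" by (simp add: algebra_simps)
  also have "\<dots> = of_int p ^ (N + M) * (a * c)" unfolding ab(5) cd(5) by (simp add: power_add algebra_simps)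
  finally show ?thesis
    using O_minus_P_mult[of b d] ab cd O_mult[of a c]
    by (intro ldivI[of "a * c" "b * d"]) auto
qed

lemma ldiv_scale: "ldiv 0 x \<Longrightarrow> ldiv N y \<Longrightarrow> ldiv N (x * y)"
  using ldiv_mult[of 0 x N y] by simp

lemma ldiv_uminus: "ldiv N x \<Longrightarrow> ldiv N (- x)"
  using ldiv_scale[OF ldiv_of_int[of "-1"], of N x] by simp

lemma ldiv_diff: "ldiv N x \<Longrightarrow> ldiv N y \<Longrightarrow> ldiv N (x - y)"
  using ldiv_add[of N x "- y"] ldiv_uminus by simp

lemma ldiv_sum: "(\<And>i. i \<in> I \<Longrightarrow> ldiv N (f i)) \<Longrightarrow> ldiv N (sum f I)"
  by (induction I rule: infinite_finite_induct) (auto intro: ldiv_add)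

lemma ldiv_p_power: "ldiv N (of_int p ^ N)"
  by (rule ldivI[of 1 1]) (use one_notin_P O_of_int[of 1] in auto)

lemma ldiv_mono:
  assumes "ldiv N x" "M \<le> N"
  shows "ldiv M x"
proof -
  obtain a b where ab: "a \<in> \<O>" "b \<in> \<O>" "b \<notin> P" "b \<noteq> 0" "x * b = of_int p ^ N * a"
    by (rule ldivE[OF assms(1)])
  have "x * b = of_int p ^ M * (of_int (p ^ (N - M)) * a)"
    using assms(2) ab(5) by (simp flip: power_add mult.assoc)
  then show ?thesis
    using ab O_mult[OF O_of_int, of a "p ^ (N - M)"]
    by (intro ldivI[of "of_int (p ^ (N - M)) * a" b]) auto
qed

lemma ldiv_cancel_p:
  assumes "ldiv (N + k) (of_int p ^ k * x)"
  shows "ldiv N x"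
proof -
  obtain a b where ab: "a \<in> \<O>" "b \<in> \<O>" "b \<notin> P" "b \<noteq> 0" "of_int p ^ k * x * b = of_int p ^ (N + k) * a"
    by (rule ldivE[OF assms])
  have "of_int p ^ k * (x * b) = of_int p ^ k * (of_int p ^ N * a)"
    using ab(5) by (simp add: power_add mult_ac)
  then have "x * b = of_int p ^ N * a" using p_gt_1 by simp
  then show ?thesis using ab by (intro ldivI[of a b]) auto
qed

text \<open>Algebraic integers of \<open>F\<close> outside \<open>P\<close> are units of the
  localization, so \<open>u\<close> can be moved into the denominator.\<close>

lemma ldiv_divide_unit:
  assumes "ldiv N (u * x)" "u \<in> \<O>" "u \<notin> P"
  shows "ldiv N x"
proof -
  obtain a b where ab: "a \<in> \<O>" "b \<in> \<O>" "b \<notin> P" "b \<noteq> 0" "u * x * b = of_int p ^ N * a"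
    by (rule ldivE[OF assms(1)])
  then show ?thesis using O_minus_P_mult[of u b] assms(2,3)
    by (intro ldivI[of a "u * b"]) (auto simp: mult_ac)
qed

text \<open>The passage between \<open>F\<close> and the rationals. If the numerator
  \<open>c\<close> contained too low a power of \<open>p\<close>, cancelling it would leave an
  integer \<open>c'\<close> prime to \<open>p\<close> and a \<open>b\<close> outside
  \<open>P\<close> with \<open>c' * b\<close> in \<open>P\<close>. Primality gives \<open>c'\<close>
  in \<open>P\<close>, but the integers in \<open>P\<close> are the multiples of
  \<open>p\<close>.\<close>

lemma ldiv_of_rat_iff: "ldiv N (of_rat r) \<longleftrightarrow> p_integral p (r / of_int p ^ N)"
proof
  assume "p_integral p (r / of_int p ^ N)"
  then obtain a b where ab: "\<not> p dvd b" "r / of_int p ^ N = of_int a / of_int b"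
    by (auto simp: p_integral_def)
  have "b \<noteq> 0" using ab(1) by auto
  then have "r * of_int b = of_int p ^ N * of_int a"
    using ab(2) p_gt_1 by (simp add: field_simps)
  then have "of_rat (r * of_int b) = (of_rat (of_int p ^ N * of_int a) :: complex)" by simp
  then have "of_rat r * of_int b = of_int p ^ N * (of_int a :: complex)"
    by (simp add: of_rat_mult of_rat_power)
  then show "ldiv N (of_rat r)"
    using O_of_int[of a] O_of_int[of b] P_of_int_iff[of b] ab(1) by (intro ldivI) auto
next
  assume *: "ldiv N (of_rat r)"
  obtain a b where ab: "a \<in> \<O>" "b \<in> \<O>" "b \<notin> P" "b \<noteq> 0" "of_rat r * b = of_int p ^ N * a"
    by (rule ldivE[OF *])
  obtain c d where cd: "quotient_of r = (c, d)" by force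
  have d: "d > 0" using quotient_of_denom_pos[OF cd] .
  have r: "r = of_int c / of_int d" using quotient_of_div[OF cd] .
  let ?D = "d * p ^ N"
  define e where "e = multiplicity p ?D"
  have D0: "?D \<noteq> 0" using d p_gt_1 by simp
  have rD: "r / of_int p ^ N = of_int c / of_int ?D" by (simp add: r)
  have "p ^ e dvd c"
  proof (rule ccontr)
    assume nd: "\<not> p ^ e dvd c"
    then have "c \<noteq> 0" by auto
    define g where "g = multiplicity p c"
    have ge: "g < e"
      using nd power_dvd_iff_le_multiplicity[of c p e] \<open>c \<noteq> 0\<close> p_gt_1 by (auto simp: g_def not_le)
    obtain c' where c': "c = p ^ g * c'" unfolding g_def by (metis multiplicity_dvd dvdE)
    have "\<not> p ^ Suc g dvd c"
      unfolding g_def using \<open>c \<noteq> 0\<close> p_gt_1 by (subst power_dvd_iff_le_multiplicity) auto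
    then have c'p: "\<not> p dvd c'" using c' by auto
    have "p ^ e dvd ?D" unfolding e_def by (rule multiplicity_dvd)
    then have "p ^ Suc g dvd ?D" using ge by (meson Suc_leI dvd_trans le_imp_power_dvd)
    then obtain D' where D': "?D = p ^ Suc g * D'" by auto
    have "of_int c * b = of_int ?D * a"
    proof -
      have "of_int c = of_int d * (of_rat r :: complex)" using d by (simp add: r of_rat_divide)
      then have "of_int c * b = of_int d * (of_rat r * b)" by simp
      then show ?thesis unfolding ab(5) by simp
    qed
    then have "of_int p ^ g * (of_int c' * b) = of_int p ^ g * (of_int p * (of_int D' * a))"
      unfolding D' by (simp add: c' mult_ac)
    then have eq: "of_int c' * b = of_int p * (of_int D' * a)" using p_gt_1 by simp
    have "of_int p * (of_int D' * a) \<in> P"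
      using P_of_int_iff[of p] ab(1) O_of_int by (intro P_mult O_mult) auto
    then have "of_int c' * b \<in> P" using eq by simp
    then have "of_int c' \<in> P" using P_prime[of "of_int c'" b] O_of_int[of c'] ab by blast
    then show False using c'p P_of_int_iff by simp
  qed
  then show "p_integral p (r / of_int p ^ N)"
    unfolding rD using p_integral_divide_iff[OF prime_p D0] by (simp add: e_def)
qed

text \<open>Some nonzero integer multiple of \<open>x\<close> is integral. The part of that integer
  prime to \<open>p\<close> is a unit at \<open>P\<close>, so a power of \<open>p\<close> alone
  suffices as denominator.\<close>

lemma exists_ldiv:
  assumes "x \<in> F"
  obtains c where "ldiv 0 (of_int p ^ c * x)"
proof -
  obtain m :: int where m: "m \<noteq> 0" "algebraic_int (of_int m * x)"
    using algebraic_multiple_algebraic_int[OF number_field_algebraic[OF number_field assms]] .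
  define e where "e = multiplicity p m"
  obtain m' where m': "m = p ^ e * m'" unfolding e_def by (metis multiplicity_dvd dvdE)
  have "\<not> p ^ Suc e dvd m"
    unfolding e_def using m(1) p_gt_1 by (subst power_dvd_iff_le_multiplicity) auto
  then have "\<not> p dvd m'" using m' by auto
  then have "ldiv 0 (of_int p ^ e * x)"
    using m(2) F_of_int[of m] assms F_closed(4) O_of_int[of m'] P_of_int_iff[of m']
    by (intro ldivI[of "of_int m * x" "of_int m'"]) (auto simp: m' mult_ac)
  then show ?thesis using that by blast
qed

text \<open>If \<open>x\<close> is nonzero, p^c / x is integral at \<open>P\<close> for some
  \<open>c\<close>; multiplying by \<open>x\<close>, which is divisible by p^(c+1), makes p^c
  divisible by p^(c+1). Comparison with the rationals excludes this, without a valuation on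
  \<open>F\<close>.\<close>

lemma ldiv_all_imp_zero:
  assumes "\<And>N. ldiv N x"
  shows "x = 0"
proof (rule ccontr)
  assume "x \<noteq> 0"
  obtain a b where ab: "a \<in> \<O>" "b \<in> \<O>" "b \<notin> P" "b \<noteq> 0" "x * b = of_int p ^ 0 * a"
    by (rule ldivE[OF assms(1)[of 0]])
  then have x: "x = a * inverse b" by (simp add: field_simps)
  then have "inverse x \<in> F" using ab F_closed(4,6) by auto
  then obtain c where c: "ldiv 0 (of_int p ^ c * inverse x)" using exists_ldiv by blast
  have "ldiv (0 + Suc c) (of_int p ^ c * inverse x * x)" using ldiv_mult[OF c assms] by simp
  then have "ldiv (Suc c) (of_rat (of_int p ^ c))" using \<open>x \<noteq> 0\<close> by (simp add: of_rat_power mult.assoc)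
  then have "p_integral p (of_int p ^ c / of_int p ^ Suc c)" by (simp only: ldiv_of_rat_iff)
  then have "p_integral p (of_int 1 / of_int p)" using p_gt_1 by simp
  then have "p ^ multiplicity p p dvd 1"
    using p_integral_divide_iff[OF prime_p, of p 1] p_gt_1 by simp
  moreover have "multiplicity p p = 1" using p_gt_1 by (intro multiplicity_self) auto
  ultimately show False using p_gt_1 by simp
qed

end

section \<open>Annihilating products of a matrix and periodicity of its powers\<close>

lemma mult_mat_zero_vec: "A \<in> carrier_mat nr nc \<Longrightarrow> A *\<^sub>v 0\<^sub>v nc = 0\<^sub>v nr"
  by (intro eq_vecI) auto

lemma smult_mat_mult_vec:
  fixes M :: "'a :: comm_semiring_0 mat"
  assumes "M \<in> carrier_mat nr nc" "v \<in> carrier_vec nc"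
  shows "(k \<cdot>\<^sub>m M) *\<^sub>v v = k \<cdot>\<^sub>v (M *\<^sub>v v)"
  using assms
  by (intro eq_vecI) (auto simp: scalar_prod_def sum_distrib_left mult.assoc)

lemma vec_add_minus_cancel_left:
  "a \<in> carrier_vec n \<Longrightarrow> b \<in> carrier_vec n \<Longrightarrow> (a + b) - a = (b :: 'a :: ab_group_add vec)"
  by (intro eq_vecI) auto

lemma vec_add_minus_add:
  "\<lbrakk>a \<in> carrier_vec n; b \<in> carrier_vec n; c \<in> carrier_vec n; d \<in> carrier_vec n\<rbrakk> \<Longrightarrow>
    (a + b) - (c + d) = (a - c) + (b - (d :: 'a :: ab_group_add vec))"
  by (intro eq_vecI) (simp_all add: algebra_simps)

text \<open>The product of the commuting factors \<open>A - l\<close> for \<open>l\<close> in the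
  list, repetitions counted, applied to \<open>v\<close>. Over a field the vectors killed by such
  products form sums of generalized eigenspaces, and induction on the list removes one factor at a
  time.\<close>

fun annihilate :: "'a :: comm_ring_1 mat \<Rightarrow> 'a list \<Rightarrow> 'a vec \<Rightarrow> 'a vec" where
  "annihilate A [] v = v"
| "annihilate A (l # L) v = annihilate A L (A *\<^sub>v v - l \<cdot>\<^sub>v v)"

context
  fixes A :: "'a :: comm_ring_1 mat" and n :: nat
  assumes A: "A \<in> carrier_mat n n"
begin

lemma shift_carrier: "v \<in> carrier_vec n \<Longrightarrow> A *\<^sub>v v - l \<cdot>\<^sub>v v \<in> carrier_vec n"
  using A by auto

lemma shift_add:
  assumes "v \<in> carrier_vec n" "w \<in> carrier_vec n"
  shows "A *\<^sub>v (v + w) - l \<cdot>\<^sub>v (v + w) = (A *\<^sub>v v - l \<cdot>\<^sub>v v) + (A *\<^sub>v w - l \<cdot>\<^sub>v w)"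
  using A assms by (intro eq_vecI) (auto simp: scalar_prod_add_distrib[of _ n] algebra_simps)

lemma shift_smult:
  assumes "v \<in> carrier_vec n"
  shows "A *\<^sub>v (c \<cdot>\<^sub>v v) - l \<cdot>\<^sub>v (c \<cdot>\<^sub>v v) = c \<cdot>\<^sub>v (A *\<^sub>v v - l \<cdot>\<^sub>v v)"
  using A assms by (intro eq_vecI) (auto simp: algebra_simps)

lemma shift_minus:
  assumes "v \<in> carrier_vec n" "w \<in> carrier_vec n"
  shows "A *\<^sub>v (v - w) - l \<cdot>\<^sub>v (v - w) = (A *\<^sub>v v - l \<cdot>\<^sub>v v) - (A *\<^sub>v w - l \<cdot>\<^sub>v w)"
  using A assms by (intro eq_vecI) (auto simp: scalar_prod_minus_distrib[of _ n] algebra_simps)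

lemma shift_mult:
  assumes "v \<in> carrier_vec n"
  shows "A *\<^sub>v (A *\<^sub>v v) - l \<cdot>\<^sub>v (A *\<^sub>v v) = A *\<^sub>v (A *\<^sub>v v - l \<cdot>\<^sub>v v)"
  using A assms by (subst mult_minus_distrib_mat_vec[of _ n n]) (auto simp: mult_mat_vec)

lemma annihilate_add:
  assumes "v \<in> carrier_vec n" "w \<in> carrier_vec n"
  shows "annihilate A L (v + w) = annihilate A L v + annihilate A L w"
  using assms by (induction L arbitrary: v w) (auto simp: shift_add shift_carrier)

lemma annihilate_minus:
  assumes "v \<in> carrier_vec n" "w \<in> carrier_vec n"
  shows "annihilate A L (v - w) = annihilate A L v - annihilate A L w"
  using assms by (induction L arbitrary: v w) (auto simp: shift_minus shift_carrier)

lemma annihilate_smult: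
  assumes "v \<in> carrier_vec n"
  shows "annihilate A L (c \<cdot>\<^sub>v v) = c \<cdot>\<^sub>v annihilate A L v"
  using assms by (induction L arbitrary: v) (auto simp: shift_smult shift_carrier)

lemma annihilate_mult:
  assumes "v \<in> carrier_vec n"
  shows "annihilate A L (A *\<^sub>v v) = A *\<^sub>v annihilate A L v"
  using assms A by (induction L arbitrary: v) (auto simp: shift_mult shift_carrier)

lemma shift_zero: "A *\<^sub>v 0\<^sub>v n - l \<cdot>\<^sub>v 0\<^sub>v n = 0\<^sub>v n"
  using A by (intro eq_vecI) auto

lemma annihilate_zero: "annihilate A L (0\<^sub>v n) = 0\<^sub>v n"
  by (induction L) (simp_all add: shift_zero)

lemma annihilate_shift:
  assumes "v \<in> carrier_vec n"
  shows "annihilate A L (A *\<^sub>v v - l \<cdot>\<^sub>v v) = A *\<^sub>v annihilate A L v - l \<cdot>\<^sub>v annihilate A L v"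
  using assms A by (simp add: annihilate_minus annihilate_mult annihilate_smult)

lemma annihilate_append: "annihilate A (L @ M) v = annihilate A M (annihilate A L v)"
  by (induction L arbitrary: v) auto

lemma annihilate_append_zero_left:
  "annihilate A L v = 0\<^sub>v n \<Longrightarrow> annihilate A (L @ M) v = 0\<^sub>v n"
  by (simp add: annihilate_append annihilate_zero)

text \<open>The factors commute, so those of \<open>L\<close> may be applied after those of
  \<open>M\<close>; \<open>annihilate_shift\<close> moves one factor at a time.\<close>

lemma annihilate_append_zero_right:
  assumes "v \<in> carrier_vec n" "annihilate A M v = 0\<^sub>v n"
  shows "annihilate A (L @ M) v = 0\<^sub>v n"
  using assms
proof (induction L arbitrary: v)
  case (Cons l L)
  have "annihilate A M (A *\<^sub>v v - l \<cdot>\<^sub>v v) = 0\<^sub>v n"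
    using Cons.prems A by (simp add: annihilate_shift shift_zero)
  then show ?case using Cons shift_carrier by simp
qed simp

lemma annihilate_mult_zero:
  assumes "v \<in> carrier_vec n" "annihilate A L v = 0\<^sub>v n"
  shows "annihilate A L (A *\<^sub>v v) = 0\<^sub>v n"
  using assms A by (simp add: annihilate_mult mult_mat_zero_vec)

end

text \<open>If the coordinates of \<open>v\<close> vanish beyond index k, the factor with diagonal
  entry \<open>B $$ (k, k)\<close> removes coordinate k as well. The list is reversed because the
  last coordinate has to go first.\<close>

lemma annihilate_upper_triangular:
  assumes B: "B \<in> carrier_mat n n" "upper_triangular B" and "k \<le> n"
    and "v \<in> carrier_vec n" "\<And>i. k \<le> i \<Longrightarrow> i < n \<Longrightarrow> v $ i = 0"
  shows "annihilate B (rev (map (\<lambda>i. B $$ (i, i)) [0..<k])) v = 0\<^sub>v n"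
  using assms(3-5)
proof (induction k arbitrary: v)
  case 0
  then show ?case by (auto intro!: eq_vecI)
next
  case (Suc k)
  let ?w = "B *\<^sub>v v - B $$ (k, k) \<cdot>\<^sub>v v"
  have "?w $ i = 0" if i: "k \<le> i" "i < n" for i
  proof -
    have "(B *\<^sub>v v) $ i = (\<Sum>j\<in>{0..<n}. B $$ (i, j) * v $ j)"
      using i B(1) Suc.prems by (auto simp: scalar_prod_def)
    also have "\<dots> = (\<Sum>j\<in>{0..<n}. if j = i then B $$ (k, k) * v $ i else 0)"
    proof (rule sum.cong)
      fix j assume j: "j \<in> {0..<n}"
      show "B $$ (i, j) * v $ j = (if j = i then B $$ (k, k) * v $ i else 0)"
      proof (cases "j < i")
        case True
        then show ?thesis using B i by (auto simp: upper_triangular_def)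
      next
        case False
        then show ?thesis using Suc.prems(3)[of j] Suc.prems(3)[of i] i j by (cases "j = k") auto
      qed
    qed simp
    also have "\<dots> = B $$ (k, k) * v $ i" using i by simp
    finally show ?thesis using i B(1) Suc.prems by simp
  qed
  then have "annihilate B (rev (map (\<lambda>i. B $$ (i, i)) [0..<k])) ?w = 0\<^sub>v n"
    using Suc.prems B(1) by (intro Suc.IH) auto
  then show ?case by simp
qed

lemma annihilate_similar:
  assumes "P \<in> carrier_mat n n" "Q \<in> carrier_mat n n" "B \<in> carrier_mat n n"
    "Q * P = 1\<^sub>m n" "A = P * B * Q" "v \<in> carrier_vec n"
  shows "annihilate A L (P *\<^sub>v v) = P *\<^sub>v annihilate B L v"
  using assms(6)
proof (induction L arbitrary: v)
  case (Cons l L)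
  have "Q *\<^sub>v (P *\<^sub>v v) = (Q * P) *\<^sub>v v" using assms(1,2) Cons.prems by simp
  then have "A *\<^sub>v (P *\<^sub>v v) = P *\<^sub>v (B *\<^sub>v v)"
    using assms(1-5) Cons.prems by (simp add: assoc_mult_mat_vec[of _ n n _ n])
  then have "A *\<^sub>v (P *\<^sub>v v) - l \<cdot>\<^sub>v (P *\<^sub>v v) = P *\<^sub>v (B *\<^sub>v v - l \<cdot>\<^sub>v v)"
    using assms(1,3) Cons.prems
    by (subst mult_minus_distrib_mat_vec[of _ n n]) (auto simp: mult_mat_vec)
  then show ?case using Cons assms(3) by simp
qed simp

text \<open>Cayley-Hamilton in factored form: a Schur triangulation has the eigenvalues on its
  diagonal, and the triangular case is transported along the similarity. The eigenvalues appear as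
  list entries, ready to be sorted into those in a prime and the others.\<close>

lemma complex_mat_annihilated:
  fixes A :: "complex mat"
  assumes A: "A \<in> carrier_mat n n"
  obtains L where "set L \<subseteq> {l. eigenvalue A l}"
    "\<And>v. v \<in> carrier_vec n \<Longrightarrow> annihilate A L v = 0\<^sub>v n"
proof -
  obtain as where "char_poly A = (\<Prod>a\<leftarrow>as. [:- a, 1:])"
    using char_poly_factorized[OF A] by blast
  then obtain B where B: "B \<in> carrier_mat n n" "upper_triangular B" "similar_mat A B"
    using schur_decomposition_exists[OF A] by blast
  obtain P Q where "similar_mat_wit A B P Q" using B(3) by (auto simp: similar_mat_def)
  then have PQ: "P \<in> carrier_mat n n" "Q \<in> carrier_mat n n" "P * Q = 1\<^sub>m n" "Q * P = 1\<^sub>m n"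
    "A = P * B * Q"
    using A by (auto simp: similar_mat_wit_def Let_def)
  let ?L = "rev (map (\<lambda>i. B $$ (i, i)) [0..<n])"
  have "annihilate A ?L v = 0\<^sub>v n" if v: "v \<in> carrier_vec n" for v
  proof -
    have Qv: "Q *\<^sub>v v \<in> carrier_vec n" using PQ v by simp
    have "P *\<^sub>v (Q *\<^sub>v v) = v"
      using PQ v assoc_mult_mat_vec[of P n n Q n v] by simp
    then have "annihilate A ?L v = P *\<^sub>v annihilate B ?L (Q *\<^sub>v v)"
      using annihilate_similar[OF PQ(1,2) B(1) PQ(4,5) Qv, of ?L] by (simp only:)
    also have "annihilate B ?L (Q *\<^sub>v v) = 0\<^sub>v n"
      using Qv by (intro annihilate_upper_triangular[OF B(1,2)]) auto
    finally show ?thesis using PQ(1) by (simp add: mult_mat_zero_vec)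
  qed
  moreover have "set ?L \<subseteq> {l. eigenvalue A l}"
  proof
    fix l assume "l \<in> set ?L"
    then have "l \<in> set (diag_mat B)" using B(1) by (auto simp: diag_mat_def)
    then have "poly (char_poly B) l = 0"
      unfolding char_poly_upper_triangular[OF B(1,2)] by (auto simp: poly_prod_list_zero_iff)
    then show "l \<in> {l. eigenvalue A l}"
      using eigenvalue_root_char_poly[OF A] char_poly_similar[OF B(3)] by simp
  qed
  ultimately show ?thesis by (intro that)
qed

section \<open>Powers of an integer matrix modulo q\<close>

lemma finite_bounded_int_mats:
  "finite {M \<in> carrier_mat n n. \<forall>i<n. \<forall>j<n. M $$ (i, j) \<in> {0..<q::int}}"
proof (rule finite_subset)
  let ?I = "{..<n} \<times> {..<n}"
  show "finite (mat n n ` (?I \<rightarrow>\<^sub>E {0..<q}))" by (intro finite_imageI finite_PiE) auto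
  show "{M \<in> carrier_mat n n. \<forall>i<n. \<forall>j<n. M $$ (i, j) \<in> {0..<q}} \<subseteq> mat n n ` (?I \<rightarrow>\<^sub>E {0..<q})"
  proof
    fix M assume M: "M \<in> {M \<in> carrier_mat n n. \<forall>i<n. \<forall>j<n. M $$ (i, j) \<in> {0..<q}}"
    let ?f = "restrict (\<lambda>ij. M $$ ij) ?I"
    have "M = mat n n ?f" using M by (intro eq_matI) auto
    moreover have "?f \<in> ?I \<rightarrow>\<^sub>E {0..<q}" using M by auto
    ultimately show "M \<in> mat n n ` (?I \<rightarrow>\<^sub>E {0..<q})" by blast
  qed
qed

lemma pow_mat_add:
  fixes A :: "'a :: semiring_1 mat"
  assumes "A \<in> carrier_mat n n"
  shows "A ^\<^sub>m (a + b) = A ^\<^sub>m a * A ^\<^sub>m b"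
proof (induction b)
  case (Suc b)
  then show ?case using assms
    by (simp add: assoc_mult_mat[OF pow_carrier_mat[OF assms] pow_carrier_mat[OF assms] assms])
qed (use assms in simp)

text \<open>There are finitely many matrices modulo \<open>q\<close>, so A^a and A^b agree for some
  \<open>a < b\<close>, and from \<open>a\<close> on the powers have period
  \<open>c = b - a\<close>. The difference is kept as \<open>q\<close> times an integer matrix
  because the eigenvalues of that matrix are used later. If \<open>m \<ge> a\<close> is a multiple
  of \<open>c\<close>, then A^m is idempotent modulo \<open>q\<close>.\<close>

lemma int_mat_powers_periodic:
  fixes A :: "int mat"
  assumes A: "A \<in> carrier_mat n n" and q: "q > 0"
  shows "\<exists>a c. c > 0 \<and>
    (\<forall>m\<ge>a. \<forall>k. \<exists>B\<in>carrier_mat n n. A ^\<^sub>m m = A ^\<^sub>m (m + c * k) + q \<cdot>\<^sub>m B)"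
proof -
  define f where "f m = map_mat (\<lambda>x. x mod q) (A ^\<^sub>m m)" for m
  have "range f \<subseteq> {M \<in> carrier_mat n n. \<forall>i<n. \<forall>j<n. M $$ (i, j) \<in> {0..<q}}"
    using A q by (auto simp: f_def)
  then have "finite (range f)" using finite_bounded_int_mats finite_subset by blast
  then have "\<not> inj f" using finite_imageD[of f UNIV] infinite_UNIV_nat by blast
  then obtain a b where ab: "a < b" "f a = f b" unfolding inj_def by (metis linorder_neqE_nat)
  define c where "c = b - a"
  have pw: "A ^\<^sub>m k \<in> carrier_mat n n" for k using A by simp
  define B0 where "B0 = mat n n (\<lambda>ij. ((A ^\<^sub>m a) $$ ij - (A ^\<^sub>m b) $$ ij) div q)"
  have B0: "A ^\<^sub>m a = A ^\<^sub>m b + q \<cdot>\<^sub>m B0"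
  proof (rule eq_matI)
    fix i j assume "i < dim_row (A ^\<^sub>m b + q \<cdot>\<^sub>m B0)" "j < dim_col (A ^\<^sub>m b + q \<cdot>\<^sub>m B0)"
    then have ij: "i < n" "j < n" by (auto simp: B0_def)
    have "f a $$ (i, j) = f b $$ (i, j)" using ab by simp
    then have "q dvd (A ^\<^sub>m a) $$ (i, j) - (A ^\<^sub>m b) $$ (i, j)"
      using ij pw[THEN carrier_matD(1)] pw[THEN carrier_matD(2)]
      by (auto simp: f_def mod_eq_dvd_iff)
    then show "(A ^\<^sub>m a) $$ (i, j) = (A ^\<^sub>m b + q \<cdot>\<^sub>m B0) $$ (i, j)"
      using ij pw[THEN carrier_matD(1)] pw[THEN carrier_matD(2)] by (auto simp: B0_def)
  qed (use A in \<open>auto simp: B0_def\<close>)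
  have B0c: "B0 \<in> carrier_mat n n" by (simp add: B0_def)
  have step: "\<exists>B\<in>carrier_mat n n. A ^\<^sub>m m = A ^\<^sub>m (m + c) + q \<cdot>\<^sub>m B" if "m \<ge> a" for m
  proof -
    have "A ^\<^sub>m m = A ^\<^sub>m a * A ^\<^sub>m (m - a)" using that by (simp flip: pow_mat_add[OF A])
    also have "\<dots> = A ^\<^sub>m b * A ^\<^sub>m (m - a) + q \<cdot>\<^sub>m (B0 * A ^\<^sub>m (m - a))"
      unfolding B0 using pw B0c
      by (subst add_mult_distrib_mat[of _ n n]) (auto simp: mult_smult_assoc_mat[OF B0c pw])
    also have "A ^\<^sub>m b * A ^\<^sub>m (m - a) = A ^\<^sub>m (m + c)"
      using that ab by (simp add: c_def add.commute flip: pow_mat_add[OF A])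
    finally show ?thesis using B0c pw by (intro bexI[of _ "B0 * A ^\<^sub>m (m - a)"]) auto
  qed
  show ?thesis
  proof (rule exI[of _ a], rule exI[of _ c], intro conjI allI impI)
    show "c > 0" using ab by (simp add: c_def)
    fix m k assume m: "m \<ge> a"
    show "\<exists>B\<in>carrier_mat n n. A ^\<^sub>m m = A ^\<^sub>m (m + c * k) + q \<cdot>\<^sub>m B"
    proof (induction k)
      case 0
      show ?case using pw by (intro bexI[of _ "0\<^sub>m n n"]) auto
    next
      case (Suc k)
      then obtain B where B: "B \<in> carrier_mat n n" "A ^\<^sub>m m = A ^\<^sub>m (m + c * k) + q \<cdot>\<^sub>m B" by blast
      obtain B' where B': "B' \<in> carrier_mat n n"
        "A ^\<^sub>m (m + c * k) = A ^\<^sub>m (m + c * k + c) + q \<cdot>\<^sub>m B'"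
        using step[of "m + c * k"] m by auto
      have "A ^\<^sub>m m = A ^\<^sub>m (m + c * k + c) + q \<cdot>\<^sub>m B' + q \<cdot>\<^sub>m B" using B(2) B'(2) by simp
      also have "\<dots> = A ^\<^sub>m (m + c * k + c) + (q \<cdot>\<^sub>m B' + q \<cdot>\<^sub>m B)"
        using B(1) B'(1) pw by (intro assoc_add_mat[of _ n n]) auto
      also have "q \<cdot>\<^sub>m B' + q \<cdot>\<^sub>m B = q \<cdot>\<^sub>m (B' + B)"
        using B(1) B'(1) by (intro add_smult_distrib_left_mat[symmetric])
      also have "m + c * k + c = m + c * Suc k" by simp
      finally have "A ^\<^sub>m m = A ^\<^sub>m (m + c * Suc k) + q \<cdot>\<^sub>m (B' + B)" .
      then show ?case using B(1) B'(1) by (intro bexI[of _ "B' + B"]) auto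
    qed
  qed
qed

section \<open>The eigenspace at a prime\<close>

locale eigenspace_above = prime_above_field +
  fixes A :: "int mat" and n :: nat
  assumes A: "A \<in> carrier_mat n n"
    and eigenvalues_F: "{l. eigenvalue (map_mat complex_of_int A) l} \<subseteq> F"
begin

abbreviation AC :: "complex mat" where "AC \<equiv> map_mat of_int A"

text \<open>The power is formed over the integers before mapping, so that integer identities between
  powers, such as periodicity, apply directly.\<close>

abbreviation pw :: "nat \<Rightarrow> complex vec \<Rightarrow> complex vec" where
  "pw m v \<equiv> map_mat of_int (A ^\<^sub>m m) *\<^sub>v v"

lemma AC: "AC \<in> carrier_mat n n" using A by simp

lemma pow_A: "A ^\<^sub>m m \<in> carrier_mat n n" using A by simp

lemma pow_AC: "map_mat complex_of_int (A ^\<^sub>m m) \<in> carrier_mat n n" using A by simp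

lemma pw_carrier: "v \<in> carrier_vec n \<Longrightarrow> pw m v \<in> carrier_vec n"
  by (rule mult_mat_vec_carrier[OF pow_AC])

lemma pw_add:
  assumes "v \<in> carrier_vec n"
  shows "pw (m + k) v = pw m (pw k v)"
proof -
  have "map_mat complex_of_int (A ^\<^sub>m (m + k)) =
      map_mat of_int (A ^\<^sub>m m) * map_mat of_int (A ^\<^sub>m k)"
    unfolding pow_mat_add[OF A] by (rule of_int_hom.mat_hom_mult[OF pow_A pow_A])
  then show ?thesis using assoc_mult_mat_vec[OF pow_AC pow_AC assms] by simp
qed

lemma pw_0: "v \<in> carrier_vec n \<Longrightarrow> pw 0 v = v"
  using A by (simp add: of_int_hom.mat_hom_one)

lemma pw_1: "pw 1 v = AC *\<^sub>v v"
  using A by simp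

lemma pw_Suc: "v \<in> carrier_vec n \<Longrightarrow> pw (Suc m) v = pw m (AC *\<^sub>v v)"
  using pw_add[of v m 1] pw_1 by simp

lemma pw_Suc': "v \<in> carrier_vec n \<Longrightarrow> pw (Suc m) v = AC *\<^sub>v pw m v"
  using pw_add[of v 1 m] pw_1 by simp

lemma pw_minus:
  "v \<in> carrier_vec n \<Longrightarrow> w \<in> carrier_vec n \<Longrightarrow> pw m (v - w) = pw m v - pw m w"
  using pow_AC by (intro mult_minus_distrib_mat_vec)

lemma pw_plus:
  "v \<in> carrier_vec n \<Longrightarrow> w \<in> carrier_vec n \<Longrightarrow> pw m (v + w) = pw m v + pw m w"
  using pow_AC by (intro mult_add_distrib_mat_vec)

lemma pw_smult: "v \<in> carrier_vec n \<Longrightarrow> pw m (c \<cdot>\<^sub>v v) = c \<cdot>\<^sub>v pw m v"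
  using pow_AC by (intro mult_mat_vec)

lemma eigenvalue_O: "eigenvalue AC l \<Longrightarrow> l \<in> \<O>"
  using eigenvalues_F int_mat_eigenvalue_algebraic_int[OF A] by auto

definition F_vec :: "complex vec set" where
  "F_vec = {v \<in> carrier_vec n. \<forall>i<n. v $ i \<in> F}"

lemma F_vecD: "v \<in> F_vec \<Longrightarrow> v \<in> carrier_vec n" by (simp add: F_vec_def)

lemma F_vec_add: "v \<in> F_vec \<Longrightarrow> w \<in> F_vec \<Longrightarrow> v + w \<in> F_vec"
  by (auto simp: F_vec_def intro!: F_closed(3))

lemma F_vec_minus: "v \<in> F_vec \<Longrightarrow> w \<in> F_vec \<Longrightarrow> v - w \<in> F_vec"
  by (auto simp: F_vec_def intro!: F_diff)

lemma F_vec_smult: "c \<in> F \<Longrightarrow> v \<in> F_vec \<Longrightarrow> c \<cdot>\<^sub>v v \<in> F_vec"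
  by (auto simp: F_vec_def intro!: F_closed(4))

lemma F_vec_zero: "0\<^sub>v n \<in> F_vec"
  by (auto simp: F_vec_def intro!: F_closed(1))

lemma F_vec_mult:
  assumes "M \<in> carrier_mat n n" "\<And>i j. i < n \<Longrightarrow> j < n \<Longrightarrow> M $$ (i, j) \<in> F" "v \<in> F_vec"
  shows "M *\<^sub>v v \<in> F_vec"
  using assms by (auto simp: F_vec_def scalar_prod_def intro!: F_sum F_closed)

lemma F_vec_mult_int: "M \<in> carrier_mat n n \<Longrightarrow> v \<in> F_vec \<Longrightarrow> map_mat of_int M *\<^sub>v v \<in> F_vec"
  by (rule F_vec_mult) (auto intro: F_of_int)

lemma F_vec_shift: "l \<in> F \<Longrightarrow> v \<in> F_vec \<Longrightarrow> AC *\<^sub>v v - l \<cdot>\<^sub>v v \<in> F_vec"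
  using A by (intro F_vec_minus F_vec_mult_int F_vec_smult)

text \<open>\<open>A - l\<close> is invertible on the kernel of a product of factors with other
  eigenvalues. For the head \<open>m\<close>, if \<open>z\<close> solves the equation with
  right-hand side (A - m) y, then (A - l)(y - z) = (m - l) y, so (y - z)/(m - l) is a solution,
  again over \<open>F\<close>.\<close>

lemma shift_solvable:
  assumes "annihilate AC L y = 0\<^sub>v n" "y \<in> F_vec" "set L \<subseteq> F" "l \<in> F" "l \<notin> set L"
  shows "\<exists>z\<in>F_vec. annihilate AC L z = 0\<^sub>v n \<and> AC *\<^sub>v z - l \<cdot>\<^sub>v z = y"
  using assms
proof (induction L arbitrary: y)
  case Nil
  then show ?case
    using F_vec_zero shift_zero[OF AC] by (intro bexI[of _ "0\<^sub>v n"]) auto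
next
  case (Cons m L)
  let ?u = "AC *\<^sub>v y - m \<cdot>\<^sub>v y"
  have y: "y \<in> carrier_vec n" using Cons.prems F_vecD by blast
  obtain z where z: "z \<in> F_vec" "annihilate AC L z = 0\<^sub>v n" "AC *\<^sub>v z - l \<cdot>\<^sub>v z = ?u"
    using Cons.IH[of ?u] Cons.prems F_vec_shift by auto
  have zc: "z \<in> carrier_vec n" using z F_vecD by blast
  have ml: "m - l \<noteq> 0" using Cons.prems by auto
  define c where "c = inverse (m - l)"
  have cml: "c * (m - l) = 1" using ml by (simp add: c_def)
  let ?w = "c \<cdot>\<^sub>v (y - z)"
  have "?w \<in> F_vec"
    unfolding c_def using Cons.prems z by (intro F_vec_smult F_vec_minus F_closed(6) F_diff) auto
  moreover have "AC *\<^sub>v ?w - l \<cdot>\<^sub>v ?w = y"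
  proof -
    have "AC *\<^sub>v ?w - l \<cdot>\<^sub>v ?w = c \<cdot>\<^sub>v (AC *\<^sub>v (y - z) - l \<cdot>\<^sub>v (y - z))"
      using y zc by (intro shift_smult[OF AC]) auto
    also have "AC *\<^sub>v (y - z) - l \<cdot>\<^sub>v (y - z) = (AC *\<^sub>v y - l \<cdot>\<^sub>v y) - ?u"
      using y zc z(3) by (simp add: shift_minus[OF AC])
    also have "\<dots> = (m - l) \<cdot>\<^sub>v y"
      using y A by (intro eq_vecI) (auto simp: algebra_simps)
    also have "c \<cdot>\<^sub>v ((m - l) \<cdot>\<^sub>v y) = y" using cml by (simp add: smult_smult_assoc)
    finally show ?thesis .
  qed
  moreover have "annihilate AC (m # L) ?w = 0\<^sub>v n"
  proof -
    have "annihilate AC (m # L) z = 0\<^sub>v n"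
      using annihilate_append_zero_right[OF AC zc z(2), of "[m]"] by simp
    then have "annihilate AC (m # L) (y - z) = 0\<^sub>v n - 0\<^sub>v n"
      using Cons.prems(1) annihilate_minus[OF AC y zc, of "m # L"] by (simp only:)
    then have "annihilate AC (m # L) (y - z) = 0\<^sub>v n" by simp
    then have "annihilate AC (m # L) ?w = c \<cdot>\<^sub>v 0\<^sub>v n"
      using annihilate_smult[OF AC, of "y - z" "m # L" c] y zc by (simp only: minus_carrier_vec)
    also have "\<dots> = 0\<^sub>v n" by (intro eq_vecI) auto
    finally show ?thesis .
  qed
  ultimately show ?case by blast
qed

text \<open>Induction on the list, with (A - l) w = x + y already split. If \<open>l\<close> is in
  \<open>S\<close>, solve (A - l) z = y within the kernel belonging to y; then (A - l)(w - z) = x,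
  so w - z lies on the side of \<open>S\<close>. If not, x and y change roles. \<open>S\<close> is
  kept general since both a prime and a single eigenvalue are inserted for it.\<close>

lemma primary_decomposition:
  assumes "annihilate AC L w = 0\<^sub>v n" "w \<in> F_vec" "set L \<subseteq> F"
  shows "\<exists>x\<in>F_vec. \<exists>y\<in>F_vec. \<exists>Lx Ly. w = x + y \<and> set Lx \<subseteq> set L \<inter> S \<and> set Ly \<subseteq> set L - S \<and>
    annihilate AC Lx x = 0\<^sub>v n \<and> annihilate AC Ly y = 0\<^sub>v n"
  using assms
proof (induction L arbitrary: w)
  case Nil
  then have "w = 0\<^sub>v n + 0\<^sub>v n" by simp
  then show ?case using F_vec_zero
    by (intro bexI[of _ "0\<^sub>v n"] exI[of _ "[]"]) auto
next
  case (Cons l L)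
  have l: "l \<in> F" using Cons.prems by simp
  have w: "w \<in> carrier_vec n" using Cons.prems F_vecD by blast
  obtain x y Lx Ly where *: "x \<in> F_vec" "y \<in> F_vec" "AC *\<^sub>v w - l \<cdot>\<^sub>v w = x + y"
      "set Lx \<subseteq> set L \<inter> S" "set Ly \<subseteq> set L - S"
      "annihilate AC Lx x = 0\<^sub>v n" "annihilate AC Ly y = 0\<^sub>v n"
    using Cons.IH[of "AC *\<^sub>v w - l \<cdot>\<^sub>v w"] Cons.prems F_vec_shift by auto
  have xy: "x \<in> carrier_vec n" "y \<in> carrier_vec n" using * F_vecD by auto
  have sets: "set Lx \<subseteq> F" "set Ly \<subseteq> F" using *(4,5) Cons.prems(3) by auto
  have solve: "\<exists>z\<in>F_vec. annihilate AC M z = 0\<^sub>v n \<and> annihilate AC (l # M') (w - z) = 0\<^sub>v n"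
    if y': "y' \<in> F_vec" "x' \<in> F_vec" "x + y = x' + y'" "annihilate AC M y' = 0\<^sub>v n"
      "annihilate AC M' x' = 0\<^sub>v n" "set M \<subseteq> F" "l \<notin> set M" for x' y' M M'
  proof -
    obtain z where z: "z \<in> F_vec" "annihilate AC M z = 0\<^sub>v n" "AC *\<^sub>v z - l \<cdot>\<^sub>v z = y'"
      using shift_solvable[OF y'(4,1,6) l y'(7)] by blast
    have zc: "z \<in> carrier_vec n" using z F_vecD by blast
    have "AC *\<^sub>v (w - z) - l \<cdot>\<^sub>v (w - z) = (x' + y') - y'"
      using w zc z(3) *(3) y'(3) by (simp add: shift_minus[OF AC])
    also have "\<dots> = x'" using y'(1,2)[THEN F_vecD] by (intro eq_vecI) auto
    finally show ?thesis using z y'(5) by auto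
  qed
  have wz: "w = (w - z) + z" "w = z + (w - z)" if "z \<in> F_vec" for z
    using w F_vecD[OF that] by (auto intro!: eq_vecI)
  show ?case
  proof (cases "l \<in> S")
    case True
    obtain z where z: "z \<in> F_vec" "annihilate AC Ly z = 0\<^sub>v n" "annihilate AC (l # Lx) (w - z) = 0\<^sub>v n"
      using solve[OF *(2,1) refl *(7,6) sets(2)] * True by auto
    show ?thesis
    proof (intro bexI exI conjI)
      show "w = (w - z) + z" using wz z by blast
      show "set (l # Lx) \<subseteq> set (l # L) \<inter> S" "set Ly \<subseteq> set (l # L) - S" using * True by auto
    qed (use z Cons.prems F_vec_minus in auto)
  next
    case False
    have comm: "x + y = y + x" using xy by (rule comm_add_vec)
    obtain z where z: "z \<in> F_vec" "annihilate AC Lx z = 0\<^sub>v n" "annihilate AC (l # Ly) (w - z) = 0\<^sub>v n"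
      using solve[OF *(1,2) comm *(6,7) sets(1)] * False by auto
    show ?thesis
    proof (intro bexI exI conjI)
      show "w = z + (w - z)" using wz z by blast
      show "set Lx \<subseteq> set (l # L) \<inter> S" "set (l # Ly) \<subseteq> set (l # L) - S" using * False by auto
    qed (use z Cons.prems F_vec_minus in auto)
  qed
qed

text \<open>The eigenspace as a union of kernels instead of a span, which suits induction on lists;
  \<open>eigenspace_at_eq_X\<close> identifies the two.\<close>

definition X :: "complex vec set" where
  "X = {v \<in> F_vec. \<exists>L. set L \<subseteq> {l \<in> P. eigenvalue AC l} \<and> annihilate AC L v = 0\<^sub>v n}"

lemma X_add:
  assumes "v \<in> X" "w \<in> X"
  shows "v + w \<in> X"
proof -
  obtain L M where *: "v \<in> F_vec" "w \<in> F_vec" "set L \<subseteq> {l \<in> P. eigenvalue AC l}"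
    "set M \<subseteq> {l \<in> P. eigenvalue AC l}" "annihilate AC L v = 0\<^sub>v n" "annihilate AC M w = 0\<^sub>v n"
    using assms by (auto simp: X_def)
  have "annihilate AC (L @ M) (v + w) = 0\<^sub>v n"
    using * F_vecD annihilate_append_zero_left[OF AC, of L v M]
      annihilate_append_zero_right[OF AC, of w M L]
    by (simp add: annihilate_add[OF AC])
  moreover have "set (L @ M) \<subseteq> {l \<in> P. eigenvalue AC l}" using * by auto
  ultimately show ?thesis using * F_vec_add unfolding X_def by blast
qed

lemma X_smult:
  assumes "c \<in> F" "v \<in> X"
  shows "c \<cdot>\<^sub>v v \<in> X"
proof -
  obtain L where *: "v \<in> F_vec" "set L \<subseteq> {l \<in> P. eigenvalue AC l}" "annihilate AC L v = 0\<^sub>v n"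
    using assms by (auto simp: X_def)
  have "annihilate AC L (c \<cdot>\<^sub>v v) = c \<cdot>\<^sub>v 0\<^sub>v n"
    using * F_vecD by (simp add: annihilate_smult[OF AC])
  also have "\<dots> = 0\<^sub>v n" by (intro eq_vecI) auto
  finally show ?thesis using * F_vec_smult[OF assms(1)] unfolding X_def by blast
qed

lemma X_zero: "0\<^sub>v n \<in> X"
  using F_vec_zero unfolding X_def by (intro CollectI conjI exI[of _ "[]"]) auto

lemma X_F_vec: "v \<in> X \<Longrightarrow> v \<in> F_vec" by (simp add: X_def)

lemma X_carrier: "v \<in> X \<Longrightarrow> v \<in> carrier_vec n" by (simp add: X_def F_vec_def)

lemma char_matrix_pow_annihilate:
  assumes "v \<in> carrier_vec n"
  shows "char_matrix AC l ^\<^sub>m m *\<^sub>v v = annihilate AC (replicate m l) v"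
  using assms
proof (induction m arbitrary: v)
  case 0
  then show ?case using A by (simp add: char_matrix_def)
next
  case (Suc m)
  let ?C = "char_matrix AC l"
  have C: "?C \<in> carrier_mat n n" using A by simp
  have "?C *\<^sub>v v = AC *\<^sub>v v - l \<cdot>\<^sub>v v"
    using Suc.prems A
    by (intro eq_vecI) (auto simp: char_matrix_def add_scalar_prod_distrib[of _ n] algebra_simps)
  then have "?C ^\<^sub>m Suc m *\<^sub>v v = ?C ^\<^sub>m m *\<^sub>v (AC *\<^sub>v v - l \<cdot>\<^sub>v v)"
    using C Suc.prems by (simp add: assoc_mult_mat_vec[of _ n n _ n])
  then show ?case using Suc.IH[of "AC *\<^sub>v v - l \<cdot>\<^sub>v v"] Suc.prems AC by simp
qed

text \<open>The span in \<open>eigenspace_at\<close> takes its scalars from \<open>F\<close> but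
  lives in the complex vector space, so the module laws are wanted for this restriction of
  scalars.\<close>

lemma module_F_vec: "module ((class_ring :: complex ring)\<lparr>carrier := F\<rparr>) (module_vec TYPE(complex) n)"
proof -
  have "field ((class_ring :: complex ring)\<lparr>carrier := F\<rparr>)"
    by (rule ring.subfield_iff(2)[OF class_ring.ring_axioms subfield_F])
  then have "cring ((class_ring :: complex ring)\<lparr>carrier := F\<rparr>)" by (rule fieldE(1))
  moreover have "abelian_group (module_vec TYPE(complex) n)"
    by (rule module.axioms(2)[OF vec_module])
  ultimately show ?thesis
    by (intro module.intro module_axioms.intro)
       (auto simp: module_vec_simps add_smult_distrib_vec smult_add_distrib_vec smult_smult_assoc)
qed


lemma generalized_eigenvector_iff:
  "generalized_eigenvector AC v l \<longleftrightarrow>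
    v \<in> carrier_vec n \<and> v \<noteq> 0\<^sub>v n \<and> (\<exists>m. annihilate AC (replicate m l) v = 0\<^sub>v n)"
  using A char_matrix_pow_annihilate by (auto simp: generalized_eigenvector_def)

text \<open>\<open>X\<close> is closed under the operations and contains the generalized
  eigenvectors, hence their span. Conversely, induction over the finite set \<open>D\<close> of
  eigenvalues that occur splits off the component of one \<open>l\<close> by the primary
  decomposition with respect to the singleton of \<open>l\<close>.\<close>

lemma eigenspace_at_eq_X: "eigenspace_at F A P = X"
proof -
  let ?K = "(class_ring :: complex ring)\<lparr>carrier := F\<rparr>" and ?V = "module_vec TYPE(complex) n"
  define S where "S = {v. set\<^sub>v v \<subseteq> F \<and> (\<exists>l\<in>P. eigenvalue AC l \<and> generalized_eigenvector AC v l)}"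
  have eq: "eigenspace_at F A P = module.span ?K ?V S"
    using A by (simp add: eigenspace_at_def S_def)
  have F_vec_iff: "v \<in> F_vec \<longleftrightarrow> v \<in> carrier_vec n \<and> set\<^sub>v v \<subseteq> F" for v
    by (auto simp: F_vec_def vec_set_def)
  interpret M: module ?K ?V by (rule module_F_vec)
  have S_carrier: "S \<subseteq> carrier ?V"
    by (auto simp: S_def generalized_eigenvector_iff module_vec_simps)
  have "S \<subseteq> X"
  proof
    fix v assume "v \<in> S"
    then obtain l m where "l \<in> P" "eigenvalue AC l" "annihilate AC (replicate m l) v = 0\<^sub>v n" "v \<in> F_vec"
      by (auto simp: S_def generalized_eigenvector_iff F_vec_iff)
    then show "v \<in> X" unfolding X_def by (intro CollectI conjI exI[of _ "replicate m l"]) auto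
  qed
  moreover have "submodule ?K X ?V"
    using module_F_vec X_add X_smult X_zero X_carrier
    by (intro submodule.intro) (auto simp: module_vec_simps)
  ultimately have sub: "module.span ?K ?V S \<subseteq> X" by (rule M.span_is_subset)
  have sp: "submodule ?K (module.span ?K ?V S) ?V" by (rule M.span_is_submodule[OF S_carrier])
  have main: "v \<in> module.span ?K ?V S"
    if "finite D" "D \<subseteq> {l \<in> P. eigenvalue AC l}" "v \<in> F_vec" "set L \<subseteq> D" "annihilate AC L v = 0\<^sub>v n"
    for D L v
    using that
  proof (induction D arbitrary: L v)
    case empty
    then have "v = 0\<^sub>v n" by simp
    then show ?case using submodule.zero_closed[OF sp] by (simp add: module_vec_simps)
  next
    case (insert l D)
    have "set L \<subseteq> F" using insert.prems eigenvalues_F by auto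
    then obtain x y Lx Ly where *: "x \<in> F_vec" "y \<in> F_vec" "v = x + y" "set Lx \<subseteq> set L \<inter> {l}"
      "set Ly \<subseteq> set L - {l}" "annihilate AC Lx x = 0\<^sub>v n" "annihilate AC Ly y = 0\<^sub>v n"
      using primary_decomposition[OF insert.prems(4,2), of "{l}"] by blast
    have y: "y \<in> module.span ?K ?V S"
      using insert.prems * by (intro insert.IH[of y Ly]) auto
    \<comment> \<open>The zero vector is treated apart because generalized eigenvectors are nonzero
      by definition.\<close>
    have x: "x \<in> module.span ?K ?V S"
    proof (cases "x = 0\<^sub>v n")
      case True
      then show ?thesis using submodule.zero_closed[OF sp] by (simp add: module_vec_simps)
    next
      case False
      have "\<forall>z\<in>set Lx. z = l" using *(4) by auto
      then have "Lx = replicate (length Lx) l" by (simp add: replicate_length_same)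
      then have "annihilate AC (replicate (length Lx) l) x = 0\<^sub>v n" using *(6) by metis
      then have "x \<in> S"
        using False *(1) insert.prems(1)
        unfolding S_def by (auto simp: generalized_eigenvector_iff F_vec_iff)
      then show ?thesis using M.in_own_span[OF S_carrier] by blast
    qed
    show ?case using submodule.m_closed[OF sp x y] *(3) by (simp add: module_vec_simps)
  qed
  have "X \<subseteq> module.span ?K ?V S"
  proof
    fix v assume "v \<in> X"
    then obtain L where "v \<in> F_vec" "set L \<subseteq> {l \<in> P. eigenvalue AC l}" "annihilate AC L v = 0\<^sub>v n"
      by (auto simp: X_def)
    then show "v \<in> module.span ?K ?V S" using main[of "set L" v L] by auto
  qed
  then show ?thesis using sub eq by auto
qed

section \<open>Divisibility of vectors by powers of p at P\<close>

definition vdiv :: "nat \<Rightarrow> complex vec \<Rightarrow> bool" where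
  "vdiv N v \<longleftrightarrow> (\<forall>i<n. ldiv N (v $ i))"

lemma vdiv_add: "v \<in> carrier_vec n \<Longrightarrow> w \<in> carrier_vec n \<Longrightarrow> vdiv N v \<Longrightarrow> vdiv N w \<Longrightarrow> vdiv N (v + w)"
  by (auto simp: vdiv_def intro: ldiv_add)

lemma vdiv_minus: "v \<in> carrier_vec n \<Longrightarrow> w \<in> carrier_vec n \<Longrightarrow> vdiv N v \<Longrightarrow> vdiv N w \<Longrightarrow> vdiv N (v - w)"
  by (auto simp: vdiv_def intro: ldiv_diff)

lemma vdiv_smult: "v \<in> carrier_vec n \<Longrightarrow> ldiv N c \<Longrightarrow> vdiv M v \<Longrightarrow> vdiv (N + M) (c \<cdot>\<^sub>v v)"
  by (auto simp: vdiv_def intro: ldiv_mult)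

lemma vdiv_mono: "vdiv N v \<Longrightarrow> M \<le> N \<Longrightarrow> vdiv M v"
  by (auto simp: vdiv_def intro: ldiv_mono)

lemma vdiv_cancel_p: "v \<in> carrier_vec n \<Longrightarrow> vdiv (N + k) (of_int p ^ k \<cdot>\<^sub>v v) \<Longrightarrow> vdiv N v"
  by (auto simp: vdiv_def intro!: ldiv_cancel_p[of N k])

text \<open>The exponent \<open>d\<close> is the loss caused by the powers of \<open>p\<close> in
  the denominators of \<open>M\<close>.\<close>

lemma vdiv_mult:
  assumes "M \<in> carrier_mat n n" "\<And>i j. i < n \<Longrightarrow> j < n \<Longrightarrow> ldiv 0 (of_int p ^ d * M $$ (i, j))"
    "v \<in> carrier_vec n" "vdiv (N + d) v"
  shows "vdiv N (M *\<^sub>v v)"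
  unfolding vdiv_def
proof (intro allI impI)
  fix i assume i: "i < n"
  have "of_int p ^ d * (M *\<^sub>v v) $ i = (\<Sum>j<n. of_int p ^ d * M $$ (i, j) * v $ j)"
    using assms(1,3) i
    by (auto simp: scalar_prod_def sum_distrib_left mult.assoc atLeast0LessThan)
  also have "ldiv (N + d) \<dots>"
    using assms i by (intro ldiv_sum ldiv_scale[of "_ * _"]) (auto simp: vdiv_def)
  finally show "ldiv N ((M *\<^sub>v v) $ i)" by (rule ldiv_cancel_p)
qed

lemma vdiv_mult_int:
  assumes "M \<in> carrier_mat n n" "v \<in> carrier_vec n" "vdiv N v"
  shows "vdiv N (map_mat of_int M *\<^sub>v v)"
  using assms by (intro vdiv_mult[where d = 0]) (auto intro: ldiv_of_int)

lemma vdiv_pw: "v \<in> carrier_vec n \<Longrightarrow> vdiv N v \<Longrightarrow> vdiv N (pw m v)"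
  using pow_A by (rule vdiv_mult_int)

lemma eventually_ldiv:
  assumes "x \<in> F"
  shows "\<forall>\<^sub>F c in sequentially. ldiv 0 (of_int p ^ c * x)"
proof -
  obtain c where c: "ldiv 0 (of_int p ^ c * x)" using exists_ldiv[OF assms] .
  have "ldiv 0 (of_int p ^ k * x)" if "k \<ge> c" for k
  proof -
    have "of_int p ^ k * x = of_int (p ^ (k - c)) * (of_int p ^ c * x)"
      using that by (simp flip: power_add mult.assoc)
    then show ?thesis using ldiv_scale[OF ldiv_of_int c] by metis
  qed
  then show ?thesis using eventually_sequentially by blast
qed

lemma exists_vdiv:
  assumes "v \<in> F_vec"
  obtains c where "vdiv 0 (of_int p ^ c \<cdot>\<^sub>v v)"
proof -
  have "\<forall>\<^sub>F c in sequentially. \<forall>i\<in>{..<n}. ldiv 0 (of_int p ^ c * v $ i)"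
    using assms by (intro eventually_ball_finite ballI eventually_ldiv) (auto simp: F_vec_def)
  then obtain c where "\<forall>i\<in>{..<n}. ldiv 0 (of_int p ^ c * v $ i)"
    using eventually_happens' sequentially_bot by blast
  then have "vdiv 0 (of_int p ^ c \<cdot>\<^sub>v v)" using assms by (auto simp: vdiv_def F_vec_def)
  then show ?thesis by (rule that)
qed

lemma exists_mat_ldiv:
  assumes "M \<in> carrier_mat n n" "\<And>i j. i < n \<Longrightarrow> j < n \<Longrightarrow> M $$ (i, j) \<in> F"
  obtains d where "\<And>i j. i < n \<Longrightarrow> j < n \<Longrightarrow> ldiv 0 (of_int p ^ d * M $$ (i, j))"
proof -
  have "\<forall>\<^sub>F d in sequentially. \<forall>i\<in>{..<n}. \<forall>j\<in>{..<n}. ldiv 0 (of_int p ^ d * M $$ (i, j))"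
    using assms by (intro eventually_ball_finite ballI eventually_ldiv) auto
  then obtain d where "\<forall>i\<in>{..<n}. \<forall>j\<in>{..<n}. ldiv 0 (of_int p ^ d * M $$ (i, j))"
    using eventually_happens' sequentially_bot by blast
  then show ?thesis by (intro that) auto
qed

lemma vdiv_all_imp_zero:
  assumes "v \<in> carrier_vec n" "\<And>N. vdiv N v"
  shows "v = 0\<^sub>v n"
  using assms ldiv_all_imp_zero by (intro eq_vecI) (auto simp: vdiv_def)

text \<open>Induction on \<open>L\<close>: u = (A - m) y is killed by the remaining factors and A u
  is divisible by p^N, so u is. Then m y = A y - u is divisible too, and \<open>m\<close> is a unit
  at \<open>P\<close>. In this way \<open>A\<close> is cancelled on the unit part without an
  inverse.\<close>

lemma unit_eigenspace_vdiv:
  assumes "annihilate AC L y = 0\<^sub>v n" "y \<in> carrier_vec n" "set L \<subseteq> \<O> - P" "vdiv N (AC *\<^sub>v y)"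
  shows "vdiv N y"
  using assms
proof (induction L arbitrary: y)
  case Nil
  then show ?case by (auto simp: vdiv_def)
next
  case (Cons m L)
  let ?u = "AC *\<^sub>v y - m \<cdot>\<^sub>v y"
  have m: "m \<in> \<O>" "m \<notin> P" using Cons.prems by auto
  have u: "?u \<in> carrier_vec n" and Ay: "AC *\<^sub>v y \<in> carrier_vec n" using Cons.prems AC by auto
  have "AC *\<^sub>v ?u = AC *\<^sub>v (AC *\<^sub>v y) - m \<cdot>\<^sub>v (AC *\<^sub>v y)"
    using shift_mult[OF AC Cons.prems(2)] by simp
  moreover have "vdiv N (AC *\<^sub>v (AC *\<^sub>v y))" using vdiv_mult_int[OF A Ay] Cons.prems by simp
  moreover have "vdiv (0 + N) (m \<cdot>\<^sub>v (AC *\<^sub>v y))"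
    using Ay Cons.prems m by (intro vdiv_smult ldiv_O)
  ultimately have "vdiv N (AC *\<^sub>v ?u)"
    using vdiv_minus[of "AC *\<^sub>v (AC *\<^sub>v y)" "m \<cdot>\<^sub>v (AC *\<^sub>v y)" N] Ay AC by simp
  then have "vdiv N ?u" using Cons.IH[OF _ u] Cons.prems by auto
  then have "vdiv N (AC *\<^sub>v y - ?u)" using vdiv_minus[OF Ay u] Cons.prems by blast
  also have "AC *\<^sub>v y - ?u = m \<cdot>\<^sub>v y" using Ay Cons.prems by (intro eq_vecI) auto
  finally show "vdiv N y"
    using Cons.prems(2) m ldiv_divide_unit[of N m] by (auto simp: vdiv_def)
qed

lemma annihilate_pw:
  assumes "annihilate AC L y = 0\<^sub>v n" "y \<in> carrier_vec n"
  shows "annihilate AC L (pw m y) = 0\<^sub>v n"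
proof (induction m)
  case 0
  then show ?case using assms by (simp only: pw_0)
next
  case (Suc m)
  then show ?case
    using annihilate_mult_zero[OF AC pw_carrier[OF assms(2)]] assms(2) by (simp only: pw_Suc')
qed

lemma unit_eigenspace_vdiv_pw:
  assumes "annihilate AC L y = 0\<^sub>v n" "y \<in> carrier_vec n" "set L \<subseteq> \<O> - P" "vdiv N (pw m y)"
  shows "vdiv N y"
  using assms(4)
proof (induction m)
  case 0
  then show ?case using assms(2) by (simp only: pw_0)
next
  case (Suc m)
  then have "vdiv N (AC *\<^sub>v pw m y)" using assms(2) by (simp only: pw_Suc')
  then have "vdiv N (pw m y)"
    using unit_eigenspace_vdiv[OF annihilate_pw[OF assms(1,2)] pw_carrier[OF assms(2)] assms(3)]
    by blast
  then show ?case by (rule Suc.IH)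
qed

lemma pw_periodic:
  assumes B: "B \<in> carrier_mat n n" "A ^\<^sub>m a = A ^\<^sub>m b + q \<cdot>\<^sub>m B" and v: "v \<in> carrier_vec n"
  shows "pw a v = pw b v + of_int q \<cdot>\<^sub>v (map_mat of_int B *\<^sub>v v)"
proof -
  have BC: "map_mat complex_of_int B \<in> carrier_mat n n" using B(1) by simp
  have "map_mat complex_of_int (A ^\<^sub>m a) =
      map_mat of_int (A ^\<^sub>m b) + of_int q \<cdot>\<^sub>m map_mat of_int B"
    unfolding B(2) using B(1) carrier_matD[OF pow_A[of b]] by (intro eq_matI) auto
  then show ?thesis
    using BC v pow_AC[of b] smult_mat_mult_vec[OF BC v]
    by (simp add: add_mult_distrib_mat_vec[of _ n n])
qed

text \<open>
  If \<open>A\<^sup>a - A\<^sup>a\<^sup>+\<^sup>c = p B\<close> with \<open>B\<close> integral, then \<open>l\<^sup>a (1 - l\<^sup>c) / p\<close> is an eigenvalue of \<open>B\<close>, hence an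
  algebraic integer; and \<open>1 - l\<^sup>c\<close> is a unit at \<open>P\<close>.
\<close>

lemma eigenvalue_power_ldiv:
  assumes "l \<in> P" "eigenvalue AC l"
  obtains a where "ldiv 1 (l ^ a)"
proof -
  obtain a c where ac: "c > 0"
    "\<forall>m\<ge>a. \<forall>k. \<exists>B\<in>carrier_mat n n. A ^\<^sub>m m = A ^\<^sub>m (m + c * k) + p \<cdot>\<^sub>m B"
    using int_mat_powers_periodic[OF A, of p] p_gt_1 by auto
  obtain B where B: "B \<in> carrier_mat n n" "A ^\<^sub>m a = A ^\<^sub>m (a + c) + p \<cdot>\<^sub>m B"
    using ac(2)[rule_format, of a 1] by auto
  obtain v where v: "v \<in> carrier_vec n" "v \<noteq> 0\<^sub>v n" "AC *\<^sub>v v = l \<cdot>\<^sub>v v"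
    using assms(2) A by (auto simp: eigenvalue_def eigenvector_def)
  have pv: "pw m v = l ^ m \<cdot>\<^sub>v v" for m
  proof (induction m)
    case 0
    then show ?case unfolding pw_0[OF v(1)] by simp
  next
    case (Suc m)
    have "pw (Suc m) v = AC *\<^sub>v (l ^ m \<cdot>\<^sub>v v)" using Suc pw_Suc'[OF v(1)] by (simp only:)
    also have "\<dots> = l ^ m \<cdot>\<^sub>v (l \<cdot>\<^sub>v v)" using v AC by (simp add: mult_mat_vec)
    finally show ?case by (simp add: smult_smult_assoc mult.commute)
  qed
  define z where "z = (l ^ a - l ^ (a + c)) / of_int p"
  have e: "l ^ a \<cdot>\<^sub>v v = l ^ (a + c) \<cdot>\<^sub>v v + of_int p \<cdot>\<^sub>v (map_mat of_int B *\<^sub>v v)"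
    using pw_periodic[OF B v(1)] unfolding pv .
  have "map_mat of_int B *\<^sub>v v = z \<cdot>\<^sub>v v"
  proof (rule eq_vecI)
    fix i assume "i < dim_vec (z \<cdot>\<^sub>v v)"
    then have i: "i < n" using v(1) by auto
    have "(l ^ a \<cdot>\<^sub>v v) $ i = (l ^ (a + c) \<cdot>\<^sub>v v + of_int p \<cdot>\<^sub>v (map_mat of_int B *\<^sub>v v)) $ i"
      using e by simp
    then have "l ^ a * v $ i = l ^ (a + c) * v $ i + of_int p * (map_mat of_int B *\<^sub>v v) $ i"
      using i v(1) B(1) by simp
    then have "(map_mat of_int B *\<^sub>v v) $ i = z * v $ i"
      using p_gt_1 by (simp add: z_def field_simps)
    then show "(map_mat of_int B *\<^sub>v v) $ i = (z \<cdot>\<^sub>v v) $ i" using i v(1) by simp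
  qed (use B(1) v(1) in auto)
  then have "eigenvalue (map_mat of_int B) z"
    using B(1) v unfolding eigenvalue_def eigenvector_def by (intro exI[of _ v]) auto
  then have "algebraic_int z" using int_mat_eigenvalue_algebraic_int[OF B(1)] by blast
  moreover have lF: "l \<in> F" using eigenvalues_F assms by auto
  then have "z \<in> F"
    unfolding z_def divide_inverse by (intro F_closed(4) F_closed(6) F_diff F_power F_of_int)
  ultimately have z: "z \<in> \<O>" by simp
  have lO: "l \<in> \<O>" using P_subset[OF assms(1)] .
  have lc: "l ^ c \<in> P"
  proof -
    obtain c' where "c = Suc c'" using ac(1) gr0_implies_Suc by blast
    then show ?thesis using P_mult[OF assms(1) O_power[OF lO, of c']] by simp
  qed
  have "1 - l ^ c \<in> \<O>" using O_add[OF O_of_int[of 1] O_uminus[OF O_power[OF lO]], of c] by simp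
  moreover have "1 - l ^ c \<notin> P" using P_add[of "1 - l ^ c" "l ^ c"] lc one_notin_P by auto
  moreover have "l ^ a * (1 - l ^ c) = of_int p ^ 1 * z"
    using p_gt_1 by (simp add: z_def field_simps power_add)
  ultimately have "ldiv 1 (l ^ a)" using z by (intro ldivI[of z "1 - l ^ c"]) auto
  then show ?thesis by (rule that)
qed

text \<open>Induction on the factors. With u = (A - l) v one has A^(m+1) v = l A^m v + A^m u, and
  A^m u is eventually as divisible as desired. Up to such terms A^(m+a) v is l^a A^m v, and since
  l^a is divisible by \<open>p\<close>, every \<open>a\<close> steps gain one factor
  \<open>p\<close>.\<close>

lemma eigenspace_contracting:
  assumes "annihilate AC L x = 0\<^sub>v n" "x \<in> F_vec" "set L \<subseteq> {l \<in> P. eigenvalue AC l}"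
  shows "\<forall>\<^sub>F m in sequentially. vdiv N (pw m x)"
  using assms
proof (induction L arbitrary: x N)
  case Nil
  have "vdiv N (pw m x)" for m
    using Nil mult_mat_zero_vec[OF pow_AC] by (auto simp: vdiv_def)
  then show ?case by simp
next
  case (Cons l L)
  have l: "l \<in> P" "eigenvalue AC l" using Cons.prems by auto
  have lF: "l \<in> F" using eigenvalues_F l by auto
  have lO: "ldiv 0 (l ^ i)" for i using O_power[OF P_subset[OF l(1)]] by (rule ldiv_O)
  obtain a where a: "ldiv 1 (l ^ a)" using eigenvalue_power_ldiv[OF l] .
  \<comment> \<open>Scaling by \<open>p ^ c\<close> makes the vector integral at \<open>P\<close>,
    which starts the induction on the exponent \<open>M\<close>; the scaling is paid back at the end
    by asking for exponent \<open>N + c\<close>.\<close>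
  obtain c where c: "vdiv 0 (of_int p ^ c \<cdot>\<^sub>v x)" using exists_vdiv[OF Cons.prems(2)] .
  define v where "v = of_int p ^ c \<cdot>\<^sub>v x"
  have vF: "v \<in> F_vec"
    unfolding v_def using Cons.prems(2) by (intro F_vec_smult F_power F_of_int)
  have v: "v \<in> carrier_vec n" and x: "x \<in> carrier_vec n" using vF Cons.prems(2) F_vecD by auto
  define u where "u = AC *\<^sub>v v - l \<cdot>\<^sub>v v"
  have uF: "u \<in> F_vec" unfolding u_def using lF vF by (rule F_vec_shift)
  have uc: "u \<in> carrier_vec n" using uF F_vecD by auto
  have "annihilate AC (l # L) v = of_int p ^ c \<cdot>\<^sub>v 0\<^sub>v n"
    unfolding v_def using annihilate_smult[OF AC x, of "l # L"] Cons.prems(1) by (simp only:)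
  also have "\<dots> = 0\<^sub>v n" by (intro eq_vecI) auto
  finally have "annihilate AC L u = 0\<^sub>v n" by (simp add: u_def)
  then have small: "\<forall>\<^sub>F m in sequentially. vdiv M (pw m u)" for M
    using Cons.IH[OF _ uF] Cons.prems(3) by auto
  have rec: "pw (Suc m) v = l \<cdot>\<^sub>v pw m v + pw m u" for m
  proof -
    have "pw m u = pw m (AC *\<^sub>v v) - l \<cdot>\<^sub>v pw m v"
      unfolding u_def using v AC by (simp add: pw_minus pw_smult)
    moreover have "pw (Suc m) v = pw m (AC *\<^sub>v v)" using v by (rule pw_Suc)
    ultimately show ?thesis
      using pw_carrier[OF v, of m] pw_carrier[of "AC *\<^sub>v v" m] v AC by (auto intro!: eq_vecI)
  qed
  have "\<forall>\<^sub>F m in sequentially. vdiv M (pw m v)" for M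
  proof (induction M)
    case 0
    then show ?case using vdiv_pw[OF v] c by (simp add: v_def)
  next
    case (Suc M)
    obtain m0 where m0: "\<And>m. m \<ge> m0 \<Longrightarrow> vdiv M (pw m v) \<and> vdiv (Suc M) (pw m u)"
      using eventually_conj[OF Suc small[of "Suc M"]] unfolding eventually_sequentially by blast
    have diff: "vdiv (Suc M) (pw (m + i) v - l ^ i \<cdot>\<^sub>v pw m v)" if m: "m \<ge> m0" for m i
    proof (induction i)
      case 0
      then show ?case using pw_carrier[OF v, of m] by (auto simp: vdiv_def)
    next
      case (Suc i)
      have "pw (m + Suc i) v - l ^ Suc i \<cdot>\<^sub>v pw m v =
          l \<cdot>\<^sub>v (pw (m + i) v - l ^ i \<cdot>\<^sub>v pw m v) + pw (m + i) u"
        unfolding add_Suc_right rec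
        using pw_carrier[OF v, of m] pw_carrier[OF v, of "m + i"] pw_carrier[OF uc, of "m + i"]
        by (intro eq_vecI) (auto simp: algebra_simps)
      moreover have "vdiv (0 + Suc M) (l \<cdot>\<^sub>v (pw (m + i) v - l ^ i \<cdot>\<^sub>v pw m v))"
        using pw_carrier[OF v, of m] pw_carrier[OF v, of "m + i"] Suc lO[of 1]
        by (intro vdiv_smult) auto
      moreover have "vdiv (Suc M) (pw (m + i) u)" using m0[of "m + i"] m by simp
      ultimately show ?case
        using pw_carrier[OF v, of m] pw_carrier[OF v, of "m + i"] pw_carrier[OF uc, of "m + i"]
          vdiv_add[of "l \<cdot>\<^sub>v (pw (m + i) v - l ^ i \<cdot>\<^sub>v pw m v)" "pw (m + i) u" "Suc M"] by simp
    qed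
    have "vdiv (Suc M) (pw m v)" if m: "m \<ge> m0 + a" for m
    proof -
      define k where "k = m - a"
      have k: "m = k + a" "k \<ge> m0" using m by (auto simp: k_def)
      have "vdiv (1 + M) (l ^ a \<cdot>\<^sub>v pw k v)"
        using m0[OF k(2)] a pw_carrier[OF v] by (intro vdiv_smult) auto
      then have "vdiv (Suc M) ((pw (k + a) v - l ^ a \<cdot>\<^sub>v pw k v) + l ^ a \<cdot>\<^sub>v pw k v)"
        using diff[OF k(2), of a] pw_carrier[OF v] by (intro vdiv_add) auto
      also have "(pw (k + a) v - l ^ a \<cdot>\<^sub>v pw k v) + l ^ a \<cdot>\<^sub>v pw k v = pw m v"
        using pw_carrier[OF v, of k] pw_carrier[OF v, of m] k(1) by (intro eq_vecI) auto
      finally show ?thesis .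
    qed
    then show ?case unfolding eventually_sequentially by blast
  qed
  from this[of "N + c"] show ?case
  proof (rule eventually_mono)
    fix m assume "vdiv (N + c) (pw m v)"
    then show "vdiv N (pw m x)"
      using vdiv_cancel_p[OF pw_carrier[OF x], of N c] pw_smult[OF x] by (simp only: v_def)
  qed
qed

lemma X_contracting: "v \<in> X \<Longrightarrow> \<forall>\<^sub>F m in sequentially. vdiv N (pw m v)"
  using eigenspace_contracting unfolding X_def by blast

text \<open>The primary decomposition with respect to the set \<open>P\<close>. Eigenvalues are
  algebraic integers of \<open>F\<close>, so those outside \<open>P\<close> are units at
  \<open>P\<close>.\<close>

lemma F_vec_decomposition:
  assumes "w \<in> F_vec"
  obtains x y L where "x \<in> X" "y \<in> F_vec" "w = x + y" "set L \<subseteq> \<O> - P" "annihilate AC L y = 0\<^sub>v n"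
proof -
  obtain L where L: "set L \<subseteq> {l. eigenvalue AC l}"
    "\<And>v. v \<in> carrier_vec n \<Longrightarrow> annihilate AC L v = 0\<^sub>v n"
    using complex_mat_annihilated[OF AC] by blast
  have LF: "set L \<subseteq> F" using L(1) eigenvalues_F by blast
  obtain x y Lx Ly where *: "x \<in> F_vec" "y \<in> F_vec" "w = x + y" "set Lx \<subseteq> set L \<inter> P"
      "set Ly \<subseteq> set L - P" "annihilate AC Lx x = 0\<^sub>v n" "annihilate AC Ly y = 0\<^sub>v n"
    using primary_decomposition[OF L(2)[OF F_vecD[OF assms]] assms LF, of P] by blast
  have "x \<in> X" unfolding X_def using * L(1) by (intro CollectI conjI exI[of _ Lx]) auto
  moreover have "set Ly \<subseteq> \<O> - P" using *(5) L(1) eigenvalue_O by blast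
  ultimately show ?thesis using * by (intro that)
qed


text \<open>The hypothesis \<open>int\<close> expresses that T A^(-k) becomes integral after
  multiplication by a power of \<open>A\<close>. Given N, take k with A^k v divisible by p^N; then
  A^l T v is divisible as well, and so, after subtracting the contracting component x, is some A^m
  y. Cancelling A^m on the unit part makes y divisible by p^N for every N, so y = 0.\<close>

lemma X_stable:
  assumes T: "T \<in> carrier_mat n n" "\<And>i j. i < n \<Longrightarrow> j < n \<Longrightarrow> T $$ (i, j) \<in> F"
    and int: "\<And>k. \<exists>l. \<exists>M\<in>carrier_mat n n. map_mat of_int (A ^\<^sub>m l) * T = map_mat of_int M * map_mat of_int (A ^\<^sub>m k)"
    and v: "v \<in> X"
  shows "T *\<^sub>v v \<in> X"
proof -
  have vc: "v \<in> carrier_vec n" using v by (rule X_carrier)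
  have w: "T *\<^sub>v v \<in> F_vec" using F_vec_mult[OF T X_F_vec[OF v]] .
  have wc: "T *\<^sub>v v \<in> carrier_vec n" using w by (rule F_vecD)
  obtain x y L where *: "x \<in> X" "y \<in> F_vec" "T *\<^sub>v v = x + y" "set L \<subseteq> \<O> - P" "annihilate AC L y = 0\<^sub>v n"
    using F_vec_decomposition[OF w] .
  have xc: "x \<in> carrier_vec n" and yc: "y \<in> carrier_vec n"
    using X_carrier[OF *(1)] F_vecD[OF *(2)] by auto
  have "vdiv N y" for N
  proof -
    obtain k where k: "vdiv N (pw k v)"
      using X_contracting[OF v, of N] unfolding eventually_sequentially by blast
    obtain m0 where m0: "\<And>m. m \<ge> m0 \<Longrightarrow> vdiv N (pw m x)"
      using X_contracting[OF *(1), of N] unfolding eventually_sequentially by blast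
    obtain l M where M: "M \<in> carrier_mat n n"
      "map_mat of_int (A ^\<^sub>m l) * T = map_mat of_int M * map_mat of_int (A ^\<^sub>m k)"
      using int[of k] by blast
    have MC: "map_mat complex_of_int M \<in> carrier_mat n n" using M(1) by simp
    have "pw l (T *\<^sub>v v) = (map_mat of_int (A ^\<^sub>m l) * T) *\<^sub>v v"
      using assoc_mult_mat_vec[OF pow_AC T(1) vc] by simp
    also have "\<dots> = map_mat of_int M *\<^sub>v pw k v"
      unfolding M(2) using assoc_mult_mat_vec[OF MC pow_AC vc] by simp
    finally have "vdiv N (pw l (T *\<^sub>v v))"
      using vdiv_mult_int[OF M(1) pw_carrier[OF vc] k] by simp
    then have "vdiv N (pw (m0 + l) (T *\<^sub>v v))"
      unfolding pw_add[OF wc] by (rule vdiv_pw[OF pw_carrier[OF wc]])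
    then have "vdiv N (pw (m0 + l) (T *\<^sub>v v) - pw (m0 + l) x)"
      using m0[of "m0 + l"] pw_carrier[OF wc] pw_carrier[OF xc] by (intro vdiv_minus) auto
    also have "pw (m0 + l) (T *\<^sub>v v) - pw (m0 + l) x = pw (m0 + l) y"
      unfolding *(3) pw_plus[OF xc yc]
      by (rule vec_add_minus_cancel_left[OF pw_carrier[OF xc] pw_carrier[OF yc]])
    finally show "vdiv N y" by (rule unit_eigenspace_vdiv_pw[OF *(5) yc *(4)])
  qed
  then have "y = 0\<^sub>v n" by (rule vdiv_all_imp_zero[OF yc])
  then show ?thesis using *(1,3) xc by simp
qed

text \<open>
  If \<open>A\<^sup>2\<^sup>m \<equiv> A\<^sup>m\<close> modulo a high power of \<open>p\<close>, then \<open>A\<^sup>m\<close> is close to the projection with kernel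
  \<open>X\<close>, so stability of \<open>X\<close> under \<open>T\<close> says that \<open>A\<^sup>m T (1 - A\<^sup>m)\<close> is small.
\<close>

lemma X_stable_imp_vdiv_vec:
  assumes T: "T \<in> carrier_mat n n" "\<And>i j. i < n \<Longrightarrow> j < n \<Longrightarrow> T $$ (i, j) \<in> F"
    and stable: "\<And>v. v \<in> X \<Longrightarrow> T *\<^sub>v v \<in> X" and e: "e \<in> F_vec"
  shows "\<forall>\<^sub>F K in sequentially. \<forall>\<^sub>F m in sequentially.
    (\<exists>B\<in>carrier_mat n n. A ^\<^sub>m m = A ^\<^sub>m (m + m) + p ^ K \<cdot>\<^sub>m B) \<longrightarrow>
    vdiv N (pw m (T *\<^sub>v (e - pw m e)))"
proof -
  obtain x y L where *: "x \<in> X" "y \<in> F_vec" "e = x + y" "set L \<subseteq> \<O> - P" "annihilate AC L y = 0\<^sub>v n"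
    using F_vec_decomposition[OF e] .
  have xc: "x \<in> carrier_vec n" and yc: "y \<in> carrier_vec n"
    using X_carrier[OF *(1)] F_vecD[OF *(2)] by auto
  obtain c where c: "vdiv 0 (of_int p ^ c \<cdot>\<^sub>v y)" using exists_vdiv[OF *(2)] .
  obtain d where d: "\<And>i j. i < n \<Longrightarrow> j < n \<Longrightarrow> ldiv 0 (of_int p ^ d * T $$ (i, j))"
    using exists_mat_ldiv[OF T] by blast
  have Tc: "T *\<^sub>v v \<in> carrier_vec n" if "v \<in> carrier_vec n" for v using T(1) that by simp
  have vT: "vdiv N (T *\<^sub>v v)" if "v \<in> carrier_vec n" "vdiv (N + d) v" for v
    using vdiv_mult[OF T(1) d that] by blast
  \<comment> \<open>The bound on \<open>K\<close> pays for the denominators \<open>p ^ d\<close> of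
    \<open>T\<close> and \<open>p ^ c\<close> of the unit component \<open>y\<close>.\<close>
  have small: "\<forall>\<^sub>F m in sequentially. (\<exists>B\<in>carrier_mat n n. A ^\<^sub>m m = A ^\<^sub>m (m + m) + p ^ K \<cdot>\<^sub>m B) \<longrightarrow>
      vdiv N (pw m (T *\<^sub>v (e - pw m e)))" if K: "K \<ge> N + d + c" for K
    using X_contracting[OF stable[OF *(1)], of N] X_contracting[OF *(1), of "N + d"]
  proof eventually_elim
    case (elim m)
    show ?case
    proof
      assume "\<exists>B\<in>carrier_mat n n. A ^\<^sub>m m = A ^\<^sub>m (m + m) + p ^ K \<cdot>\<^sub>m B"
      then obtain B where B: "B \<in> carrier_mat n n" "A ^\<^sub>m m = A ^\<^sub>m (m + m) + p ^ K \<cdot>\<^sub>m B" by blast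
      \<comment> \<open>On the unit component approximate idempotence gives A^m u = p^K B y, and A^m
        can be cancelled there, so \<open>u\<close> itself is small. On the component
        \<open>x\<close> smallness comes from the contraction of both \<open>x\<close> and T
        x.\<close>
      define u where "u = y - pw m y"
      have uc: "u \<in> carrier_vec n" using yc pw_carrier[OF yc] by (simp add: u_def)
      have BC: "map_mat complex_of_int B \<in> carrier_mat n n" using B(1) by simp
      have "pw m y = pw (m + m) y + of_int p ^ K \<cdot>\<^sub>v (map_mat of_int B *\<^sub>v y)"
        using pw_periodic[OF B yc] by simp
      then have pu: "pw m u = of_int p ^ K \<cdot>\<^sub>v (map_mat of_int B *\<^sub>v y)"
        unfolding u_def pw_minus[OF yc pw_carrier[OF yc]] pw_add[OF yc, symmetric]
        using vec_add_minus_cancel_left[OF pw_carrier[OF yc, of "m + m"],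
            of "of_int p ^ K \<cdot>\<^sub>v (map_mat of_int B *\<^sub>v y)"] BC yc
        by (simp only: smult_carrier_vec mult_mat_vec_carrier)
      have "vdiv (K + 0) (of_int p ^ K \<cdot>\<^sub>v (map_mat of_int B *\<^sub>v (of_int p ^ c \<cdot>\<^sub>v y)))"
        using B(1) c BC by (intro vdiv_smult ldiv_p_power vdiv_mult_int) (use yc in auto)
      also have "of_int p ^ K \<cdot>\<^sub>v (map_mat of_int B *\<^sub>v (of_int p ^ c \<cdot>\<^sub>v y)) = of_int p ^ c \<cdot>\<^sub>v pw m u"
        unfolding pu mult_mat_vec[OF BC yc] by (simp add: smult_smult_assoc mult.commute)
      finally have "vdiv K (of_int p ^ c \<cdot>\<^sub>v pw m u)" by simp
      then have "vdiv (N + d + c) (of_int p ^ c \<cdot>\<^sub>v pw m u)" using K by (rule vdiv_mono)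
      then have 1: "vdiv (N + d) (pw m u)" by (rule vdiv_cancel_p[OF pw_carrier[OF uc]])
      have "annihilate AC L u = 0\<^sub>v n"
        unfolding u_def using *(5) annihilate_pw[OF *(5) yc, of m]
          annihilate_minus[OF AC yc pw_carrier[OF yc, of m], of L] by simp
      then have "vdiv (N + d) u" using uc *(4) 1 by (rule unit_eigenspace_vdiv_pw)
      then have 3: "vdiv N (pw m (T *\<^sub>v u))" using uc by (intro vdiv_pw vT Tc)
      have 2: "vdiv N (pw m (T *\<^sub>v pw m x))"
        by (rule vdiv_pw[OF Tc[OF pw_carrier[OF xc]] vT[OF pw_carrier[OF xc] elim(2)]])
      have "e - pw m e = x - pw m x + u"
        unfolding *(3) u_def pw_plus[OF xc yc]
        by (rule vec_add_minus_add[OF xc yc pw_carrier[OF xc] pw_carrier[OF yc]])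
      then have "T *\<^sub>v (e - pw m e) = T *\<^sub>v x - T *\<^sub>v pw m x + T *\<^sub>v u"
        using T(1) uc xc pw_carrier[OF xc, of m] by (simp add: mult_add_distrib_mat_vec[of _ n n] mult_minus_distrib_mat_vec[of _ n n])
      then have "pw m (T *\<^sub>v (e - pw m e)) = pw m (T *\<^sub>v x) - pw m (T *\<^sub>v pw m x) + pw m (T *\<^sub>v u)"
        using Tc[OF uc] Tc[OF xc] Tc[OF pw_carrier[OF xc, of m]] by (simp add: pw_plus pw_minus)
      then show "vdiv N (pw m (T *\<^sub>v (e - pw m e)))"
        using elim(1) 2 3 Tc[OF uc] Tc[OF xc] Tc[OF pw_carrier[OF xc, of m]]
        by (simp add: vdiv_add vdiv_minus pw_carrier)
    qed
  qed
  show ?thesis by (rule eventually_sequentiallyI[of "N + d + c"]) (rule small)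
qed

text \<open>\<open>K\<close> is fixed for all unit vectors at once, before a period modulo
  \<open>p ^ K\<close> is sought, since the period depends on \<open>K\<close>. The bound
  \<open>s\<close> allows the caller to ask in addition that A^m makes a given vector
  integral.\<close>

lemma X_stable_imp_vdiv:
  assumes T: "T \<in> carrier_mat n n" "\<And>i j. i < n \<Longrightarrow> j < n \<Longrightarrow> T $$ (i, j) \<in> F"
    and stable: "\<And>v. v \<in> X \<Longrightarrow> T *\<^sub>v v \<in> X"
  shows "\<exists>m\<ge>s. \<forall>j<n. vdiv N (pw m (T *\<^sub>v (unit_vec n j - pw m (unit_vec n j))))"
proof -
  let ?Q = "\<lambda>j m. vdiv N (pw m (T *\<^sub>v (unit_vec n j - pw m (unit_vec n j))))"
  have unit: "unit_vec n j \<in> F_vec" if "j < n" for j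
    using that F_closed(1,2) by (auto simp: F_vec_def unit_vec_def)
  have "\<forall>\<^sub>F K in sequentially. \<forall>j\<in>{..<n}. \<forall>\<^sub>F m in sequentially.
      (\<exists>B\<in>carrier_mat n n. A ^\<^sub>m m = A ^\<^sub>m (m + m) + p ^ K \<cdot>\<^sub>m B) \<longrightarrow> ?Q j m"
    using unit by (intro eventually_ball_finite ballI X_stable_imp_vdiv_vec[OF T stable]) auto
  then obtain K where "\<forall>j\<in>{..<n}. \<forall>\<^sub>F m in sequentially.
      (\<exists>B\<in>carrier_mat n n. A ^\<^sub>m m = A ^\<^sub>m (m + m) + p ^ K \<cdot>\<^sub>m B) \<longrightarrow> ?Q j m"
    using eventually_happens' sequentially_bot by blast
  then have "\<forall>\<^sub>F m in sequentially. \<forall>j\<in>{..<n}.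
      (\<exists>B\<in>carrier_mat n n. A ^\<^sub>m m = A ^\<^sub>m (m + m) + p ^ K \<cdot>\<^sub>m B) \<longrightarrow> ?Q j m"
    by (intro eventually_ball_finite finite_lessThan)
  then obtain m0 where m0: "\<forall>m\<ge>m0. \<forall>j\<in>{..<n}.
      (\<exists>B\<in>carrier_mat n n. A ^\<^sub>m m = A ^\<^sub>m (m + m) + p ^ K \<cdot>\<^sub>m B) \<longrightarrow> ?Q j m"
    unfolding eventually_sequentially ..
  have q: "p ^ K > 0" using p_gt_1 by simp
  obtain a c where ac: "c > 0"
    "\<forall>m\<ge>a. \<forall>k. \<exists>B\<in>carrier_mat n n. A ^\<^sub>m m = A ^\<^sub>m (m + c * k) + p ^ K \<cdot>\<^sub>m B"
    using int_mat_powers_periodic[OF A q] by auto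
  \<comment> \<open>A multiple of the period, so that \<open>m + m = m + c * (a + m0 + s)\<close>,
    and not below any of the three bounds because \<open>c > 0\<close>.\<close>
  define m where "m = c * (a + m0 + s)"
  have ge: "m \<ge> a + m0 + s" using ac(1) by (simp add: m_def)
  then have "m \<ge> a" by simp
  then have ex: "\<exists>B\<in>carrier_mat n n. A ^\<^sub>m m = A ^\<^sub>m (m + m) + p ^ K \<cdot>\<^sub>m B"
    using ac(2)[rule_format, of m "a + m0 + s"] by (simp only: m_def[symmetric])
  have "m \<ge> m0" using ge by simp
  then have all: "\<forall>j\<in>{..<n}. (\<exists>B\<in>carrier_mat n n. A ^\<^sub>m m = A ^\<^sub>m (m + m) + p ^ K \<cdot>\<^sub>m B) \<longrightarrow> ?Q j m"
    by (rule m0[THEN spec, THEN mp])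
  have "?Q j m" if "j < n" for j
    by (rule mp[OF bspec[OF all] ex]) (use that in simp)
  then show ?thesis using ge by (intro exI[of _ m]) auto
qed

end

section \<open>The group $G_A$ and its localizations\<close>

lemma p_integral_of_int: "prime p \<Longrightarrow> p_integral p (of_int z)"
  unfolding p_integral_def by (intro exI[of _ z] exI[of _ 1]) (auto simp: zdvd1_eq dest: prime_gt_1_int)

lemma p_integral_Ints: "prime p \<Longrightarrow> r \<in> \<int> \<Longrightarrow> p_integral p r"
  using p_integral_of_int by (auto elim: Ints_cases)

lemma p_integral_add:
  assumes "prime p" "p_integral p r" "p_integral p s"
  shows "p_integral p (r + s)"
proof -
  obtain a b c d where "\<not> p dvd b" "r = of_int a / of_int b" "\<not> p dvd d" "s = of_int c / of_int d"
    using assms(2,3) by (auto simp: p_integral_def)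
  moreover from this have "b \<noteq> 0" "d \<noteq> 0" by auto
  ultimately show ?thesis
    using assms(1) unfolding p_integral_def
    by (intro exI[of _ "a * d + c * b"] exI[of _ "b * d"])
       (auto simp: prime_dvd_mult_iff field_simps)
qed

lemma p_integral_mult:
  assumes "prime p" "p_integral p r" "p_integral p s"
  shows "p_integral p (r * s)"
proof -
  obtain a b c d where "\<not> p dvd b" "r = of_int a / of_int b" "\<not> p dvd d" "s = of_int c / of_int d"
    using assms(2,3) by (auto simp: p_integral_def)
  then show ?thesis
    using assms(1) unfolding p_integral_def
    by (intro exI[of _ "a * c"] exI[of _ "b * d"]) (auto simp: prime_dvd_mult_iff)
qed

lemma p_integral_uminus: "prime p \<Longrightarrow> p_integral p r \<Longrightarrow> p_integral p (- r)"
  using p_integral_mult[of p "of_int (- 1)" r] p_integral_of_int[of p "- 1"] by simp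

lemma p_integral_diff: "prime p \<Longrightarrow> p_integral p r \<Longrightarrow> p_integral p s \<Longrightarrow> p_integral p (r - s)"
  using p_integral_add[of p r "- s"] p_integral_uminus by simp

lemma p_integral_sum:
  assumes "prime p" "\<And>i. i \<in> I \<Longrightarrow> p_integral p (f i)"
  shows "p_integral p (sum f I)"
  using assms(2)
  by (induction I rule: infinite_finite_induct)
     (use p_integral_of_int[OF assms(1), of 0] p_integral_add[OF assms(1)] in auto)

lemma p_integral_divide:
  assumes "\<not> p dvd d" "of_int d * r \<in> \<int>"
  shows "p_integral p r"
proof -
  obtain z where "of_int d * r = of_int z" using assms(2) by (auto elim: Ints_cases)
  moreover have "d \<noteq> 0" using assms(1) by auto
  ultimately have "r = of_int z / of_int d" by (simp add: field_simps)
  then show ?thesis using assms(1) unfolding p_integral_def by blast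
qed

lemma Ints_if_p_integral:
  assumes "\<And>p. prime p \<Longrightarrow> p_integral p r"
  shows "r \<in> \<int>"
proof -
  obtain a b where ab: "quotient_of r = (a, b)" by force
  have b: "b > 0" using quotient_of_denom_pos[OF ab] .
  have r: "r = of_int a / of_int b" using quotient_of_div[OF ab] .
  have cop: "Rings.coprime a b" using quotient_of_coprime[OF ab] .
  have "b = 1"
  proof (rule ccontr)
    assume "b \<noteq> 1"
    then obtain p where p: "prime p" "p dvd b"
      using b prime_divisor_exists[of b] by (auto simp: zdvd1_eq)
    have "p_integral p (of_int a / of_int b)" using assms[OF p(1)] r by simp
    then have "p ^ multiplicity p b dvd a" using p_integral_divide_iff[OF p(1), of b a] b by simp
    moreover have "multiplicity p b \<ge> 1"
      using p b prime_gt_1_int[OF p(1)] power_dvd_iff_le_multiplicity[of b p 1] by auto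
    then have "p dvd p ^ multiplicity p b" by (intro dvd_power) simp
    ultimately have "p dvd a" by (metis dvd_trans)
    then have "p dvd 1" using cop p(2) by (meson coprime_common_divisor)
    then show False using prime_gt_1_int[OF p(1)] by (simp add: zdvd1_eq)
  qed
  then show ?thesis using r by simp
qed

lemma eventually_p_integral:
  assumes "prime p"
  shows "\<forall>\<^sub>F c in sequentially. p_integral p (of_int p ^ c * r)"
proof -
  have p: "p > 1" using assms by (rule prime_gt_1_int)
  obtain a b where ab: "quotient_of r = (a, b)" by force
  have b: "b > 0" using quotient_of_denom_pos[OF ab] .
  have r: "r = of_int a / of_int b" using quotient_of_div[OF ab] .
  have "p_integral p (of_int p ^ c * r)" if "c \<ge> multiplicity p b" for c
  proof -
    have "of_int p ^ c * r = of_int (p ^ c * a) / of_int b" by (simp add: r)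
    moreover have "p ^ multiplicity p b dvd p ^ c * a" using that by (simp add: le_imp_power_dvd)
    ultimately show ?thesis using p_integral_divide_iff[OF assms, of b "p ^ c * a"] b by simp
  qed
  then show ?thesis by (rule eventually_sequentiallyI)
qed

lemma adjoin_inverse_iff:
  assumes "d \<noteq> 0"
  shows "r \<in> adjoin_inverse d \<longleftrightarrow> (\<exists>k. of_int d ^ k * r \<in> \<int>)"
proof
  assume "r \<in> adjoin_inverse d"
  then obtain f :: "int poly" where r: "r = poly (map_poly of_int f) (1 / of_int d)"
    by (auto simp: adjoin_inverse_def)
  have "of_int d ^ degree f * r = (\<Sum>i\<le>degree f. of_int (poly.coeff f i) * of_int d ^ (degree f - i))"
    unfolding r poly_altdef sum_distrib_left using assms
    by (auto simp: power_divide power_diff coeff_map_poly intro!: sum.cong)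
  also have "\<dots> \<in> \<int>" by auto
  finally show "\<exists>k. of_int d ^ k * r \<in> \<int>" by blast
next
  assume "\<exists>k. of_int d ^ k * r \<in> \<int>"
  then obtain k z where "of_int d ^ k * r = of_int z" by (auto elim: Ints_cases)
  then have "r = of_int z * (1 / of_int d) ^ k" using assms by (simp add: field_simps)
  also have "\<dots> = poly (map_poly of_int (Polynomial.monom z k)) (1 / of_int d)"
    by (simp add: poly_monom of_int_hom.map_poly_hom_monom)
  finally show "r \<in> adjoin_inverse d" unfolding adjoin_inverse_def by (rule range_eqI)
qed

lemma mult_unit_vec_index:
  fixes M :: "'a :: semiring_1 mat"
  shows "M \<in> carrier_mat n n \<Longrightarrow> i < n \<Longrightarrow> j < n \<Longrightarrow> (M *\<^sub>v unit_vec n j) $ i = M $$ (i, j)"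
  by (simp add: scalar_prod_right_unit)

locale nonsingular_int_mat =
  fixes A :: "int mat" and n :: nat
  assumes A: "A \<in> carrier_mat n n" and det: "det A \<noteq> 0"
begin

abbreviation qp :: "nat \<Rightarrow> rat mat" where "qp m \<equiv> map_mat rat_of_int (A ^\<^sub>m m)"

lemma pow_A: "A ^\<^sub>m m \<in> carrier_mat n n" using A by simp

lemma qp: "qp m \<in> carrier_mat n n" using A by simp

lemma qp_eq: "qp m = map_mat rat_of_int A ^\<^sub>m m"
  using of_int_hom.mat_hom_pow[OF A] .

lemma qp_carrier: "v \<in> carrier_vec n \<Longrightarrow> qp m *\<^sub>v v \<in> carrier_vec n"
  by (rule mult_mat_vec_carrier[OF qp])

lemma qp_add:
  assumes "v \<in> carrier_vec n"
  shows "qp (m + k) *\<^sub>v v = qp m *\<^sub>v (qp k *\<^sub>v v)"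
proof -
  have "qp (m + k) = qp m * qp k"
    unfolding pow_mat_add[OF A] by (rule of_int_hom.mat_hom_mult[OF pow_A pow_A])
  then show ?thesis using assoc_mult_mat_vec[OF qp qp assms] by simp
qed

lemma qp_0: "v \<in> carrier_vec n \<Longrightarrow> qp 0 *\<^sub>v v = v"
  using A by (simp add: of_int_hom.mat_hom_one)

lemma Ints_mult_vec:
  assumes "M \<in> carrier_mat n n" "v \<in> carrier_vec n" "\<And>i. i < n \<Longrightarrow> v $ i \<in> \<int>" "i < n"
  shows "(map_mat rat_of_int M *\<^sub>v v) $ i \<in> \<int>"
  using assms by (auto simp: scalar_prod_def intro!: Ints_sum Ints_mult)

lemma p_integral_mult_vec:
  assumes "prime p" "M \<in> carrier_mat n n" "\<And>i j. i < n \<Longrightarrow> j < n \<Longrightarrow> p_integral p (M $$ (i, j))"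
    "v \<in> carrier_vec n" "\<And>i. i < n \<Longrightarrow> p_integral p (v $ i)" "i < n"
  shows "p_integral p ((M *\<^sub>v v) $ i)"
  using assms by (auto simp: scalar_prod_def intro!: p_integral_sum p_integral_mult)

lemma p_integral_qp:
  assumes "prime p" "v \<in> carrier_vec n" "\<And>i. i < n \<Longrightarrow> p_integral p (v $ i)" "i < n"
  shows "p_integral p ((qp m *\<^sub>v v) $ i)"
  using assms carrier_matD[OF pow_A[of m]]
  by (intro p_integral_mult_vec[OF assms(1) qp]) (auto intro!: p_integral_of_int)

text \<open>Negative powers of \<open>A\<close> enter only through cancellation on vectors, so both
  cancellation laws are packaged with the matrix \<open>B\<close> that \<open>mat_zpow\<close>
  uses.\<close>

lemma inverse_exists:
  "\<exists>B\<in>carrier_mat n n. mat_inverse (map_mat rat_of_int A) = Some B \<and>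
    (\<forall>l. \<forall>v\<in>carrier_vec n. qp l *\<^sub>v (B ^\<^sub>m l *\<^sub>v v) = v \<and> B ^\<^sub>m l *\<^sub>v (qp l *\<^sub>v v) = v)"
proof -
  let ?A = "map_mat rat_of_int A"
  have Ac: "?A \<in> carrier_mat n n" using A by simp
  have "det ?A = of_int (det A)" by (simp add: of_int_hom.hom_det)
  then have "?A \<in> Units (ring_mat TYPE(rat) n ())"
    using det det_non_zero_imp_unit[OF Ac] by simp
  then obtain B where B: "mat_inverse ?A = Some B"
    using mat_inverse(1)[OF Ac] by fastforce
  have *: "?A * B = 1\<^sub>m n" "B * ?A = 1\<^sub>m n" "B \<in> carrier_mat n n"
    using mat_inverse(2)[OF Ac B] by auto
  have cancel: "M ^\<^sub>m l *\<^sub>v (N ^\<^sub>m l *\<^sub>v v) = v"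
    if "M \<in> carrier_mat n n" "N \<in> carrier_mat n n" "M * N = 1\<^sub>m n" "v \<in> carrier_vec n"
    for M N :: "rat mat" and l v
    using that(4)
  proof (induction l arbitrary: v)
    case 0
    then show ?case using that by simp
  next
    case (Suc l)
    have c: "N ^\<^sub>m l *\<^sub>v w \<in> carrier_vec n" if "w \<in> carrier_vec n" for w
      using that \<open>N \<in> carrier_mat n n\<close> by (meson mult_mat_vec_carrier pow_carrier_mat)
    have Nl: "N ^\<^sub>m Suc l = N * N ^\<^sub>m l" using pow_mat_add[OF that(2), of 1 l] that(2) by simp
    have "N ^\<^sub>m Suc l *\<^sub>v v = N *\<^sub>v (N ^\<^sub>m l *\<^sub>v v)"
      unfolding Nl using that(2) Suc.prems by (intro assoc_mult_mat_vec) auto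
    moreover have "M ^\<^sub>m Suc l *\<^sub>v w = M ^\<^sub>m l *\<^sub>v (M *\<^sub>v w)" if "w \<in> carrier_vec n" for w
      using that \<open>M \<in> carrier_mat n n\<close> by (simp add: assoc_mult_mat_vec[of _ n n _ n])
    moreover have "M *\<^sub>v (N *\<^sub>v w) = w" if "w \<in> carrier_vec n" for w
      using assoc_mult_mat_vec[OF \<open>M \<in> carrier_mat n n\<close> \<open>N \<in> carrier_mat n n\<close> that]
        \<open>M * N = 1\<^sub>m n\<close> that by simp
    ultimately show ?case
      using Suc.IH[OF Suc.prems] c[OF Suc.prems] that(2) by simp
  qed
  show ?thesis
    using cancel[OF Ac *(3) *(1)] cancel[OF *(3) Ac *(2)] *(3) B
    by (intro bexI[of _ B]) (simp_all add: qp_eq)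
qed

text \<open>Nonnegative powers of \<open>A\<close> keep integer vectors integral, and a negative
  power is undone by the opposite one. From here on membership involves nonnegative powers
  only.\<close>

lemma group_of_mat_iff:
  "v \<in> group_of_mat A \<longleftrightarrow> v \<in> carrier_vec n \<and> (\<exists>l. \<forall>i<n. (qp l *\<^sub>v v) $ i \<in> \<int>)"
proof -
  obtain B where B: "B \<in> carrier_mat n n" "mat_inverse (map_mat rat_of_int A) = Some B"
    "\<forall>l. \<forall>v\<in>carrier_vec n. qp l *\<^sub>v (B ^\<^sub>m l *\<^sub>v v) = v \<and> B ^\<^sub>m l *\<^sub>v (qp l *\<^sub>v v) = v"
    using inverse_exists by blast
  have Bc: "B ^\<^sub>m l *\<^sub>v w \<in> carrier_vec n" if "w \<in> carrier_vec n" for w l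
    using that B(1) by (meson mult_mat_vec_carrier pow_carrier_mat)
  show ?thesis
  proof
    assume "v \<in> group_of_mat A"
    then obtain x k where x: "x \<in> carrier_vec n"
      and v: "v = mat_zpow (map_mat rat_of_int A) k *\<^sub>v map_vec rat_of_int x"
      using A by (auto simp: group_of_mat_def)
    let ?x = "map_vec rat_of_int x"
    have xc: "?x \<in> carrier_vec n" and xi: "\<And>i. i < n \<Longrightarrow> ?x $ i \<in> \<int>" using x by auto
    show "v \<in> carrier_vec n \<and> (\<exists>l. \<forall>i<n. (qp l *\<^sub>v v) $ i \<in> \<int>)"
    proof (cases "k \<ge> 0")
      case True
      then have v': "v = qp (nat k) *\<^sub>v ?x" using v by (simp add: mat_zpow_def qp_eq)
      then have "v \<in> carrier_vec n" using qp_carrier[OF xc] by simp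
      then have "qp 0 *\<^sub>v v = v" by (rule qp_0)
      then have "\<forall>i<n. (qp 0 *\<^sub>v v) $ i \<in> \<int>"
        using v' Ints_mult_vec[OF pow_A xc xi] by simp
      then show ?thesis using \<open>v \<in> carrier_vec n\<close> by blast
    next
      case False
      then have v': "v = B ^\<^sub>m nat (- k) *\<^sub>v ?x" using v B(2) by (simp add: mat_zpow_def)
      then have "qp (nat (- k)) *\<^sub>v v = ?x" using B(3) xc by simp
      then show ?thesis using Bc[OF xc] v' xi by metis
    qed
  next
    assume "v \<in> carrier_vec n \<and> (\<exists>l. \<forall>i<n. (qp l *\<^sub>v v) $ i \<in> \<int>)"
    then obtain l where v: "v \<in> carrier_vec n" and l: "\<forall>i<n. (qp l *\<^sub>v v) $ i \<in> \<int>" by blast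
    define x where "x = vec n (\<lambda>i. \<lfloor>(qp l *\<^sub>v v) $ i\<rfloor>)"
    have "qp l *\<^sub>v v = map_vec rat_of_int x"
      using A l by (intro eq_vecI) (auto simp: x_def simp del: index_mult_mat_vec)
    then have "v = B ^\<^sub>m l *\<^sub>v map_vec rat_of_int x" using B(3) v by metis
    \<comment> \<open>\<open>l = 0\<close> is separate because there \<open>mat_zpow\<close> takes
      the branch without the inverse.\<close>
    moreover have "mat_zpow (map_mat rat_of_int A) (- int l) = B ^\<^sub>m l"
      using B(1,2) A by (cases "l = 0") (auto simp: mat_zpow_def)
    ultimately have "v = mat_zpow (map_mat rat_of_int A) (- int l) *\<^sub>v map_vec rat_of_int x" by simp
    moreover have "x \<in> carrier_vec (dim_row A)" using A by (simp add: x_def)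
    ultimately show "v \<in> group_of_mat A" unfolding group_of_mat_def by blast
  qed
qed

text \<open>For prime \<open>p\<close> this is the localization of G_A at \<open>p\<close>. One
  suitable exponent would do, as \<open>A\<close> is integral (\<open>loc_groupI\<close>); with
  \<open>eventually\<close>, finitely many vectors share an exponent at once.\<close>

definition loc_group :: "int \<Rightarrow> rat vec set" where
  "loc_group p = {v \<in> carrier_vec n. \<forall>\<^sub>F l in sequentially. \<forall>i<n. p_integral p ((qp l *\<^sub>v v) $ i)}"

lemma loc_groupI:
  assumes "prime p" "v \<in> carrier_vec n" "\<And>i. i < n \<Longrightarrow> p_integral p ((qp l *\<^sub>v v) $ i)"
  shows "v \<in> loc_group p"
proof -
  have "\<forall>i<n. p_integral p ((qp m *\<^sub>v v) $ i)" if "m \<ge> l" for m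
  proof -
    have "qp m *\<^sub>v v = qp (m - l) *\<^sub>v (qp l *\<^sub>v v)" using qp_add[OF assms(2), of "m - l" l] that by simp
    then show ?thesis using p_integral_qp[OF assms(1) qp_carrier[OF assms(2)] assms(3)] by simp
  qed
  then have "\<forall>\<^sub>F l in sequentially. \<forall>i<n. p_integral p ((qp l *\<^sub>v v) $ i)"
    by (rule eventually_sequentiallyI)
  then show ?thesis using assms(2) by (simp add: loc_group_def)
qed

lemma loc_group_carrier: "v \<in> loc_group p \<Longrightarrow> v \<in> carrier_vec n" by (simp add: loc_group_def)

lemma loc_group_p_integral:
  assumes "prime p" "v \<in> carrier_vec n" "\<And>i. i < n \<Longrightarrow> p_integral p (v $ i)"
  shows "v \<in> loc_group p"
  by (rule loc_groupI[where l = 0, OF assms(1,2)]) (use assms qp_0 in simp)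

lemma group_of_mat_loc_group:
  assumes "prime p" "v \<in> group_of_mat A"
  shows "v \<in> loc_group p"
proof -
  obtain l where "v \<in> carrier_vec n" "\<forall>i<n. (qp l *\<^sub>v v) $ i \<in> \<int>"
    using assms(2) group_of_mat_iff by blast
  then show ?thesis using p_integral_Ints[OF assms(1)] loc_groupI[OF assms(1)] by blast
qed

lemma loc_group_add:
  assumes "prime p" "v \<in> loc_group p" "w \<in> loc_group p"
  shows "v + w \<in> loc_group p"
proof -
  have c: "v \<in> carrier_vec n" "w \<in> carrier_vec n" using assms loc_group_carrier by auto
  have ev: "\<forall>\<^sub>F l in sequentially. \<forall>i<n. p_integral p ((qp l *\<^sub>v v) $ i)"
    "\<forall>\<^sub>F l in sequentially. \<forall>i<n. p_integral p ((qp l *\<^sub>v w) $ i)"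
    using assms(2,3) by (simp_all add: loc_group_def)
  have "\<forall>\<^sub>F l in sequentially. \<forall>i<n. p_integral p ((qp l *\<^sub>v (v + w)) $ i)"
    using ev
  proof eventually_elim
    case (elim l)
    have "qp l *\<^sub>v (v + w) = qp l *\<^sub>v v + qp l *\<^sub>v w" using c by (intro mult_add_distrib_mat_vec[OF qp])
    then show ?case using elim A p_integral_add[OF assms(1)]
      by (auto simp del: index_mult_mat_vec)
  qed
  then show ?thesis using c by (simp add: loc_group_def)
qed

lemma loc_group_smult:
  assumes "prime p" "v \<in> loc_group p" "p_integral p c"
  shows "c \<cdot>\<^sub>v v \<in> loc_group p"
proof -
  have v: "v \<in> carrier_vec n" using assms loc_group_carrier by auto
  have ev: "\<forall>\<^sub>F l in sequentially. \<forall>i<n. p_integral p ((qp l *\<^sub>v v) $ i)"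
    using assms(2) by (simp add: loc_group_def)
  have "\<forall>\<^sub>F l in sequentially. \<forall>i<n. p_integral p ((qp l *\<^sub>v (c \<cdot>\<^sub>v v)) $ i)"
    using ev
  proof eventually_elim
    case (elim l)
    have "qp l *\<^sub>v (c \<cdot>\<^sub>v v) = c \<cdot>\<^sub>v (qp l *\<^sub>v v)" using v by (intro mult_mat_vec[OF qp])
    then show ?case using elim A p_integral_mult[OF assms(1,3)]
      by (auto simp del: index_mult_mat_vec)
  qed
  then show ?thesis using v by (simp add: loc_group_def)
qed

lemma loc_group_minus:
  assumes "prime p" "v \<in> loc_group p" "w \<in> loc_group p"
  shows "v - w \<in> loc_group p"
proof -
  have "(- 1) \<cdot>\<^sub>v w \<in> loc_group p"
    using loc_group_smult[OF assms(1,3), of "- 1"] p_integral_of_int[OF assms(1), of "- 1"] by simp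
  then have "v + (- 1) \<cdot>\<^sub>v w \<in> loc_group p" by (rule loc_group_add[OF assms(1,2)])
  also have "v + (- 1) \<cdot>\<^sub>v w = v - w"
    using assms(2,3)[THEN loc_group_carrier] by (intro eq_vecI) auto
  finally show ?thesis .
qed

text \<open>A common exponent \<open>l\<close> for all columns makes A^l M a p-integral matrix. Thus
  combinations of elements with p-integral coefficients stay in the localization.\<close>

lemma loc_group_mult_vec:
  assumes "prime p" "M \<in> carrier_mat n n" "\<And>j. j < n \<Longrightarrow> M *\<^sub>v unit_vec n j \<in> loc_group p"
    "y \<in> carrier_vec n" "\<And>j. j < n \<Longrightarrow> p_integral p (y $ j)"
  shows "M *\<^sub>v y \<in> loc_group p"
proof -
  have "\<forall>\<^sub>F l in sequentially. \<forall>j\<in>{..<n}. \<forall>i<n. p_integral p ((qp l *\<^sub>v (M *\<^sub>v unit_vec n j)) $ i)"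
    using assms(3) by (intro eventually_ball_finite) (auto simp: loc_group_def)
  then obtain l where l: "\<forall>j\<in>{..<n}. \<forall>i<n. p_integral p ((qp l *\<^sub>v (M *\<^sub>v unit_vec n j)) $ i)"
    using eventually_happens' sequentially_bot by blast
  have qM: "qp l * M \<in> carrier_mat n n" using qp[of l] assms(2) by (rule mult_carrier_mat)
  have entry: "(qp l * M) $$ (i, j) = (qp l *\<^sub>v (M *\<^sub>v unit_vec n j)) $ i" if "i < n" "j < n" for i j
  proof -
    have "qp l *\<^sub>v (M *\<^sub>v unit_vec n j) = (qp l * M) *\<^sub>v unit_vec n j"
      using assoc_mult_mat_vec[OF qp assms(2)] by simp
    then show ?thesis using mult_unit_vec_index[OF qM that] by simp
  qed
  show ?thesis
  proof (rule loc_groupI[where l = l, OF assms(1)])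
    show "M *\<^sub>v y \<in> carrier_vec n" using assms(2,4) by simp
    fix i assume i: "i < n"
    have "qp l *\<^sub>v (M *\<^sub>v y) = (qp l * M) *\<^sub>v y" using assoc_mult_mat_vec[OF qp assms(2,4)] by simp
    moreover have "p_integral p (((qp l * M) *\<^sub>v y) $ i)"
      using l entry by (intro p_integral_mult_vec[OF assms(1) qM _ assms(4,5) i]) auto
    ultimately show "p_integral p ((qp l *\<^sub>v (M *\<^sub>v y)) $ i)" by simp
  qed
qed

lemma vec_common_denominator:
  fixes v :: "rat vec"
  assumes "v \<in> carrier_vec n"
  shows "\<exists>d::int. d > 0 \<and> (\<forall>i<n. of_int d * v $ i \<in> \<int>)"
proof -
  obtain d :: int where d: "d > 0" "\<forall>r\<in>(\<lambda>i. v $ i) ` {..<n}. \<exists>z. r = of_int z / of_int d"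
    using common_denominator[of "(\<lambda>i. v $ i) ` {..<n}"] by blast
  have "of_int d * v $ i \<in> \<int>" if "i < n" for i
  proof -
    obtain z where "v $ i = of_int z / of_int d" using d(2) \<open>i < n\<close> by blast
    then show ?thesis using d(1) by simp
  qed
  then show ?thesis using d(1) by blast
qed

text \<open>Only the finitely many primes dividing a common denominator of \<open>v\<close> impose a
  condition; they share an exponent \<open>l\<close>, for which A^l v is integral at every
  prime.\<close>

lemma group_of_mat_local:
  assumes "v \<in> carrier_vec n" "\<And>p. prime p \<Longrightarrow> v \<in> loc_group p"
  shows "v \<in> group_of_mat A"
proof -
  obtain d where d: "d > 0" "\<forall>i<n. of_int d * v $ i \<in> \<int>"
    using vec_common_denominator[OF assms(1)] by blast
  define S where "S = {p. prime p \<and> p dvd d}"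
  have "S \<subseteq> {0..d}"
    using d(1) zdvd_imp_le by (auto simp: S_def dest: prime_ge_0_int)
  then have "finite S" by (rule finite_subset) simp
  have "\<forall>\<^sub>F l in sequentially. \<forall>p\<in>S. \<forall>i<n. p_integral p ((qp l *\<^sub>v v) $ i)"
    using assms(2) \<open>finite S\<close> by (intro eventually_ball_finite) (auto simp: S_def loc_group_def)
  then obtain l where l: "\<forall>p\<in>S. \<forall>i<n. p_integral p ((qp l *\<^sub>v v) $ i)"
    using eventually_happens' sequentially_bot by blast
  have "(qp l *\<^sub>v v) $ i \<in> \<int>" if i: "i < n" for i
  proof (rule Ints_if_p_integral)
    fix p :: int assume p: "prime p"
    show "p_integral p ((qp l *\<^sub>v v) $ i)"
    proof (cases "p dvd d")
      case True
      then show ?thesis using l p i by (auto simp: S_def)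
    next
      case False
      then have "p_integral p (v $ i)" if "i < n" for i using p_integral_divide[of p d] d(2) that by blast
      then show ?thesis by (rule p_integral_qp[OF p assms(1) _ i])
    qed
  qed
  then show ?thesis using assms(1) group_of_mat_iff by blast
qed

text \<open>The adjugate of A^l is an integer matrix inverting A^l up to the factor (det A)^l;
  applied to the integer vector A^l v, it shows that this factor clears the denominators of
  \<open>v\<close>.\<close>

lemma group_of_mat_denominator:
  assumes "v \<in> group_of_mat A"
  shows "\<exists>k. \<forall>i<n. of_int (det A) ^ k * v $ i \<in> \<int>"
proof -
  obtain l where v: "v \<in> carrier_vec n" and l: "\<forall>i<n. (qp l *\<^sub>v v) $ i \<in> \<int>"
    using assms group_of_mat_iff by blast
  let ?M = "adj_mat (A ^\<^sub>m l)"
  have M: "?M \<in> carrier_mat n n" "?M * A ^\<^sub>m l = det (A ^\<^sub>m l) \<cdot>\<^sub>m 1\<^sub>m n"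
    using adj_mat[OF pow_A[of l]] by auto
  have dp: "det (A ^\<^sub>m l) = det A ^ l"
  proof (induction l)
    case (Suc l)
    then show ?case using det_mult[OF pow_A[of l] A] by (simp add: mult.commute)
  qed (use A in simp)
  have MQ: "map_mat rat_of_int ?M \<in> carrier_mat n n" using M(1) by simp
  have "map_mat rat_of_int ?M *\<^sub>v (qp l *\<^sub>v v) = map_mat rat_of_int (?M * A ^\<^sub>m l) *\<^sub>v v"
    unfolding of_int_hom.mat_hom_mult[OF M(1) pow_A] using assoc_mult_mat_vec[OF MQ qp v] by simp
  also have "map_mat rat_of_int (?M * A ^\<^sub>m l) = of_int (det A ^ l) \<cdot>\<^sub>m 1\<^sub>m n"
    unfolding M(2) dp by (intro eq_matI) auto
  also have "\<dots> *\<^sub>v v = of_int (det A ^ l) \<cdot>\<^sub>v v" using v by (simp add: smult_mat_mult_vec[of _ n n])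
  finally have eq: "map_mat rat_of_int ?M *\<^sub>v (qp l *\<^sub>v v) = of_int (det A ^ l) \<cdot>\<^sub>v v" .
  have "of_int (det A) ^ l * v $ i \<in> \<int>" if i: "i < n" for i
  proof -
    have "(map_mat rat_of_int ?M *\<^sub>v (qp l *\<^sub>v v)) $ i \<in> \<int>"
      using l by (intro Ints_mult_vec[OF M(1) qp_carrier[OF v] _ i]) auto
    then show ?thesis unfolding eq using i v by simp
  qed
  then show ?thesis by blast
qed

end

section \<open>The characteristic\<close>

context nonsingular_int_mat
begin

abbreviation tp :: "int \<Rightarrow> nat" where "tp \<equiv> zero_mult A"

text \<open>The truncation of \<open>char_vec\<close> at level \<open>k \<ge> 1\<close>. At level 0
  the two differ in coordinate \<open>i\<close>, since 1 has residue 0 modulo \<open>p ^ 0\<close>;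
  \<open>p_inf\<close> starts at level 1.\<close>

definition char_trunc :: "(int \<Rightarrow> nat \<Rightarrow> nat \<Rightarrow> (nat \<Rightarrow> int)) \<Rightarrow> int \<Rightarrow> nat \<Rightarrow> nat \<Rightarrow> rat vec" where
  "char_trunc \<alpha> p i k = vec n (\<lambda>j. if j = i then 1 else if j < tp p then 0 else of_int (\<alpha> p i j k))"

lemma primes_of_mat'D: "p \<in> primes_of_mat' A \<Longrightarrow> prime p \<and> p \<in> primes_of_mat A"
  by (simp add: primes_of_mat'_def primes_of_mat_def)

lemma padic_trunc_one:
  assumes "p > 1" "k \<ge> 1"
  shows "padic_trunc p k \<one>\<^bsub>padic_int p\<^esub> = 1"
proof -
  have "\<one>\<^bsub>padic_int p\<^esub> = padic_of_int p 1" by (simp add: padic_int_def padic_of_int_def)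
  then have "padic_trunc p k \<one>\<^bsub>padic_int p\<^esub> = 1 mod p ^ k"
    using padic_trunc_eq[of "padic_of_int p 1" p k] padic_of_int_closed[of p 1] assms(1)
    by (simp add: padic_of_int_def)
  moreover have "p ^ k > 1" using assms by simp
  ultimately show ?thesis by simp
qed

lemma padic_trunc_zero: "padic_trunc p k \<zero>\<^bsub>padic_int p\<^esub> = 0"
  by (simp add: padic_trunc_def padic_digit_def padic_int_def)

lemma p_inf_unit:
  assumes "q > 1"
  shows "p_inf q (padic_unit_vec q n j) = {(1 / of_int q ^ k) \<cdot>\<^sub>v unit_vec n j | k. k \<ge> 1}"
proof -
  have "map_vec (\<lambda>a. rat_of_int (padic_trunc q k a)) (padic_unit_vec q n j) = unit_vec n j"
    if "k \<ge> 1" for k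
    using that assms padic_trunc_one padic_trunc_zero
    by (intro eq_vecI) (auto simp: padic_unit_vec_def unit_vec_def)
  then show ?thesis unfolding p_inf_def by (intro Collect_cong ex_cong1) auto
qed

lemma p_inf_char_vec:
  assumes "p > 1" "\<And>j. tp p \<le> j \<Longrightarrow> j < n \<Longrightarrow> \<alpha> p i j \<in> carrier (padic_int p)" "i < tp p"
  shows "p_inf p (char_vec \<alpha> n (tp p) p i) = {(1 / of_int p ^ k) \<cdot>\<^sub>v char_trunc \<alpha> p i k | k. k \<ge> 1}"
proof -
  have "map_vec (\<lambda>a. rat_of_int (padic_trunc p k a)) (char_vec \<alpha> n (tp p) p i) = char_trunc \<alpha> p i k"
    if "k \<ge> 1" for k
    using that assms padic_trunc_one[OF assms(1)] padic_trunc_zero padic_trunc_eq[of _ p k]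
    by (intro eq_vecI) (auto simp: char_vec_def char_trunc_def)
  then show ?thesis unfolding p_inf_def by (intro Collect_cong ex_cong1) auto
qed

lemma unit_vec_in_group: "j < n \<Longrightarrow> unit_vec n j \<in> group_of_mat A"
proof -
  have "(qp 0 *\<^sub>v unit_vec n j) $ i \<in> \<int>" if "i < n" for i
    unfolding qp_0[OF unit_vec_carrier] using that by (simp add: unit_vec_def)
  then show ?thesis using group_of_mat_iff unit_vec_carrier by blast
qed

context
  fixes \<alpha> assumes char: "is_characteristic A \<alpha>"
begin

lemma alpha_closed:
  "p \<in> primes_of_mat' A \<Longrightarrow> i < tp p \<Longrightarrow> tp p \<le> j \<Longrightarrow> j < n \<Longrightarrow> \<alpha> p i j \<in> carrier (padic_int p)"
  using char A by (simp add: is_characteristic_def Let_def)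

definition gens :: "rat vec set" where
  "gens = unit_vec n ` {..<n}
        \<union> (\<Union>q\<in>primes_of_mat A - primes_of_mat' A. \<Union>j<n. p_inf q (padic_unit_vec q n j))
        \<union> (\<Union>p\<in>primes_of_mat' A. \<Union>i<tp p. p_inf p (char_vec \<alpha> n (tp p) p i))"

lemma group_generate: "group_of_mat A = generate (monoid_vec TYPE(rat) n) gens"
  using char A by (simp add: is_characteristic_def Let_def gens_def)

lemma gens_subset: "gens \<subseteq> group_of_mat A"
  unfolding group_generate by (auto intro: generate.incl)

lemma char_trunc_in_group:
  assumes "p \<in> primes_of_mat' A" "i < tp p" "k \<ge> 1"
  shows "(1 / of_int p ^ k) \<cdot>\<^sub>v char_trunc \<alpha> p i k \<in> group_of_mat A"
proof -
  have "p > 1" using primes_of_mat'D[OF assms(1)] prime_gt_1_int by blast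
  then have "(1 / of_int p ^ k) \<cdot>\<^sub>v char_trunc \<alpha> p i k \<in> p_inf p (char_vec \<alpha> n (tp p) p i)"
    using p_inf_char_vec[of p \<alpha> i] alpha_closed[OF assms(1,2)] assms(2,3) by blast
  then have "(1 / of_int p ^ k) \<cdot>\<^sub>v char_trunc \<alpha> p i k \<in> gens" using assms(1,2) unfolding gens_def by blast
  then show ?thesis using gens_subset by blast
qed

lemma unit_div_in_group:
  assumes "q \<in> primes_of_mat A - primes_of_mat' A" "j < n" "k \<ge> 1"
  shows "(1 / of_int q ^ k) \<cdot>\<^sub>v unit_vec n j \<in> group_of_mat A"
proof -
  have "q > 1" using assms(1) prime_gt_1_int by (auto simp: primes_of_mat_def)
  then have "(1 / of_int q ^ k) \<cdot>\<^sub>v unit_vec n j \<in> p_inf q (padic_unit_vec q n j)"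
    using p_inf_unit[of q j] assms(3) by blast
  then have "(1 / of_int q ^ k) \<cdot>\<^sub>v unit_vec n j \<in> gens" using assms(1,2) unfolding gens_def by blast
  then show ?thesis using gens_subset by blast
qed

lemma gens_carrier: "gens \<subseteq> carrier_vec n"
  using gens_subset group_of_mat_iff by blast

text \<open>
  Expressed through the truncations of the \<open>\<alpha>\<^sub>p\<^sub>i\<^sub>k\<close>, this says that the linear form
  \<open>v\<^sub>k - \<Sum>\<^sub>i v\<^sub>i \<alpha>\<^sub>p\<^sub>i\<^sub>k\<close> takes a \<open>p\<close>-adic integer value at \<open>v\<close>.
\<close>

definition form_integral :: "int \<Rightarrow> nat \<Rightarrow> rat vec \<Rightarrow> bool" where
  "form_integral p k v \<longleftrightarrow>
    (\<forall>\<^sub>F M in sequentially. p_integral p (v $ k - (\<Sum>i<tp p. v $ i * of_int (\<alpha> p i k M))))"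

lemma form_integral_p_integral:
  assumes "prime p" "tp p \<le> k" "k < n" "\<And>i. i < n \<Longrightarrow> p_integral p (v $ i)"
  shows "form_integral p k v"
proof -
  have "p_integral p (v $ k - (\<Sum>i<tp p. v $ i * of_int (\<alpha> p i k M)))" for M
    using assms
    by (intro p_integral_diff p_integral_sum p_integral_mult p_integral_of_int) auto
  then show ?thesis by (simp add: form_integral_def)
qed

text \<open>Generators attached to other primes have p-integral coordinates. For p^(-m) times the
  truncation at level m of the vector with index i, the form taken at level M equals
  (\<open>\<alpha> p i k m\<close> - \<open>\<alpha> p i k M\<close>) / p^m, and for M \<ge> m the
  two residues agree modulo p^m.\<close>

lemma form_integral_gens:
  assumes p: "p \<in> primes_of_mat' A" and k: "tp p \<le> k" "k < n" and v: "v \<in> gens"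
  shows "form_integral p k v"
proof -
  have pp: "prime p" using primes_of_mat'D[OF p] by simp
  have p1: "p > 1" using pp by (rule prime_gt_1_int)
  have other: "form_integral p k v"
    if q: "prime q" "q \<noteq> p" "v = (1 / of_int q ^ m) \<cdot>\<^sub>v w" "w \<in> carrier_vec n"
      "\<And>i. i < n \<Longrightarrow> w $ i \<in> \<int>" for q m w
  proof (rule form_integral_p_integral[OF pp k])
    fix i assume i: "i < n"
    have "\<not> p dvd q" using primes_dvd_imp_eq[OF pp q(1)] q(2) by blast
    then have "\<not> p dvd q ^ m" using pp by (meson prime_dvd_power)
    moreover have "of_int (q ^ m) * v $ i = w $ i"
      using q(1,3,4) i prime_gt_1_int[OF q(1)] by simp
    ultimately show "p_integral p (v $ i)" using p_integral_divide[of p "q ^ m"] q(5)[OF i] by simp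
  qed
  from v consider (unit) j where "j < n" "v = unit_vec n j"
    | (div) q j m where "q \<in> primes_of_mat A - primes_of_mat' A" "j < n" "m \<ge> 1"
        "v = (1 / of_int q ^ m) \<cdot>\<^sub>v unit_vec n j"
    | (char) q i m where "q \<in> primes_of_mat' A" "i < tp q" "m \<ge> 1"
        "v = (1 / of_int q ^ m) \<cdot>\<^sub>v char_trunc \<alpha> q i m"
  proof -
    have q1: "q > 1" if "q \<in> primes_of_mat A" for q
      using that prime_gt_1_int by (auto simp: primes_of_mat_def)
    have "v \<in> unit_vec n ` {..<n} \<or>
        (\<exists>q\<in>primes_of_mat A - primes_of_mat' A. \<exists>j<n. v \<in> p_inf q (padic_unit_vec q n j)) \<or>
        (\<exists>q\<in>primes_of_mat' A. \<exists>i<tp q. v \<in> p_inf q (char_vec \<alpha> n (tp q) q i))"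
      using v unfolding gens_def by blast
    then show ?thesis
    proof (elim disjE bexE exE conjE)
      assume "v \<in> unit_vec n ` {..<n}"
      then show ?thesis using unit by blast
    next
      fix q j assume *: "q \<in> primes_of_mat A - primes_of_mat' A" "j < n"
        "v \<in> p_inf q (padic_unit_vec q n j)"
      then show ?thesis using div p_inf_unit[OF q1, of q j] by blast
    next
      fix q i assume *: "q \<in> primes_of_mat' A" "i < tp q" "v \<in> p_inf q (char_vec \<alpha> n (tp q) q i)"
      have "q > 1" using *(1) primes_of_mat'D q1 by blast
      from p_inf_char_vec[of q \<alpha> i, OF this alpha_closed[OF *(1,2)] *(2)] show ?thesis
        using *(1-3) char by blast
    qed
  qed
  then show ?thesis
  proof cases
    case unit
    then show ?thesis
      by (intro form_integral_p_integral[OF pp k] p_integral_Ints[OF pp]) (auto simp: unit_vec_def)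
  next
    case div
    then show ?thesis
      using p by (intro other[OF _ _ div(4)]) (auto simp: primes_of_mat_def unit_vec_def)
  next
    case char
    show ?thesis
    proof (cases "q = p")
      case False
      then show ?thesis
        using char primes_of_mat'D by (intro other[OF _ _ char(4)]) (auto simp: char_trunc_def)
    next
      case True
      have i: "i < tp p" "i < n" using char True k by auto
      have closed: "\<alpha> p i k \<in> carrier (padic_int p)" using alpha_closed[OF p i(1) k] .
      have "p_integral p (v $ k - (\<Sum>j<tp p. v $ j * of_int (\<alpha> p j k M)))" if "M \<ge> m" for M
      proof -
        have "(\<Sum>j<tp p. v $ j * of_int (\<alpha> p j k M)) =
            (\<Sum>j<tp p. if j = i then of_int (\<alpha> p i k M) / of_int p ^ m else 0)"
          using True char(4) k by (intro sum.cong) (auto simp: char_trunc_def)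
        also have "\<dots> = of_int (\<alpha> p i k M) / of_int p ^ m" using i by simp
        finally have "v $ k - (\<Sum>j<tp p. v $ j * of_int (\<alpha> p j k M)) =
            of_int (\<alpha> p i k m - \<alpha> p i k M) / of_int (p ^ m)"
          using True char(4) k i by (simp add: char_trunc_def diff_divide_distrib)
        moreover have "p ^ m dvd \<alpha> p i k m - \<alpha> p i k M"
          using padic_int_mod[OF closed that] padic_int_self_mod[OF closed, of m]
          by (metis mod_eq_dvd_iff)
        then obtain z where "\<alpha> p i k m - \<alpha> p i k M = p ^ m * z" by auto
        ultimately have "v $ k - (\<Sum>j<tp p. v $ j * of_int (\<alpha> p j k M)) = of_int z"
          using p1 by simp
        then show ?thesis using p_integral_of_int[OF pp] by simp
      qed
      then show ?thesis unfolding form_integral_def by (rule eventually_sequentiallyI)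
    qed
  qed
qed

lemma form_integral_add:
  assumes "prime p" "form_integral p k v" "form_integral p k w" "v \<in> carrier_vec n" "w \<in> carrier_vec n"
    "tp p \<le> k" "k < n"
  shows "form_integral p k (v + w)"
  unfolding form_integral_def using assms(2,3)[unfolded form_integral_def]
proof eventually_elim
  case (elim M)
  have "(\<Sum>i<tp p. (v + w) $ i * of_int (\<alpha> p i k M)) =
      (\<Sum>i<tp p. v $ i * of_int (\<alpha> p i k M)) + (\<Sum>i<tp p. w $ i * of_int (\<alpha> p i k M))"
    unfolding sum.distrib[symmetric] using assms(4-7) by (intro sum.cong) (auto simp: distrib_right)
  then show ?case using p_integral_add[OF assms(1) elim] assms(4-7) by (simp add: algebra_simps)
qed

lemma form_integral_uminus:
  assumes "prime p" "form_integral p k v" "v \<in> carrier_vec n" "tp p \<le> k" "k < n"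
  shows "form_integral p k (- v)"
  unfolding form_integral_def using assms(2)[unfolded form_integral_def]
proof eventually_elim
  case (elim M)
  have "(\<Sum>i<tp p. (- v) $ i * of_int (\<alpha> p i k M)) = - (\<Sum>i<tp p. v $ i * of_int (\<alpha> p i k M))"
    unfolding sum_negf[symmetric] using assms(3-5) by (intro sum.cong) auto
  then show ?case using p_integral_uminus[OF assms(1) elim] assms(3-5) by simp
qed

text \<open>Integrality of the form defines a subgroup of the rational vectors that contains all
  generators; \<open>form_integral_loc_group\<close> supplies the converse at
  \<open>p\<close>.\<close>

lemma form_integral_group:
  assumes p: "p \<in> primes_of_mat' A" and k: "tp p \<le> k" "k < n" and v: "v \<in> group_of_mat A"
  shows "form_integral p k v"
proof -
  let ?G = "monoid_vec TYPE(rat) n"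
  have pp: "prime p" using primes_of_mat'D[OF p] by simp
  interpret G: comm_group ?G by (rule comm_group_vec)
  define H where "H = {v \<in> carrier_vec n. form_integral p k v}"
  have inv: "inv\<^bsub>?G\<^esub> a = - a" if "a \<in> carrier_vec n" for a
    using that by (intro G.inv_equality) (auto simp: monoid_vec_simps)
  have "subgroup H ?G"
  proof (rule G.subgroupI)
    show "H \<subseteq> carrier ?G" by (auto simp: H_def monoid_vec_simps)
    have "0\<^sub>v n \<in> H"
      unfolding H_def using form_integral_p_integral[OF pp k, of "0\<^sub>v n"] p_integral_of_int[OF pp, of 0]
      by auto
    then show "H \<noteq> {}" by blast
    show "inv\<^bsub>?G\<^esub> a \<in> H" if "a \<in> H" for a
      using that inv[of a] form_integral_uminus[OF pp _ _ k] by (auto simp: H_def)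
    show "a \<otimes>\<^bsub>?G\<^esub> b \<in> H" if "a \<in> H" "b \<in> H" for a b
      using that form_integral_add[OF pp _ _ _ _ k] by (auto simp: H_def monoid_vec_simps)
  qed
  moreover have "gens \<subseteq> H" using form_integral_gens[OF p k] gens_carrier by (auto simp: H_def)
  ultimately have "generate ?G gens \<subseteq> H" using G.generate_subgroup_incl by blast
  then show ?thesis using v unfolding group_generate H_def by blast
qed

text \<open>Subtract from \<open>w\<close> the combination of the generators for i <
  \<open>tp p\<close> truncated at level M, with coefficients p^M w_i. This clears the coordinates
  below \<open>tp p\<close> and leaves in each later coordinate the value of the form. For large M
  both the coefficients and these values are p-integral.\<close>

lemma form_integral_loc_group:
  assumes p: "p \<in> primes_of_mat' A" and t: "tp p < n" and w: "w \<in> carrier_vec n"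
    and int: "\<And>k. tp p \<le> k \<Longrightarrow> k < n \<Longrightarrow> form_integral p k w"
  shows "w \<in> loc_group p"
proof -
  have pp: "prime p" using primes_of_mat'D[OF p] by simp
  have p1: "p > 1" using pp by (rule prime_gt_1_int)
  have "\<forall>\<^sub>F M in sequentially. \<forall>k\<in>{tp p..<n}.
      p_integral p (w $ k - (\<Sum>i<tp p. w $ i * of_int (\<alpha> p i k M)))"
    using int by (intro eventually_ball_finite) (auto simp: form_integral_def)
  moreover have "\<forall>\<^sub>F M in sequentially. \<forall>i\<in>{..<n}. p_integral p (of_int p ^ M * w $ i)"
    using pp by (intro eventually_ball_finite ballI eventually_p_integral) auto
  moreover have "\<forall>\<^sub>F M in sequentially. M \<ge> (1::nat)" by (rule eventually_ge_at_top)
  ultimately have "\<forall>\<^sub>F M in sequentially. (\<forall>k\<in>{tp p..<n}.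
      p_integral p (w $ k - (\<Sum>i<tp p. w $ i * of_int (\<alpha> p i k M)))) \<and>
      (\<forall>i\<in>{..<n}. p_integral p (of_int p ^ M * w $ i)) \<and> M \<ge> 1"
    by (intro eventually_conj)
  then obtain M where M: "\<forall>k\<in>{tp p..<n}. p_integral p (w $ k - (\<Sum>i<tp p. w $ i * of_int (\<alpha> p i k M)))"
      "\<forall>i\<in>{..<n}. p_integral p (of_int p ^ M * w $ i)" "M \<ge> 1"
    using eventually_happens' sequentially_bot by blast
  \<comment> \<open>The columns of \<open>C\<close> are the generators at level \<open>M\<close>,
    with zero columns from \<open>tp p\<close> on, and \<open>u\<close> holds the coefficients, so
    \<open>C\<close> times \<open>u\<close> is the vector to be subtracted.\<close>
  define C where "C = mat n n (\<lambda>(k, i). if i < tp p then char_trunc \<alpha> p i M $ k / of_int p ^ M else 0)"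
  define u where "u = vec n (\<lambda>i. of_int p ^ M * w $ i)"
  have C: "C \<in> carrier_mat n n" by (simp add: C_def)
  have u: "u \<in> carrier_vec n" by (simp add: u_def)
  have "C *\<^sub>v unit_vec n i \<in> loc_group p" if i: "i < n" for i
  proof (cases "i < tp p")
    case True
    have "C *\<^sub>v unit_vec n i = (1 / of_int p ^ M) \<cdot>\<^sub>v char_trunc \<alpha> p i M"
      using i True by (intro eq_vecI) (auto simp: C_def char_trunc_def)
    then show ?thesis
      using group_of_mat_loc_group[OF pp char_trunc_in_group[OF p True M(3)]] by simp
  next
    case False
    have "C *\<^sub>v unit_vec n i = 0\<^sub>v n"
      using i False C by (intro eq_vecI) (auto simp: C_def)
    then show ?thesis
      using loc_group_p_integral[OF pp, of "0\<^sub>v n"] p_integral_of_int[OF pp, of 0] by simp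
  qed
  then have Cu: "C *\<^sub>v u \<in> loc_group p"
    using M(2) by (intro loc_group_mult_vec[OF pp C _ u]) (auto simp: u_def)
  have Cuk: "(C *\<^sub>v u) $ k = (\<Sum>i<tp p. char_trunc \<alpha> p i M $ k * w $ i)" if k: "k < n" for k
  proof -
    have "(C *\<^sub>v u) $ k = (\<Sum>i<n. if i < tp p then char_trunc \<alpha> p i M $ k * w $ i else 0)"
      using k p1 by (auto simp: C_def u_def scalar_prod_def atLeast0LessThan intro!: sum.cong)
    also have "\<dots> = (\<Sum>i\<in>{..<n} \<inter> {i. i < tp p}. char_trunc \<alpha> p i M $ k * w $ i)"
      by (simp add: sum.inter_restrict)
    also have "{..<n} \<inter> {i. i < tp p} = {..<tp p}" using t by auto
    finally show ?thesis .
  qed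
  have "w - C *\<^sub>v u \<in> loc_group p"
  proof (rule loc_group_p_integral[OF pp])
    show "w - C *\<^sub>v u \<in> carrier_vec n" using w C u by simp
    fix k assume k: "k < n"
    have wk: "(w - C *\<^sub>v u) $ k = w $ k - (\<Sum>i<tp p. char_trunc \<alpha> p i M $ k * w $ i)"
      using k C Cuk[OF k] by (simp del: index_mult_mat_vec)
    show "p_integral p ((w - C *\<^sub>v u) $ k)"
    proof (cases "k < tp p")
      case True
      have "(\<Sum>i<tp p. char_trunc \<alpha> p i M $ k * w $ i) = (\<Sum>i<tp p. if i = k then w $ k else 0)"
        using True k by (intro sum.cong) (auto simp: char_trunc_def)
      then show ?thesis using wk True p_integral_of_int[OF pp, of 0] by simp
    next
      case False
      have "(\<Sum>i<tp p. char_trunc \<alpha> p i M $ k * w $ i) = (\<Sum>i<tp p. w $ i * of_int (\<alpha> p i k M))"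
        using False k by (intro sum.cong) (auto simp: char_trunc_def)
      then show ?thesis using wk M(1) False k by simp
    qed
  qed
  then have "(w - C *\<^sub>v u) + C *\<^sub>v u \<in> loc_group p" using Cu by (rule loc_group_add[OF pp])
  also have "(w - C *\<^sub>v u) + C *\<^sub>v u = w" using w C u by (intro eq_vecI) auto
  finally show ?thesis .
qed

text \<open>G_A contains the vectors e_j / q^M for all M \<ge> 1, so at \<open>q\<close> every
  denominator is allowed.\<close>

lemma loc_group_top:
  assumes q: "q \<in> primes_of_mat A - primes_of_mat' A" and v: "v \<in> carrier_vec n"
  shows "v \<in> loc_group q"
proof -
  have qq: "prime q" using q by (simp add: primes_of_mat_def)
  have q1: "q > 1" using qq by (rule prime_gt_1_int)
  have "\<forall>\<^sub>F M in sequentially. \<forall>i\<in>{..<n}. p_integral q (of_int q ^ M * v $ i)"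
    using qq by (intro eventually_ball_finite ballI eventually_p_integral) auto
  moreover have "\<forall>\<^sub>F M in sequentially. M \<ge> (1::nat)" by (rule eventually_ge_at_top)
  ultimately have "\<forall>\<^sub>F M in sequentially. (\<forall>i\<in>{..<n}. p_integral q (of_int q ^ M * v $ i)) \<and> M \<ge> 1"
    by (rule eventually_conj)
  then obtain M where M: "\<forall>i\<in>{..<n}. p_integral q (of_int q ^ M * v $ i)" "M \<ge> 1"
    using eventually_happens' sequentially_bot by blast
  let ?C = "(1 / of_int q ^ M) \<cdot>\<^sub>m 1\<^sub>m n :: rat mat" and ?u = "of_int q ^ M \<cdot>\<^sub>v v"
  have C: "?C \<in> carrier_mat n n" and u: "?u \<in> carrier_vec n" using v by auto
  have Cv: "?C *\<^sub>v w = (1 / of_int q ^ M) \<cdot>\<^sub>v w" if "w \<in> carrier_vec n" for w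
    using smult_mat_mult_vec[OF one_carrier_mat that] that by simp
  have cols: "?C *\<^sub>v unit_vec n j \<in> loc_group q" if "j < n" for j
    using group_of_mat_loc_group[OF qq unit_div_in_group[OF q that M(2)]]
    unfolding Cv[OF unit_vec_carrier] .
  have ints: "p_integral q (?u $ j)" if "j < n" for j using M(1) v that by simp
  have "?C *\<^sub>v ?u \<in> loc_group q" using C cols u ints by (rule loc_group_mult_vec[OF qq])
  also have "?C *\<^sub>v ?u = v"
    unfolding Cv[OF u] using v q1 by (intro eq_vecI) auto
  finally show ?thesis .
qed

text \<open>
  The vectors \<open>T e\<^sub>i\<close> with \<open>i < t\<^sub>p\<close> are reached through \<open>e\<^sub>i = p\<^sup>k g - z\<close>, where \<open>g \<in> G\<^sub>A\<close> is a generator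
  attached to the characteristic and \<open>z\<close> is an integral combination of the \<open>e\<^sub>j\<close> with \<open>j \<ge> t\<^sub>p\<close>.
\<close>

lemma loc_group_image:
  assumes p: "p \<in> primes_of_mat' A" and T: "T \<in> carrier_mat n n"
    and cols: "\<And>j. tp p \<le> j \<Longrightarrow> j < n \<Longrightarrow> T *\<^sub>v unit_vec n j \<in> loc_group p"
    and approx: "\<And>g. g \<in> group_of_mat A \<Longrightarrow>
      \<exists>y\<in>carrier_vec n. (\<forall>i<n. y $ i \<in> \<int>) \<and> T *\<^sub>v g - T *\<^sub>v y \<in> loc_group p"
    and g: "g \<in> group_of_mat A"
  shows "T *\<^sub>v g \<in> loc_group p"
proof -
  have pp: "prime p" using primes_of_mat'D[OF p] by simp
  have p1: "p > 1" using pp by (rule prime_gt_1_int)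
  have Tc: "T *\<^sub>v v \<in> carrier_vec n" if "v \<in> carrier_vec n" for v using T that by simp
  have cancel: "(a - b) + b = a" if "a \<in> carrier_vec n" "b \<in> carrier_vec n" for a b :: "rat vec"
    using that by (intro eq_vecI) auto
  \<comment> \<open>With \<open>k\<close> so large that p^k T is p-integral, the correction p^k T y
    is harmless, and T c = p^k T h lies in the localization, where h = c / p^k is the
    generator.\<close>
  have unit: "T *\<^sub>v unit_vec n i \<in> loc_group p" if i: "i < n" "i < tp p" for i
  proof -
    have "\<forall>\<^sub>F k in sequentially. \<forall>a\<in>{..<n}. \<forall>b\<in>{..<n}. p_integral p (of_int p ^ k * T $$ (a, b))"
      using pp by (intro eventually_ball_finite ballI eventually_p_integral) auto
    moreover have "\<forall>\<^sub>F k in sequentially. k \<ge> (1::nat)" by (rule eventually_ge_at_top)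
    ultimately have "\<forall>\<^sub>F k in sequentially.
        (\<forall>a\<in>{..<n}. \<forall>b\<in>{..<n}. p_integral p (of_int p ^ k * T $$ (a, b))) \<and> k \<ge> 1"
      by (rule eventually_conj)
    then obtain k where k: "\<forall>a\<in>{..<n}. \<forall>b\<in>{..<n}. p_integral p (of_int p ^ k * T $$ (a, b))" "k \<ge> 1"
      using eventually_happens' sequentially_bot by blast
    define c where "c = char_trunc \<alpha> p i k"
    have c: "c \<in> carrier_vec n" by (simp add: c_def char_trunc_def)
    let ?h = "(1 / of_int p ^ k) \<cdot>\<^sub>v c"
    have h: "?h \<in> carrier_vec n" using c by simp
    have "?h \<in> group_of_mat A" unfolding c_def using char_trunc_in_group[OF p i(2) k(2)] .
    from approx[OF this] obtain y where y: "y \<in> carrier_vec n" "\<forall>i<n. y $ i \<in> \<int>"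
      "T *\<^sub>v ?h - T *\<^sub>v y \<in> loc_group p" by blast
    have "of_int p ^ k \<cdot>\<^sub>v (T *\<^sub>v y) \<in> loc_group p"
    proof (rule loc_group_p_integral[OF pp])
      show "of_int p ^ k \<cdot>\<^sub>v (T *\<^sub>v y) \<in> carrier_vec n" using Tc[OF y(1)] by simp
      fix a assume a: "a < n"
      have "of_int p ^ k \<cdot>\<^sub>v (T *\<^sub>v y) = (of_int p ^ k \<cdot>\<^sub>m T) *\<^sub>v y"
        using smult_mat_mult_vec[OF T y(1)] by simp
      moreover have "p_integral p (((of_int p ^ k \<cdot>\<^sub>m T) *\<^sub>v y) $ a)"
        using k(1) y(1,2) T a p_integral_Ints[OF pp]
        by (intro p_integral_mult_vec[OF pp _ _ y(1)]) auto
      ultimately show "p_integral p ((of_int p ^ k \<cdot>\<^sub>v (T *\<^sub>v y)) $ a)" by simp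
    qed
    moreover have "of_int p ^ k \<cdot>\<^sub>v (T *\<^sub>v ?h - T *\<^sub>v y) \<in> loc_group p"
      using loc_group_smult[OF pp y(3), of "of_int p ^ k"] p_integral_of_int[OF pp, of "p ^ k"] by simp
    ultimately have "of_int p ^ k \<cdot>\<^sub>v (T *\<^sub>v ?h - T *\<^sub>v y) + of_int p ^ k \<cdot>\<^sub>v (T *\<^sub>v y) \<in> loc_group p"
      by (intro loc_group_add[OF pp])
    also have "of_int p ^ k \<cdot>\<^sub>v (T *\<^sub>v ?h - T *\<^sub>v y) + of_int p ^ k \<cdot>\<^sub>v (T *\<^sub>v y) =
        of_int p ^ k \<cdot>\<^sub>v ((T *\<^sub>v ?h - T *\<^sub>v y) + T *\<^sub>v y)"
      using Tc[OF y(1)] Tc[OF h] by (intro smult_add_distrib_vec[symmetric]) auto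
    also have "(T *\<^sub>v ?h - T *\<^sub>v y) + T *\<^sub>v y = T *\<^sub>v ?h" using Tc[OF y(1)] Tc[OF h] by (intro cancel)
    also have "of_int p ^ k \<cdot>\<^sub>v (T *\<^sub>v ?h) = T *\<^sub>v c"
      using mult_mat_vec[OF T c, of "1 / of_int p ^ k"] p1 by (simp add: smult_smult_assoc)
    finally have 1: "T *\<^sub>v c \<in> loc_group p" .
    \<comment> \<open>c - e_i vanishes below \<open>tp p\<close>, so clearing the first columns of
      \<open>T\<close> does not change its image, while every column of \<open>T0\<close> is known
      to lie in the localization.\<close>
    define T0 where "T0 = mat n n (\<lambda>(a, b). if b < tp p then 0 else T $$ (a, b))"
    have T0: "T0 \<in> carrier_mat n n" by (simp add: T0_def)
    let ?z = "c - unit_vec n i"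
    have z: "?z \<in> carrier_vec n" using c by simp
    have z0: "?z $ j = 0" if "j < tp p" "j < n" for j
      using that i by (simp add: c_def char_trunc_def unit_vec_def)
    have "T0 *\<^sub>v unit_vec n j \<in> loc_group p" if j: "j < n" for j
    proof (cases "j < tp p")
      case True
      have "T0 *\<^sub>v unit_vec n j = 0\<^sub>v n"
        using j True by (intro eq_vecI) (auto simp: T0_def)
      then show ?thesis
        using loc_group_p_integral[OF pp, of "0\<^sub>v n"] p_integral_of_int[OF pp, of 0] by simp
    next
      case False
      have "T0 *\<^sub>v unit_vec n j = T *\<^sub>v unit_vec n j"
        using j False T by (intro eq_vecI) (auto simp: T0_def)
      then show ?thesis using cols[of j] j False by simp
    qed
    then have "T0 *\<^sub>v ?z \<in> loc_group p"
    proof (rule loc_group_mult_vec[OF pp T0 _ z])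
      fix j assume "j < n"
      then show "p_integral p (?z $ j)"
        by (intro p_integral_Ints[OF pp]) (auto simp: c_def char_trunc_def unit_vec_def)
    qed
    also have "T0 *\<^sub>v ?z = T *\<^sub>v ?z"
    proof (rule eq_vecI)
      fix a assume "a < dim_vec (T *\<^sub>v ?z)"
      then have a: "a < n" using T by simp
      have "(T0 *\<^sub>v ?z) $ a = (\<Sum>j<n. T0 $$ (a, j) * ?z $ j)"
        using a T0 z by (auto simp: scalar_prod_def atLeast0LessThan simp del: index_minus_vec)
      also have "\<dots> = (\<Sum>j<n. T $$ (a, j) * ?z $ j)"
        using a z0 by (intro sum.cong) (auto simp: T0_def)
      also have "\<dots> = (T *\<^sub>v ?z) $ a"
        using a T z by (auto simp: scalar_prod_def atLeast0LessThan simp del: index_minus_vec)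
      finally show "(T0 *\<^sub>v ?z) $ a = (T *\<^sub>v ?z) $ a" .
    qed (use T T0 in simp)
    finally have "T *\<^sub>v c - T *\<^sub>v ?z \<in> loc_group p" using 1 by (intro loc_group_minus[OF pp])
    also have "T *\<^sub>v c - T *\<^sub>v ?z = T *\<^sub>v (c - ?z)"
      using mult_minus_distrib_mat_vec[OF T c z] by simp
    also have "c - ?z = unit_vec n i" using c by (intro eq_vecI) auto
    finally show ?thesis .
  qed
  obtain y where y: "y \<in> carrier_vec n" "\<forall>i<n. y $ i \<in> \<int>" "T *\<^sub>v g - T *\<^sub>v y \<in> loc_group p"
    using approx[OF g] by blast
  have "T *\<^sub>v unit_vec n j \<in> loc_group p" if "j < n" for j
    using cols[of j] unit[of j] that by (cases "j < tp p") auto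
  then have "T *\<^sub>v y \<in> loc_group p"
    using y(2) p_integral_Ints[OF pp] by (intro loc_group_mult_vec[OF pp T _ y(1)]) auto
  then have "(T *\<^sub>v g - T *\<^sub>v y) + T *\<^sub>v y \<in> loc_group p" by (rule loc_group_add[OF pp y(3)])
  moreover have "g \<in> carrier_vec n" using g group_of_mat_iff by blast
  ultimately show ?thesis using cancel[OF Tc Tc[OF y(1)]] by simp
qed

end

end

section \<open>Stable eigenspaces and endomorphisms\<close>

lemma mat_eq_if_unit_vec:
  fixes M N :: "'a :: semiring_1 mat"
  assumes "M \<in> carrier_mat n n" "N \<in> carrier_mat n n"
    "\<And>j. j < n \<Longrightarrow> M *\<^sub>v unit_vec n j = N *\<^sub>v unit_vec n j"
  shows "M = N"
proof (rule eq_matI)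
  fix i j assume "i < dim_row N" "j < dim_col N"
  then have ij: "i < n" "j < n" using assms(2) by auto
  then show "M $$ (i, j) = N $$ (i, j)"
    using assms(3)[OF ij(2)] mult_unit_vec_index[OF assms(1) ij] mult_unit_vec_index[OF assms(2) ij]
    by simp
qed (use assms in auto)

lemma of_rat_map_of_int: "map_mat of_rat (map_mat rat_of_int M) = map_mat complex_of_int M"
  by (intro eq_matI) auto

context nonsingular_int_mat
begin

lemma group_of_mat_eventually_Ints:
  assumes "v \<in> group_of_mat A"
  shows "\<forall>\<^sub>F l in sequentially. \<forall>i<n. (qp l *\<^sub>v v) $ i \<in> \<int>"
proof -
  obtain l where v: "v \<in> carrier_vec n" and l: "\<forall>i<n. (qp l *\<^sub>v v) $ i \<in> \<int>"
    using assms group_of_mat_iff by blast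
  have "\<forall>i<n. (qp m *\<^sub>v v) $ i \<in> \<int>" if "m \<ge> l" for m
  proof -
    have "qp m *\<^sub>v v = qp (m - l) *\<^sub>v (qp l *\<^sub>v v)" using qp_add[OF v, of "m - l" l] that by simp
    then show ?thesis using Ints_mult_vec[OF pow_A qp_carrier[OF v]] l by simp
  qed
  then show ?thesis by (rule eventually_sequentiallyI)
qed

text \<open>The columns of A^(-k) lie in G_A, so a single A^l makes all their images under
  \<open>T\<close> integral; then A^l T A^(-k) is the integer matrix \<open>M\<close>. The equation
  is free of inverses so that it can be carried over to complex matrices.\<close>

lemma endomorphism_intertwining:
  assumes T: "T \<in> carrier_mat n n" and sub: "\<And>v. v \<in> group_of_mat A \<Longrightarrow> T *\<^sub>v v \<in> group_of_mat A"
  shows "\<exists>l. \<exists>M\<in>carrier_mat n n. qp l * T = map_mat rat_of_int M * qp k"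
proof -
  obtain B where B: "B \<in> carrier_mat n n"
    "\<forall>l. \<forall>v\<in>carrier_vec n. qp l *\<^sub>v (B ^\<^sub>m l *\<^sub>v v) = v \<and> B ^\<^sub>m l *\<^sub>v (qp l *\<^sub>v v) = v"
    using inverse_exists by blast
  let ?B = "B ^\<^sub>m k"
  have Bk: "?B \<in> carrier_mat n n" using B(1) by simp
  have "?B *\<^sub>v unit_vec n j \<in> group_of_mat A" if "j < n" for j
  proof -
    have "qp k *\<^sub>v (?B *\<^sub>v unit_vec n j) = unit_vec n j" using B(2) by simp
    moreover have "?B *\<^sub>v unit_vec n j \<in> carrier_vec n" by (rule mult_mat_vec_carrier[OF Bk]) simp
    ultimately show ?thesis unfolding group_of_mat_iff
      by (intro conjI exI[of _ k]) (auto simp: unit_vec_def)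
  qed
  then have "\<forall>\<^sub>F l in sequentially. \<forall>j\<in>{..<n}. \<forall>i<n. (qp l *\<^sub>v (T *\<^sub>v (?B *\<^sub>v unit_vec n j))) $ i \<in> \<int>"
    using sub by (intro eventually_ball_finite ballI group_of_mat_eventually_Ints) auto
  then obtain l where l: "\<forall>j\<in>{..<n}. \<forall>i<n. (qp l *\<^sub>v (T *\<^sub>v (?B *\<^sub>v unit_vec n j))) $ i \<in> \<int>"
    using eventually_happens' sequentially_bot by blast
  define C where "C = qp l * (T * ?B)"
  have TB: "T * ?B \<in> carrier_mat n n" using T Bk by (rule mult_carrier_mat)
  have C: "C \<in> carrier_mat n n" unfolding C_def using qp[of l] TB by (rule mult_carrier_mat)
  have Cv: "C *\<^sub>v v = qp l *\<^sub>v (T *\<^sub>v (?B *\<^sub>v v))" if "v \<in> carrier_vec n" for v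
    unfolding C_def using assoc_mult_mat_vec[OF qp[of l] TB that] assoc_mult_mat_vec[OF T Bk that] by simp
  have CI: "C $$ (i, j) \<in> \<int>" if "i < n" "j < n" for i j
  proof -
    have "C $$ (i, j) = (qp l *\<^sub>v (T *\<^sub>v (?B *\<^sub>v unit_vec n j))) $ i"
      using mult_unit_vec_index[OF C that] Cv[OF unit_vec_carrier] by simp
    moreover have "(qp l *\<^sub>v (T *\<^sub>v (?B *\<^sub>v unit_vec n j))) $ i \<in> \<int>" using l that by blast
    ultimately show ?thesis by (simp only:)
  qed
  define M where "M = mat n n (\<lambda>ij. \<lfloor>C $$ ij\<rfloor>)"
  have M: "M \<in> carrier_mat n n" by (simp add: M_def)
  have CM: "C = map_mat rat_of_int M"
    using C CI by (intro eq_matI) (auto simp: M_def)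
  have "qp l * T = C * qp k"
  proof (rule mat_eq_if_unit_vec)
    show "qp l * T \<in> carrier_mat n n" using qp[of l] T by (rule mult_carrier_mat)
    show "C * qp k \<in> carrier_mat n n" using C qp[of k] by (rule mult_carrier_mat)
    fix j assume "j < n"
    have e: "unit_vec n j \<in> carrier_vec n" by simp
    have "C * qp k *\<^sub>v unit_vec n j = C *\<^sub>v (qp k *\<^sub>v unit_vec n j)"
      using assoc_mult_mat_vec[OF C qp e] .
    also have "\<dots> = qp l *\<^sub>v (T *\<^sub>v (?B *\<^sub>v (qp k *\<^sub>v unit_vec n j)))" by (rule Cv[OF qp_carrier[OF e]])
    also have "?B *\<^sub>v (qp k *\<^sub>v unit_vec n j) = unit_vec n j" using B(2) e by blast
    also have "qp l *\<^sub>v (T *\<^sub>v unit_vec n j) = qp l * T *\<^sub>v unit_vec n j"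
      using assoc_mult_mat_vec[OF qp T e] by simp
    finally show "qp l * T *\<^sub>v unit_vec n j = C * qp k *\<^sub>v unit_vec n j" by simp
  qed
  then show ?thesis using M CM by blast
qed

lemma eigenspace_stable:
  assumes T: "T \<in> carrier_mat n n" and sub: "\<And>v. v \<in> group_of_mat A \<Longrightarrow> T *\<^sub>v v \<in> group_of_mat A"
    and E: "eigenspace_above F P p A n"
  shows "(\<lambda>v. map_mat of_rat T *\<^sub>v v) ` eigenspace_at F A P \<subseteq> eigenspace_at F A P"
proof -
  interpret E: eigenspace_above F P p A n by (rule E)
  have int: "\<exists>l. \<exists>M\<in>carrier_mat n n. map_mat complex_of_int (A ^\<^sub>m l) * map_mat of_rat T =
      map_mat of_int M * map_mat of_int (A ^\<^sub>m k)" for k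
  proof -
    obtain l M where M: "M \<in> carrier_mat n n" "qp l * T = map_mat rat_of_int M * qp k"
      using endomorphism_intertwining[OF T sub] by blast
    have "map_mat complex_of_rat (qp l * T) = map_mat of_rat (map_mat rat_of_int M * qp k)"
      using M(2) by simp
    moreover have "map_mat complex_of_rat (qp l * T) = map_mat of_rat (qp l) * map_mat of_rat T"
      using qp T by (rule of_rat_hom.mat_hom_mult)
    moreover have "map_mat complex_of_rat (map_mat rat_of_int M * qp k) =
        map_mat of_rat (map_mat rat_of_int M) * map_mat of_rat (qp k)"
      using M(1) qp by (intro of_rat_hom.mat_hom_mult) auto
    ultimately have "map_mat complex_of_int (A ^\<^sub>m l) * map_mat of_rat T =
        map_mat of_int M * map_mat of_int (A ^\<^sub>m k)"
      by (simp only: of_rat_map_of_int)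
    then show ?thesis using M(1) by blast
  qed
  have TC: "map_mat complex_of_rat T \<in> carrier_mat n n" using T by simp
  have TF: "map_mat complex_of_rat T $$ (i, j) \<in> F" if "i < n" "j < n" for i j
    using T that E.F_of_rat by simp
  show ?thesis
    unfolding E.eigenspace_at_eq_X using E.X_stable[OF TC TF int] by blast
qed

text \<open>The witness is y = A^m g, integral because \<open>m \<ge> s\<close>. Then A^m (T g - T
  y) = W g with W = A^m T (1 - A^m). An exponent N clearing the p-denominators of g is fixed first;
  m is then chosen such that W is divisible by p^N, whence W g is p-integral.\<close>

lemma eigenspace_stable_approx:
  assumes T: "T \<in> carrier_mat n n" and g: "g \<in> group_of_mat A"
    and E: "eigenspace_above F P p A n"
    and stable: "(\<lambda>v. map_mat of_rat T *\<^sub>v v) ` eigenspace_at F A P \<subseteq> eigenspace_at F A P"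
  shows "\<exists>y\<in>carrier_vec n. (\<forall>i<n. y $ i \<in> \<int>) \<and> T *\<^sub>v g - T *\<^sub>v y \<in> loc_group p"
proof -
  interpret E: eigenspace_above F P p A n by (rule E)
  let ?T = "map_mat complex_of_rat T"
  have pp: "prime p" by (rule E.prime_p)
  have p1: "p > 1" by (rule E.p_gt_1)
  have gc: "g \<in> carrier_vec n" using g group_of_mat_iff by blast
  obtain s where s: "\<forall>m\<ge>s. \<forall>i<n. (qp m *\<^sub>v g) $ i \<in> \<int>"
    using group_of_mat_eventually_Ints[OF g] unfolding eventually_sequentially by blast
  have "\<forall>\<^sub>F N in sequentially. \<forall>j\<in>{..<n}. p_integral p (of_int p ^ N * g $ j)"
    using pp by (intro eventually_ball_finite ballI eventually_p_integral) auto
  then obtain N where N: "\<forall>j\<in>{..<n}. p_integral p (of_int p ^ N * g $ j)"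
    using eventually_happens' sequentially_bot by blast
  have TX: "?T *\<^sub>v v \<in> E.X" if "v \<in> E.X" for v
    using stable that unfolding E.eigenspace_at_eq_X by blast
  have Tc: "?T \<in> carrier_mat n n" using T by simp
  have TF: "?T $$ (i, j) \<in> F" if "i < n" "j < n" for i j using T that E.F_of_rat by simp
  obtain m where m: "m \<ge> s"
    "\<forall>j<n. E.vdiv N (E.pw m (?T *\<^sub>v (unit_vec n j - E.pw m (unit_vec n j))))"
    using E.X_stable_imp_vdiv[OF Tc TF TX, of s N] by blast
  define D where "D = 1\<^sub>m n - qp m"
  have D: "D \<in> carrier_mat n n" unfolding D_def using qp[of m] by (rule minus_carrier_mat)
  define W where "W = qp m * (T * D)"
  have TD: "T * D \<in> carrier_mat n n" using T D by (rule mult_carrier_mat)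
  have W: "W \<in> carrier_mat n n" unfolding W_def using qp[of m] TD by (rule mult_carrier_mat)
  have Dv: "D *\<^sub>v v = v - qp m *\<^sub>v v" if "v \<in> carrier_vec n" for v
    unfolding D_def using that minus_mult_distrib_mat_vec[OF one_carrier_mat qp[of m] that] by simp
  have Wv: "W *\<^sub>v v = qp m *\<^sub>v (T *\<^sub>v (v - qp m *\<^sub>v v))" if "v \<in> carrier_vec n" for v
    unfolding W_def using assoc_mult_mat_vec[OF qp[of m] TD that] assoc_mult_mat_vec[OF T D that] Dv[OF that]
    by simp
  \<comment> \<open>Divisibility is available at \<open>P\<close> for complex vectors; since the
    columns of \<open>W\<close> are rational, \<open>ldiv_of_rat_iff\<close> brings it back.\<close>
  have Wint: "p_integral p (W $$ (i, j) / of_int p ^ N)" if i: "i < n" and j: "j < n" for i j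
  proof -
    let ?e = "unit_vec n j :: rat vec"
    have e: "?e \<in> carrier_vec n" by simp
    have eC: "map_vec of_rat ?e = (unit_vec n j :: complex vec)"
      by (intro eq_vecI) (auto simp: unit_vec_def)
    have hq: "map_vec complex_of_rat (qp m *\<^sub>v v) = E.pw m (map_vec of_rat v)" if "v \<in> carrier_vec n" for v
    proof -
      have "map_vec complex_of_rat (qp m *\<^sub>v v) = map_mat of_rat (qp m) *\<^sub>v map_vec of_rat v"
        using qp that by (rule of_rat_hom.mult_mat_vec_hom)
      then show ?thesis by (simp only: of_rat_map_of_int)
    qed
    have hT: "map_vec complex_of_rat (T *\<^sub>v v) = ?T *\<^sub>v map_vec of_rat v" if "v \<in> carrier_vec n" for v
      using T that by (rule of_rat_hom.mult_mat_vec_hom)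
    have hm: "map_vec complex_of_rat (a - b) = map_vec of_rat a - map_vec of_rat b"
      if "a \<in> carrier_vec n" "b \<in> carrier_vec n" for a b
      using that by (intro eq_vecI) (auto simp: of_rat_diff)
    have qe: "qp m *\<^sub>v ?e \<in> carrier_vec n" by (rule qp_carrier[OF e])
    have "map_vec complex_of_rat (W *\<^sub>v ?e) = E.pw m (?T *\<^sub>v (unit_vec n j - E.pw m (unit_vec n j)))"
      unfolding Wv[OF e] using e qe T
      by (simp only: hq hT hm eC minus_carrier_vec mult_mat_vec_carrier[OF T])
    then have "E.vdiv N (map_vec of_rat (W *\<^sub>v ?e))" using m(2) j by simp
    then have "E.ldiv N (map_vec of_rat (W *\<^sub>v ?e) $ i)" using i unfolding E.vdiv_def by blast
    moreover have "map_vec complex_of_rat (W *\<^sub>v ?e) $ i = of_rat (W $$ (i, j))"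
      using mult_unit_vec_index[OF W i j] W i by (simp del: index_mult_mat_vec)
    ultimately show ?thesis using E.ldiv_of_rat_iff by simp
  qed
  define y where "y = qp m *\<^sub>v g"
  have y: "y \<in> carrier_vec n" unfolding y_def by (rule qp_carrier[OF gc])
  have "T *\<^sub>v g - T *\<^sub>v y \<in> loc_group p"
  proof (rule loc_groupI[where l = m, OF pp])
    show "T *\<^sub>v g - T *\<^sub>v y \<in> carrier_vec n" using T gc y by simp
    fix i assume i: "i < n"
    have "qp m *\<^sub>v (T *\<^sub>v g - T *\<^sub>v y) = W *\<^sub>v g"
      unfolding Wv[OF gc] y_def[symmetric] mult_minus_distrib_mat_vec[OF T gc y] ..
    moreover have "(W *\<^sub>v g) $ i = (\<Sum>j<n. (W $$ (i, j) / of_int p ^ N) * (of_int p ^ N * g $ j))"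
      using W gc i p1 by (auto simp: scalar_prod_def atLeast0LessThan)
    moreover have "p_integral p \<dots>"
      using N by (intro p_integral_sum[OF pp] p_integral_mult[OF pp Wint[OF i]]) auto
    ultimately show "p_integral p ((qp m *\<^sub>v (T *\<^sub>v g - T *\<^sub>v y)) $ i)" by simp
  qed
  then show ?thesis using y s m(1) by (intro bexI[of _ y]) (auto simp: y_def)
qed

end

theorem theorem3p5:
  fixes A :: "int mat" and T :: "rat mat" and n :: nat and F :: "complex set"
    and \<alpha> :: "int \<Rightarrow> nat \<Rightarrow> nat \<Rightarrow> (nat \<Rightarrow> int)"
  assumes "A \<in> carrier_mat n n" and "det A \<noteq> 0" and "primes_of_mat' A \<noteq> {}"
    and "number_field F"
    and "{l. eigenvalue (map_mat complex_of_int A) l} \<subseteq> F"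
    and "is_characteristic A \<alpha>"
    and "T \<in> carrier_mat n n"
  shows "(\<lambda>v. T *\<^sub>v v) ` group_of_mat A \<subseteq> group_of_mat A \<longleftrightarrow>
    elements_mat T \<subseteq> adjoin_inverse (det A) \<and>
    (\<forall>p\<in>primes_of_mat' A.
       (\<forall>P. prime_above F p P \<longrightarrow>
          (\<lambda>v. map_mat of_rat T *\<^sub>v v) ` eigenspace_at F A P \<subseteq> eigenspace_at F A P) \<and>
       (\<forall>j\<in>{zero_mult A p..<n}. \<forall>k\<in>{zero_mult A p..<n}.
          padic_of_rat p (T $$ (k, j)) \<ominus>\<^bsub>padic_field p\<^esub>
            (\<Oplus>\<^bsub>padic_field p\<^esub>i\<in>{..<zero_mult A p}.
               padic_of_rat p (T $$ (i, j)) \<otimes>\<^bsub>padic_field p\<^esub> padic_emb p (\<alpha> p i k))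
          \<in> padic_emb p ` carrier (padic_int p)))"
    (is "?L \<longleftrightarrow> ?R1 \<and> (\<forall>p\<in>primes_of_mat' A. (\<forall>P. prime_above F p P \<longrightarrow> ?S P) \<and> ?C p)")
proof -
  interpret nonsingular_int_mat A n using assms(1,2) by unfold_locales
  note T = assms(7) and char = assms(6)
  have E: "eigenspace_above F P p A n" if "p \<in> primes_of_mat' A" "prime_above F p P" for p P
    using that assms(1,4,5) primes_of_mat'D[OF that(1)] by unfold_locales auto
  have col: "(T *\<^sub>v unit_vec n j) $ i = T $$ (i, j)" if "i < n" "j < n" for i j
    using mult_unit_vec_index[OF T that] .
  \<comment> \<open>From here on the column condition is read as integrality of the linear forms on
    the vectors T e_j.\<close>
  have cond: "?C p \<longleftrightarrow> (\<forall>j\<in>{zero_mult A p..<n}. \<forall>k\<in>{zero_mult A p..<n}.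
      form_integral \<alpha> p k (T *\<^sub>v unit_vec n j))" if p: "p \<in> primes_of_mat' A" for p
  proof (intro ball_cong refl)
    fix j k assume jk: "j \<in> {zero_mult A p..<n}" "k \<in> {zero_mult A p..<n}"
    have "(T *\<^sub>v unit_vec n j) $ k = T $$ (k, j)" "\<And>i. i < zero_mult A p \<Longrightarrow> (T *\<^sub>v unit_vec n j) $ i = T $$ (i, j)"
      using jk col by auto
    then have "form_integral \<alpha> p k (T *\<^sub>v unit_vec n j) \<longleftrightarrow>
        (\<forall>\<^sub>F M in sequentially. p_integral p (T $$ (k, j) - (\<Sum>i<zero_mult A p. T $$ (i, j) * of_int (\<alpha> p i k M))))"
      by (simp add: form_integral_def[OF char])
    then show "(padic_of_rat p (T $$ (k, j)) \<ominus>\<^bsub>padic_field p\<^esub>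
            (\<Oplus>\<^bsub>padic_field p\<^esub>i\<in>{..<zero_mult A p}.
               padic_of_rat p (T $$ (i, j)) \<otimes>\<^bsub>padic_field p\<^esub> padic_emb p (\<alpha> p i k))
          \<in> padic_emb p ` carrier (padic_int p)) = form_integral \<alpha> p k (T *\<^sub>v unit_vec n j)"
      using padic_field_combination_integral_iff[of p "zero_mult A p" "\<lambda>i. \<alpha> p i k" "T $$ (k, j)" "\<lambda>i. T $$ (i, j)"]
        alpha_closed[OF char p] primes_of_mat'D[OF p] jk by simp
  qed
  show ?thesis
  proof
    assume ?L
    then have sub: "T *\<^sub>v v \<in> group_of_mat A" if "v \<in> group_of_mat A" for v using that by blast
    have r1: ?R1
    proof
      fix r assume "r \<in> elements_mat T"
      then obtain i j where ij: "i < n" "j < n" "r = T $$ (i, j)" using T by (auto simp: elements_mat_def)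
      have "T *\<^sub>v unit_vec n j \<in> group_of_mat A" using sub unit_vec_in_group[OF ij(2)] by blast
      then obtain k where "of_int (det A) ^ k * (T *\<^sub>v unit_vec n j) $ i \<in> \<int>"
        using group_of_mat_denominator ij(1) by blast
      then show "r \<in> adjoin_inverse (det A)"
        using adjoin_inverse_iff[OF assms(2)] col[OF ij(1,2)] ij(3) by auto
    qed
    have s: "?S P" if "p \<in> primes_of_mat' A" "prime_above F p P" for p P
      using eigenspace_stable[OF T sub E[OF that]] .
    have c: "?C p" if p: "p \<in> primes_of_mat' A" for p
      unfolding cond[OF p]
      using form_integral_group[OF char p] sub unit_vec_in_group by auto
    show "?R1 \<and> (\<forall>p\<in>primes_of_mat' A. (\<forall>P. prime_above F p P \<longrightarrow> ?S P) \<and> ?C p)"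
    proof (rule conjI[OF r1], rule ballI, rule conjI)
      fix p assume p: "p \<in> primes_of_mat' A"
      show "\<forall>P. prime_above F p P \<longrightarrow> ?S P" using s[OF p] by blast
      show "?C p" using p by (rule c)
    qed
  next
    assume R: "?R1 \<and> (\<forall>p\<in>primes_of_mat' A. (\<forall>P. prime_above F p P \<longrightarrow> ?S P) \<and> ?C p)"
    show ?L
    proof
      fix w assume "w \<in> (\<lambda>v. T *\<^sub>v v) ` group_of_mat A"
      then obtain g where g: "g \<in> group_of_mat A" "w = T *\<^sub>v g" by blast
      have gc: "g \<in> carrier_vec n" using g(1) group_of_mat_iff by blast
      have wc: "w \<in> carrier_vec n" using g(2) T gc by simp
      show "w \<in> group_of_mat A"
      proof (rule group_of_mat_local[OF wc])
        fix p :: int assume pp: "prime p"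
        consider (good) "\<not> p dvd det A" | (top) "p \<in> primes_of_mat A - primes_of_mat' A"
          | (mixed) "p \<in> primes_of_mat' A" using pp by (auto simp: primes_of_mat_def)
        then show "w \<in> loc_group p"
        proof cases
          case good
          \<comment> \<open>The denominators of \<open>T\<close> and of \<open>g\<close> divide
            powers of \<open>det A\<close>, which are prime to \<open>p\<close>.\<close>
          then have nd: "\<not> p dvd det A ^ k" for k using pp by (meson prime_dvd_power)
          have TI: "p_integral p (T $$ (i, j))" if "i < n" "j < n" for i j
          proof -
            have "T $$ (i, j) \<in> elements_mat T" using T that by (auto simp: elements_mat_def intro!: bexI[of _ i] imageI)
            then obtain k where "of_int (det A) ^ k * T $$ (i, j) \<in> \<int>"
              using R[THEN conjunct1] adjoin_inverse_iff[OF assms(2)] by blast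
            then show ?thesis using p_integral_divide[OF nd[of k]] by simp
          qed
          have gI: "p_integral p (g $ i)" if "i < n" for i
          proof -
            obtain k where "of_int (det A) ^ k * g $ i \<in> \<int>"
              using group_of_mat_denominator[OF g(1)] \<open>i < n\<close> by blast
            then show ?thesis using p_integral_divide[OF nd[of k]] by simp
          qed
          show ?thesis
            using p_integral_mult_vec[OF pp T TI gc gI] unfolding g(2)[symmetric]
            by (rule loc_group_p_integral[OF pp wc])
        next
          case top
          then show ?thesis using wc by (rule loc_group_top[OF char])
        next
          case mixed
          \<comment> \<open>Any prime above \<open>p\<close> serves; its existence is what allows
            the hypothesis on eigenspaces to be applied.\<close>
          have "subfield F (class_ring :: complex ring)" using assms(4) by (simp add: number_field_def)
          then obtain P where P: "prime_above F p P" using pp by (rule prime_above_exists)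
          have SC: "(\<forall>P. prime_above F p P \<longrightarrow> ?S P) \<and> ?C p"
            using R[THEN conjunct2] mixed by (rule bspec)
          have stable: "?S P" using SC[THEN conjunct1] P by blast
          have C: "\<forall>j\<in>{zero_mult A p..<n}. \<forall>k\<in>{zero_mult A p..<n}.
              form_integral \<alpha> p k (T *\<^sub>v unit_vec n j)"
            using SC[THEN conjunct2] unfolding cond[OF mixed] .
          show ?thesis unfolding g(2)
          proof (rule loc_group_image[OF char mixed T _ _ g(1)])
            fix j assume j: "zero_mult A p \<le> j" "j < n"
            show "T *\<^sub>v unit_vec n j \<in> loc_group p"
              using C j T by (intro form_integral_loc_group[OF char mixed]) auto
          next
            fix h assume "h \<in> group_of_mat A"
            then show "\<exists>y\<in>carrier_vec n. (\<forall>i<n. y $ i \<in> \<int>) \<and> T *\<^sub>v h - T *\<^sub>v y \<in> loc_group p"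
              using eigenspace_stable_approx[OF T _ E[OF mixed P] stable] by blast
          qed
        qed
      qed
    qed
  qed
qed

end
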